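(* Let $n\ge1$ and let $K\subset\mathbb{R}^n$ be a convex body with the origin in its interior. Then $$v(K)\ \ge\ \frac{4^n(n!)^4\pi^n}{\bigl((2n)!\bigr)^2\bigl((n/2)!\bigr)^2}=\delta_n\Bigl(\frac{\pi}{2e}\Bigr)^n v(\Delta_n),$$ where $$\delta_n=\frac{8^n(n!)^6e^n}{\bigl((2n)!\bigr)^2\bigl((n/2)!\bigr)^2(n+1)^{n+1}}$$ satisfies $\delta_n\ge\frac{2e}{\pi}$ for all $n\ge1$ and $\delta_n\to\frac{2\pi}{e}$ as $n\to\infty$.
   Context: A convex body is a compact convex set with non-empty interior (not assumed centrally symmetric). For $K\subset\mathbb{R}^n$ a convex body with the origin in its interior, the polar body is $K^\circ=\{\vec{y}\in\mathbb{R}^n : \vec{x}\cdot\vec{y}\le1 \text{ for all } \vec{x}\in K\}$ and the Mahler volume is $v(K)=(\mathrm{Vol}\, K)(\mathrm{Vol}\, K^\circ)$, with $\mathrm{Vol}$ Lebesgue measure on $\mathbb{R}^n$. $\Delta_n\subset\mathbb{R}^n$ is an $n$-simplex with centroid at the origin, for which $v(\Delta_n)=(n+1)^{n+1}/(n!)^2$. For half-integers, $(n/2)!$ means $\Gamma(\frac n2+1)$. *)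

theory Defs
  imports "HOL-Analysis.Analysis"
begin

definition convex_body :: "'a::euclidean_space set \<Rightarrow> bool" where
  "convex_body K \<longleftrightarrow> compact K \<and> convex K \<and> interior K \<noteq> {}"

definition polar_body :: "'a::euclidean_space set \<Rightarrow> 'a set" where
  "polar_body K = {y. \<forall>x\<in>K. x \<bullet> y \<le> 1}"

(* "measure" is 0 on sets of infinite measure; if K is a convex body with the origin in
   its interior, then K and its polar body are both compact, so this does not occur. *)
definition mahler_volume :: "'a::euclidean_space set \<Rightarrow> real" where
  "mahler_volume K = measure lebesgue K * measure lebesgue (polar_body K)"

(* Centre of mass of the uniform distribution on S, for bounded S of positive measure. *)
definition centroid :: "'a::euclidean_space set \<Rightarrow> 'a" where
  "centroid S = (1 / measure lebesgue S) *\<^sub>R (LINT x:S|lebesgue. x)"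

(* Gamma (n/2 + 1) is the meaning of (n/2)! also for odd n. *)
definition delta :: "nat \<Rightarrow> real" where
  "delta n = 8 ^ n * fact n ^ 6 * exp 1 ^ n
     / (fact (2 * n) ^ 2 * Gamma (real n / 2 + 1) ^ 2 * (real n + 1) ^ (n + 1))"

end

theory Submission
  imports Defs "HOL-Probability.Probability" "HOL-Real_Asymp.Real_Asymp"
begin

text \<open>
  Let \<open>N\<close> be a smooth symmetric norm on \<open>\<real>\<^sup>n\<close> with unit ball \<open>L\<close>, and let \<open>T\<close> be the gradient of \<open>N\<^sup>2 / 2\<close>. The map
  \<open>\<Phi> (u, v) = (u + v, T u - T v)\<close> is a bijection of \<open>\<real>\<^sup>2\<^sup>n\<close> that sends the set \<open>N u + N v \<le> 1\<close> into the product of \<open>L\<close>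
  and its polar body, so the Mahler volume of \<open>L\<close> is at least \<open>\<mu> {N u + N v \<le> 1}\<close>, where \<open>\<mu>\<close> is the pullback of
  Lebesgue measure. As \<open>\<mu>\<close> is homogeneous of degree \<open>n\<close> in \<open>u\<close> and in \<open>v\<close> separately, this mass is a known multiple of
  the integral of \<open>exp (- (N u)\<^sup>2 - (N v)\<^sup>2)\<close> with respect to \<open>\<mu>\<close>.

  The latter is at least \<open>(2 pi)\<^sup>n\<close>. Indeed, the integral of \<open>exp (\<i> x \<bullet> y)\<close> over \<open>\<real>\<^sup>2\<^sup>n\<close>, regularised by a Gaussian, is
  \<open>(2 pi)\<^sup>n\<close>. Pulled back along \<open>\<Phi>\<close>, the exponent is \<open>\<i> ((N u)\<^sup>2 - (N v)\<^sup>2 + v \<bullet> T u - u \<bullet> T v)\<close>, and rotating \<open>u\<close> and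
  \<open>v\<close> by opposite angles up to \<open>pi / 4\<close>, which does not change the integral by analytic continuation from real rescalings,
  turns it into \<open>- (N u)\<^sup>2 - (N v)\<^sup>2\<close> plus an imaginary term. This replaces the Gauss linking integral of Kuperberg's proof.

  Approximation extends the resulting bound to all symmetric bodies. An arbitrary body \<open>K\<close> is compared with \<open>(K - K) / 2\<close>:
  the Rogers-Shephard inequality bounds its volume, and convexity of \<open>exp\<close> bounds the volume of its polar.
\<close>

section \<open>The substitution associated with a smooth norm\<close>

text \<open>Without the Gaussian factor the oscillatory integral does not converge absolutely, and
  this shapes the middle of the proof. Under the rotation the terms of the exponent in u alone and
  in v alone acquire phases, while the mixed terms stay fixed because u and v turn oppositely. So
  the Gaussian does not remain one: its diagonal part is multiplied by a cosine, its mixed part is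
  not. Decay survives along the whole way because the real part gained from N(u)^2 and N(v)^2
  outweighs the loss once the Gaussian parameter e is small against the constant comparing N(u)^2
  with |u|^2 + |T u|^2.

  The points u and v themselves stay real, so \<open>T\<close> need not be analytic: the phase is a
  complex parameter of the integrand, and only positive rescalings (r u, v / r) act on points.

  For the Euclidean norm the Jacobian is constantly 2^n and the bound (2 pi)^n is attained. The
  final constant is (2 pi)^n (n!)^2 / ((2n)! Gamma(n/2 + 1)^2) times 2^n (n!)^2 / (2n)!, the last
  factor being the price of the difference body.\<close>

text \<open>It suffices to compare the measures on boxes. Off \<open>F\<close> the preimage of a box
  is mapped injectively onto the box minus finitely many points, and both sets lost are null. The
  set \<open>F\<close> admits gradients that fail to be differentiable at single points.\<close>

lemma distr_density_det_eq_lborel: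
  fixes g :: "real^'n::{finite,wellorder} \<Rightarrow> real^'n::_"
  assumes bij: "bij g" and F: "finite F"
    and der: "\<And>u. u \<notin> F \<Longrightarrow> (g has_derivative g' u) (at u)"
    and g[measurable]: "g \<in> borel_measurable borel"
    and J[measurable]: "(\<lambda>u. det (matrix (g' u))) \<in> borel_measurable borel"
  shows "distr (density lborel (\<lambda>u. ennreal \<bar>det (matrix (g' u))\<bar>)) lborel g = lborel"
proof (rule lborel_eqI[symmetric])
  fix l u :: "(real, 'n) vec"
  assume lu: "\<And>b. b \<in> Basis \<Longrightarrow> l \<bullet> b \<le> u \<bullet> b"
  define S where "S = g -` box l u - F"
  have gm: "g -` box l u \<in> sets borel"
    using measurable_sets_borel[OF g, of "box l u"] by simp
  have S[measurable]: "S \<in> sets borel" unfolding S_def using gm F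
    by (intro sets.Diff) (auto intro: borel_closed finite_imp_closed)
  have gS: "g ` S = box l u - g ` F"
    unfolding S_def using bij by (force simp: bij_def inj_def surj_def)
  have negl: "negligible (g ` F)" using F by (intro negligible_finite) auto
  have 1: "g ` S \<in> lmeasurable" unfolding gS
    using negl by (intro fmeasurable_Diff lmeasurable_box fmeasurableD negligible_imp_measurable)
  have 2: "measure lebesgue (g ` S) = measure lebesgue (box l u)" unfolding gS
    using negl by (intro measure_Diff_null_set) (auto simp: negligible_iff_null_sets)
  have "((\<lambda>x. \<bar>det (matrix (g' x))\<bar>) has_integral measure lebesgue (box l u)) S"
    using has_measure_differentiable_image[of S g g' "measure lebesgue (box l u)"] 1 2 S
    by (metis (no_types, lifting) S_def DiffD2 der bij bij_is_inj has_derivative_at_withinI inj_on_subset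
        sets_completionI_sets sets_lborel top_greatest)
  then have 3: "(\<integral>\<^sup>+x. ennreal \<bar>det (matrix (g' x))\<bar> * indicator S x \<partial>lborel) = measure lebesgue (box l u)"
    using nn_integral_has_integral_lebesgue'[where f="\<lambda>x. \<bar>det (matrix (g' x))\<bar>" and I="measure lebesgue (box l u)" and \<Omega>=S]
    by simp
  have "emeasure (distr (density lborel (\<lambda>u. ennreal \<bar>det (matrix (g' u))\<bar>)) lborel g) (box l u)
      = (\<integral>\<^sup>+x. ennreal \<bar>det (matrix (g' x))\<bar> * indicator (g -` box l u) x \<partial>lborel)"
    using gm by (simp add: emeasure_distr emeasure_density)
  also have "\<dots> = (\<integral>\<^sup>+x. ennreal \<bar>det (matrix (g' x))\<bar> * indicator S x \<partial>lborel)"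
  proof (rule nn_integral_cong_AE)
    have "AE x in lborel. x \<notin> F"
      using F by (intro AE_not_in) (auto simp: finite_imp_null_set_lborel)
    then show "AE x in lborel. ennreal \<bar>det (matrix (g' x))\<bar> * indicator (g -` box l u) x
        = ennreal \<bar>det (matrix (g' x))\<bar> * indicator S x"
      by eventually_elim (auto simp: S_def indicator_def)
  qed
  also have "\<dots> = measure lebesgue (box l u)" by (rule 3)
  also have "\<dots> = (\<Prod>b\<in>Basis. (u - l) \<bullet> b)"
    using lu by (simp add: measure_lborel_box_eq)
  finally show "emeasure (distr (density lborel (\<lambda>u. ennreal \<bar>det (matrix (g' u))\<bar>)) lborel g) (box l u)
      = ennreal (\<Prod>b\<in>Basis. (u - l) \<bullet> b)" .
qed simp


section \<open>Measurability of projections, coordinates and determinants\<close>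

lemma measurable_fst_borel [measurable (raw)]:
  fixes f :: "'c \<Rightarrow> 'a::second_countable_topology \<times> 'b::second_countable_topology"
  assumes "f \<in> M \<rightarrow>\<^sub>M borel" shows "(\<lambda>x. fst (f x)) \<in> M \<rightarrow>\<^sub>M borel"
  by (rule measurable_compose[OF assms]) (intro borel_measurable_continuous_onI continuous_intros)

lemma measurable_snd_borel [measurable (raw)]:
  fixes f :: "'c \<Rightarrow> 'a::second_countable_topology \<times> 'b::second_countable_topology"
  assumes "f \<in> M \<rightarrow>\<^sub>M borel" shows "(\<lambda>x. snd (f x)) \<in> M \<rightarrow>\<^sub>M borel"
  by (rule measurable_compose[OF assms]) (intro borel_measurable_continuous_onI continuous_intros)

lemma measurable_vec_nth:
  fixes f :: "'c \<Rightarrow> real^'n"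
  assumes "f \<in> M \<rightarrow>\<^sub>M borel" shows "(\<lambda>x. f x $ i) \<in> M \<rightarrow>\<^sub>M borel"
  by (rule measurable_compose[OF assms]) (intro borel_measurable_continuous_onI continuous_intros)

lemma measurable_det:
  fixes f :: "'c \<Rightarrow> real^'n^'n"
  assumes "\<And>i j. (\<lambda>x. f x $ i $ j) \<in> borel_measurable M"
  shows "(\<lambda>x. det (f x)) \<in> borel_measurable M"
  unfolding det_def
  by (intro borel_measurable_sum borel_measurable_times borel_measurable_const borel_measurable_prod assms)

text \<open>\<open>T\<close> is the gradient of \<open>N\<^sup>2 / 2\<close> and \<open>A\<close> its Hessian. The Hessian is homogeneous of degree 0, so it
  does not exist at the origin, where \<open>A\<close> has the junk value 0.\<close>
locale smooth_norm =
  fixes N :: "real^'n::{finite,wellorder} \<Rightarrow> real"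
    and T :: "real^'n::_ \<Rightarrow> real^'n::_"
    and A :: "real^'n::_ \<Rightarrow> real^'n::_ \<Rightarrow> real^'n::_"
    and \<eta> :: real
  assumes \<eta>_pos: "\<eta> > 0"
    and N_nonneg: "0 \<le> N u"
    and N_scale: "N (r *\<^sub>R u) = \<bar>r\<bar> * N u"
    and T_scale: "T (r *\<^sub>R u) = r *\<^sub>R T u"
    and inner_T: "u \<bullet> T u = (N u)\<^sup>2"
    and T_le: "x \<bullet> T u \<le> N x * N u"
    and N_deriv: "((\<lambda>x. (N x)\<^sup>2 / 2) has_derivative (\<lambda>h. T u \<bullet> h)) (at u)"
    and T_deriv: "u \<noteq> 0 \<Longrightarrow> (T has_derivative A u) (at u)"
    and T_strong_mono: "\<eta> * (norm (u - w))\<^sup>2 \<le> (T u - T w) \<bullet> (u - w)"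
    and A_zero: "A 0 = (\<lambda>h. 0)"
begin

lemma T_zero [simp]: "T 0 = 0"
  using T_scale[of 0 0] by simp

lemma N_zero [simp]: "N 0 = 0"
  using N_scale[of 0 0] by simp

lemma N_ge: "\<eta> * (norm u)\<^sup>2 \<le> (N u)\<^sup>2"
  using T_strong_mono[of u 0] inner_T[of u] by (simp add: inner_commute)

lemma continuous_on_N: "continuous_on S N"
proof -
  have "isCont (\<lambda>x. (N x)\<^sup>2 / 2) u" for u
    using N_deriv[of u] by (rule has_derivative_continuous)
  then have "continuous_on UNIV (\<lambda>x. (N x)\<^sup>2 / 2)"
    by (simp add: continuous_at_imp_continuous_on)
  then have "continuous_on UNIV (\<lambda>x. sqrt (2 * ((N x)\<^sup>2 / 2)))"
    by (rule continuous_on_real_sqrt[OF continuous_on_mult_left])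
  moreover have "(\<lambda>x. sqrt (2 * ((N x)\<^sup>2 / 2))) = N"
    using N_nonneg by (auto simp: fun_eq_iff)
  ultimately show ?thesis by (metis continuous_on_subset top_greatest)
qed

lemma N_bound: obtains C where "C > 0" "\<And>u. N u \<le> C * norm u"
proof -
  have "compact (N ` sphere 0 1)"
    by (intro compact_continuous_image continuous_on_N) simp
  then have "bounded (N ` sphere 0 1)" by (rule compact_imp_bounded)
  then obtain C where C: "C > 0" "\<And>u. norm u = 1 \<Longrightarrow> \<bar>N u\<bar> \<le> C"
    unfolding bounded_pos by auto
  have "N u \<le> C * norm u" for u
  proof (cases "u = 0")
    case False
    have "N ((1 / norm u) *\<^sub>R u) \<le> C"
      using C(2)[of "(1 / norm u) *\<^sub>R u"] False by auto
    then show ?thesis using False unfolding N_scale by (simp add: field_simps)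
  qed simp
  with C(1) show ?thesis by (rule that)
qed

text \<open>\<open>T_le\<close> with \<open>T u\<close> in place of \<open>x\<close> bounds |T u|^2
  by N(T u) N(u), and one factor |T u| cancels.\<close>

lemma T_bound: obtains C where "C > 0" "\<And>u. norm (T u) \<le> C * norm u"
proof -
  obtain C where C: "C > 0" "\<And>u. N u \<le> C * norm u" using N_bound by blast
  have "norm (T u) \<le> C\<^sup>2 * norm u" for u
  proof (cases "T u = 0")
    case False
    have "(norm (T u))\<^sup>2 = T u \<bullet> T u" by (simp add: power2_norm_eq_inner)
    also have "\<dots> \<le> N (T u) * N u" by (rule T_le)
    also have "\<dots> \<le> (C * norm (T u)) * (C * norm u)"
      using C N_nonneg by (intro mult_mono) auto
    finally have "norm (T u) * norm (T u) \<le> norm (T u) * (C\<^sup>2 * norm u)"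
      by (simp add: power2_eq_square mult_ac)
    then show ?thesis using False by simp
  qed (use C in simp)
  with C(1) show ?thesis by (intro that[of "C\<^sup>2"]) auto
qed

lemma continuous_on_T: "continuous_on S T"
proof -
  have "isCont T u" for u
  proof (cases "u = 0")
    case True
    obtain C where C: "C > 0" "\<And>u. norm (T u) \<le> C * norm u" using T_bound by blast
    have "(T \<longlongrightarrow> 0) (at 0)"
    proof (rule tendsto_0_le[where K=C])
      show "((\<lambda>u. u) \<longlongrightarrow> 0) (at (0::(real,'n) vec))" by (rule tendsto_ident_at)
      show "\<forall>\<^sub>F x in at 0. norm (T x) \<le> norm x * C"
        using C(2) by (auto simp: mult.commute)
    qed
    with True show ?thesis by (simp add: isCont_def)
  next
    case False
    then show ?thesis using T_deriv has_derivative_continuous by blast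
  qed
  then show ?thesis by (simp add: continuous_at_imp_continuous_on)
qed

lemma measurable_T [measurable]: "T \<in> borel_measurable borel"
  by (intro borel_measurable_continuous_onI continuous_on_T)

lemma measurable_N [measurable]: "N \<in> borel_measurable borel"
  by (intro borel_measurable_continuous_onI continuous_on_N)

text \<open>\<open>A\<close> is known only as a pointwise derivative, so each directional value is
  obtained as a limit of the measurable difference quotients \<open>q k\<close> with steps 1/(k +
  1). The prescribed value at the origin makes this limit correct there too.\<close>

lemma measurable_A [measurable]: "(\<lambda>u. A u h) \<in> borel_measurable borel"
proof -
  define q where "q k u = (if u = 0 then 0 else real (Suc k) *\<^sub>R (T (u + (1 / real (Suc k)) *\<^sub>R h) - T u))" for k u
  have box_mass: "q k \<in> borel_measurable borel" for k
    unfolding q_def by measurable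
  have "(\<lambda>k. q k u) \<longlonglongrightarrow> A u h" for u
  proof (cases "u = 0")
    case True
    then show ?thesis by (simp add: q_def A_zero)
  next
    case False
    have lin: "linear (A u)" using T_deriv[OF False] has_derivative_linear by blast
    have "((\<lambda>t::real. u + t *\<^sub>R h) has_derivative (\<lambda>t. t *\<^sub>R h)) (at 0)"
      by (auto intro!: derivative_eq_intros)
    moreover have "(T has_derivative A u) (at (u + (0::real) *\<^sub>R h))"
      using T_deriv[OF False] by simp
    ultimately have "((\<lambda>t. T (u + t *\<^sub>R h)) has_derivative (\<lambda>t. A u (t *\<^sub>R h))) (at 0)"
      by (rule has_derivative_compose)
    then have "((\<lambda>t. norm (T (u + t *\<^sub>R h) - T u - t *\<^sub>R A u h) / norm t) \<longlongrightarrow> 0) (at 0)"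
      using lin by (simp add: has_derivative_at linear_cmul)
    moreover have "\<forall>\<^sub>F t in at 0. norm (T (u + t *\<^sub>R h) - T u - t *\<^sub>R A u h) / norm t
        = norm ((T (u + t *\<^sub>R h) - T u) /\<^sub>R t - A u h)"
    proof (rule eventually_at_filter[THEN iffD2, OF always_eventually], intro allI impI)
      fix t :: real assume "t \<noteq> 0"
      then have "(T (u + t *\<^sub>R h) - T u) /\<^sub>R t - A u h = (T (u + t *\<^sub>R h) - T u - t *\<^sub>R A u h) /\<^sub>R t"
        by (simp add: scaleR_right_diff_distrib)
      then show "norm (T (u + t *\<^sub>R h) - T u - t *\<^sub>R A u h) / norm t
        = norm ((T (u + t *\<^sub>R h) - T u) /\<^sub>R t - A u h)"
        by (simp add: divide_inverse mult.commute)
    qed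
    ultimately have "((\<lambda>t. norm ((T (u + t *\<^sub>R h) - T u) /\<^sub>R t - A u h)) \<longlongrightarrow> 0) (at 0)"
      by (rule Lim_transform_eventually)
    then have "((\<lambda>t. (T (u + t *\<^sub>R h) - T u) /\<^sub>R t) \<longlongrightarrow> A u h) (at 0)"
      by (rule LIM_zero_cancel[OF tendsto_norm_zero_cancel])
    moreover have "filterlim (\<lambda>k. 1 / real (Suc k)) (at 0) sequentially"
      unfolding filterlim_at using LIMSEQ_inverse_real_of_nat by (auto simp: inverse_eq_divide)
    ultimately have "(\<lambda>k. (T (u + (1 / real (Suc k)) *\<^sub>R h) - T u) /\<^sub>R (1 / real (Suc k))) \<longlonglongrightarrow> A u h"
      by (rule filterlim_compose)
    then show ?thesis using False by (simp add: q_def)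
  qed
  then show ?thesis by (intro borel_measurable_LIMSEQ_metric[OF box_mass]) auto
qed

text \<open>Differentiating T(r x) directly and through homogeneity gives the same linear map. Since
  the Hessian has degree 0, \<open>jac\<close> will not change when u and v are rescaled by
  independent positive factors.\<close>

lemma A_scale: assumes "r > 0" shows "A (r *\<^sub>R u) = A u"
proof (cases "u = 0")
  case False
  have "((\<lambda>x. T (r *\<^sub>R x)) has_derivative (\<lambda>h. A (r *\<^sub>R u) (r *\<^sub>R h))) (at u)"
    using assms False by (intro has_derivative_compose[OF _ T_deriv]) (auto intro!: derivative_eq_intros)
  moreover have "((\<lambda>x. T (r *\<^sub>R x)) has_derivative (\<lambda>h. r *\<^sub>R A u h)) (at u)"
    unfolding T_scale using T_deriv[OF False] by (intro derivative_eq_intros) auto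
  ultimately have "(\<lambda>h. A (r *\<^sub>R u) (r *\<^sub>R h)) = (\<lambda>h. r *\<^sub>R A u h)"
    by (rule has_derivative_unique)
  moreover have "linear (A (r *\<^sub>R u))"
    using T_deriv[of "r *\<^sub>R u"] False assms has_derivative_linear by auto
  ultimately show ?thesis using assms
    by (auto simp: fun_eq_iff linear_cmul dest!: spec)
qed simp

text \<open>The map is the gradient of the strongly convex function (N u)^2 / 2 + (N (x - u))^2 / 2
  of u: strong monotonicity gives injectivity, coercivity gives preimages. It is the second
  component of \<open>\<Phi>\<close> on the fibre u + v = x.\<close>

lemma bij_grad_diff: "bij (\<lambda>u. T u - T (x - u))"
proof (rule bijI)
  show "inj (\<lambda>u. T u - T (x - u))"
  proof (rule injI)
    fix u w assume eq: "T u - T (x - u) = T w - T (x - w)"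
    have "\<eta> * (norm (u - w))\<^sup>2 \<le> (T u - T w) \<bullet> (u - w)" by (rule T_strong_mono)
    also have "T u - T w = T (x - u) - T (x - w)" using eq by (simp add: algebra_simps)
    also have "(T (x - u) - T (x - w)) \<bullet> (u - w) = - ((T (x - u) - T (x - w)) \<bullet> ((x - u) - (x - w)))"
      by (simp add: inner_diff_right)
    also have "\<dots> \<le> 0"
      using T_strong_mono[of "x - u" "x - w"] \<eta>_pos
      by (smt (verit) mult_nonneg_nonneg zero_le_power2)
    finally have "(norm (u - w))\<^sup>2 \<le> 0" using \<eta>_pos by (simp add: mult_le_0_iff)
    then show "u = w" by simp
  qed
  show "surj (\<lambda>u. T u - T (x - u))"
    \<comment> \<open>a solution of \<open>T u - T (x - u) = y\<close> is a minimiser of the function \<open>h\<close> below\<close>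
    unfolding surj_def
  proof (rule allI)
    fix y
    define h where "h u = (N u)\<^sup>2 / 2 + (N (x - u))\<^sup>2 / 2 - y \<bullet> u" for u
    \<comment> \<open>With this radius, \<eta> |w| exceeds 2 |y| + (N x)^2 whenever |w| > R, and R
      \<ge> 1 allows (N x)^2 to be multiplied by |w|. So the quadratic growth of N^2 keeps
      \<open>h\<close> above \<open>h 0\<close> outside the ball.\<close>
    define R where "R = (2 * norm y + (N x)\<^sup>2 + 1) / \<eta> + 1"
    have R1: "R \<ge> 1" unfolding R_def using \<eta>_pos by (simp)
    have hcont: "continuous_on (cball 0 R) h" unfolding h_def
      by (intro continuous_intros continuous_on_compose2[OF continuous_on_N]) auto
    obtain u where u: "u \<in> cball 0 R" "\<And>w. w \<in> cball 0 R \<Longrightarrow> h u \<le> h w"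
      using continuous_attains_inf[OF compact_cball _ hcont] R1 by auto
    have out: "h 0 < h w" if "w \<notin> cball 0 R" for w
    proof -
      have w: "norm w > R" using that by simp
      have "R * \<eta> = 2 * norm y + (N x)\<^sup>2 + 1 + \<eta>" unfolding R_def using \<eta>_pos by (simp add: field_simps)
      then have "2 * norm y + (N x)\<^sup>2 < R * \<eta>" using \<eta>_pos by simp
      also have "\<dots> < norm w * \<eta>" using w \<eta>_pos by simp
      finally have 1: "2 * norm y + (N x)\<^sup>2 < \<eta> * norm w" by (simp add: mult.commute)
      have "(N x)\<^sup>2 \<le> (N x)\<^sup>2 * norm w"
        using w R1 mult_left_mono[of 1 "norm w" "(N x)\<^sup>2"] by simp
      then have "(N x)\<^sup>2 + 2 * norm y * norm w \<le> (2 * norm y + (N x)\<^sup>2) * norm w" 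
        by (simp add: algebra_simps)
      also have "\<dots> < \<eta> * norm w * norm w"
        using 1 w R1 by (intro mult_strict_right_mono) auto
      also have "\<dots> \<le> (N w)\<^sup>2" using N_ge[of w] by (simp add: power2_eq_square mult_ac)
      finally have "(N x)\<^sup>2 / 2 + norm y * norm w < (N w)\<^sup>2 / 2" by simp
      moreover have "y \<bullet> w \<le> norm y * norm w" by (rule norm_cauchy_schwarz)
      ultimately have "(N x)\<^sup>2 / 2 + y \<bullet> w < (N w)\<^sup>2 / 2 + (N (x - w))\<^sup>2 / 2"
        using zero_le_power2[of "N (x - w)"] by linarith
      then show ?thesis unfolding h_def by simp
    qed
    have min: "h u \<le> h w" for w
      using u(2)[of w] u(2)[of 0] out[of w] R1 by force
    have der: "(h has_derivative (\<lambda>k. T u \<bullet> k + T (x - u) \<bullet> (- k) - y \<bullet> k)) (at u)"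
      unfolding h_def
      by (intro derivative_intros N_deriv has_derivative_compose[where f="\<lambda>u. x - u" and f'="\<lambda>k. - k" and g="\<lambda>z. (N z)\<^sup>2 / 2", OF _ N_deriv[of "x - u"]])
         (auto intro!: derivative_eq_intros)
    have "(\<lambda>k. T u \<bullet> k + T (x - u) \<bullet> (- k) - y \<bullet> k) = (\<lambda>k. 0)"
      by (rule differential_zero_maxmin[OF _ _ der, of UNIV]) (use min in auto)
    then have "(T u - T (x - u) - y) \<bullet> k = 0" for k
      by (metis (no_types) inner_diff_left inner_minus_right diff_conv_add_uminus fun_cong)
    then have "T u - T (x - u) - y = 0" by (metis inner_eq_zero_iff)
    then show "\<exists>u. y = T u - T (x - u)" by (intro exI[of _ u]) simp
  qed
qed

text \<open>The Jacobian of \<open>\<Phi>\<close>, up to sign.\<close>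
definition jac :: "(real,'n) vec \<times> (real,'n) vec \<Rightarrow> real" where
  "jac = (\<lambda>(u, v). \<bar>det (matrix (\<lambda>h. A u h + A v h))\<bar>)"

definition \<Phi> :: "(real,'n) vec \<times> (real,'n) vec \<Rightarrow> (real,'n) vec \<times> (real,'n) vec" where
  "\<Phi> = (\<lambda>(u, v). (u + v, T u - T v))"

definition \<mu> :: "((real,'n) vec \<times> (real,'n) vec) measure" where
  "\<mu> = density lborel (\<lambda>p. ennreal (jac p))"

lemma measurable_jac [measurable]: "jac \<in> borel_measurable borel"
  unfolding jac_def case_prod_beta matrix_def
  by (intro borel_measurable_abs measurable_det)
     (auto intro!: borel_measurable_add measurable_vec_nth measurable_compose[OF _ measurable_A]
        measurable_fst_borel measurable_snd_borel)

lemma measurable_\<Phi> [measurable]: "\<Phi> \<in> borel \<rightarrow>\<^sub>M borel"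
  unfolding \<Phi>_def case_prod_beta by measurable

lemma sets_\<mu> [simp, measurable_cong]: "sets \<mu> = sets borel"
  by (simp add: \<mu>_def)

lemma space_\<mu> [simp]: "space \<mu> = UNIV"
  by (simp add: \<mu>_def)

lemma nn_integral_\<mu>:
  assumes [measurable]: "f \<in> borel_measurable borel"
  shows "(\<integral>\<^sup>+p. f p \<partial>\<mu>) = (\<integral>\<^sup>+p. ennreal (jac p) * f p \<partial>lborel)"
  unfolding \<mu>_def by (simp add: nn_integral_density)

text \<open>For fixed \<open>x = u + v\<close> the map \<open>u \<mapsto> T u - T (x - u)\<close> is a bijection whose Jacobian is \<open>jac (u, x - u)\<close>,
  so the substitution is carried out in \<open>v\<close> first and in \<open>u\<close> afterwards.\<close>
lemma distr_\<mu>_\<Phi>: "distr \<mu> lborel \<Phi> = lborel"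
proof (rule measure_eqI)
  fix S assume "S \<in> sets (distr \<mu> lborel \<Phi>)"
  then have S[measurable]: "S \<in> sets borel" by simp
  let ?f = "indicator S :: _ \<Rightarrow> ennreal"
  have [measurable]: "(\<lambda>(u, v). ennreal (jac (u, v)) * ?f (u + v, T u - T v)) \<in> borel_measurable (lborel \<Otimes>\<^sub>M lborel)"
    unfolding lborel_prod by measurable
  have [measurable]: "(\<lambda>(x, u). ennreal (jac (u, x - u)) * ?f (x, T u - T (x - u))) \<in> borel_measurable (lborel \<Otimes>\<^sub>M lborel)"
    unfolding lborel_prod by measurable
  have [measurable]: "(\<lambda>(x, y). ?f (x, y)) \<in> borel_measurable (lborel \<Otimes>\<^sub>M lborel)"
    unfolding lborel_prod by measurable
  have "emeasure (distr \<mu> lborel \<Phi>) S = (\<integral>\<^sup>+p. ?f (\<Phi> p) \<partial>\<mu>)"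
    using nn_integral_distr[of \<Phi> \<mu> lborel ?f] by simp
  also have "\<dots> = (\<integral>\<^sup>+p. ennreal (jac p) * ?f (\<Phi> p) \<partial>lborel)"
    by (rule nn_integral_\<mu>) measurable
  also have "\<dots> = (\<integral>\<^sup>+u. \<integral>\<^sup>+v. ennreal (jac (u, v)) * ?f (u + v, T u - T v) \<partial>lborel \<partial>lborel)"
    unfolding lborel_prod[symmetric]
    by (subst lborel.nn_integral_fst[symmetric]) (simp add: lborel_prod, auto simp: \<Phi>_def case_prod_beta)
  also have "\<dots> = (\<integral>\<^sup>+u. \<integral>\<^sup>+x. ennreal (jac (u, x - u)) * ?f (x, T u - T (x - u)) \<partial>lborel \<partial>lborel)"
  proof (rule nn_integral_cong)
    fix u
    have "(\<integral>\<^sup>+v. ennreal (jac (u, v)) * ?f (u + v, T u - T v) \<partial>lborel)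
        = (\<integral>\<^sup>+v. ennreal (jac (u, v)) * ?f (u + v, T u - T v) \<partial>distr lborel borel ((+) (-u)))"
      by (simp add: lborel_distr_plus)
    also have "\<dots> = (\<integral>\<^sup>+x. ennreal (jac (u, x - u)) * ?f (x, T u - T (x - u)) \<partial>lborel)"
      by (subst nn_integral_distr) auto
    finally show "(\<integral>\<^sup>+v. ennreal (jac (u, v)) * ?f (u + v, T u - T v) \<partial>lborel)
       = (\<integral>\<^sup>+x. ennreal (jac (u, x - u)) * ?f (x, T u - T (x - u)) \<partial>lborel)" .
  qed
  also have "\<dots> = (\<integral>\<^sup>+x. \<integral>\<^sup>+u. ennreal (jac (u, x - u)) * ?f (x, T u - T (x - u)) \<partial>lborel \<partial>lborel)"
    by (rule lborel_pair.Fubini') measurable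
  also have "\<dots> = (\<integral>\<^sup>+x. \<integral>\<^sup>+y. ?f (x, y) \<partial>lborel \<partial>lborel)"
  proof (rule nn_integral_cong)
    fix x
    let ?g = "\<lambda>u. T u - T (x - u)"
    have d: "distr (density lborel (\<lambda>u. ennreal \<bar>det (matrix (\<lambda>h. A u h + A (x - u) h))\<bar>)) lborel ?g = lborel"
    \<comment> \<open>The exceptional points are those where u or x - u is the origin, at which
      \<open>T\<close> has no derivative assumed.\<close>
    proof (rule distr_density_det_eq_lborel[where F="{0, x}"])
      fix u assume "u \<notin> {0, x}"
      then have u: "u \<noteq> 0" "x - u \<noteq> 0" by auto
      have lin: "linear (A (x - u))" using T_deriv[OF u(2)] has_derivative_linear by blast
      have "((\<lambda>u. T (x - u)) has_derivative (\<lambda>h. A (x - u) (- h))) (at u)"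
        by (intro has_derivative_compose[where g=T and f="\<lambda>u. x - u", OF _ T_deriv[OF u(2)]]) (auto intro!: derivative_eq_intros)
      then have "((\<lambda>u. T u - T (x - u)) has_derivative (\<lambda>h. A u h - A (x - u) (- h))) (at u)"
        by (intro has_derivative_diff T_deriv u)
      then show "(?g has_derivative (\<lambda>h. A u h + A (x - u) h)) (at u)"
        using lin by (simp add: linear_neg)
    next
      show "(\<lambda>u. det (matrix (\<lambda>h. A u h + A (x - u) h))) \<in> borel_measurable borel"
        unfolding matrix_def
        by (intro measurable_det)
           (auto intro!: borel_measurable_add measurable_vec_nth measurable_compose[OF _ measurable_A])
    next
      show "bij ?g" by (rule bij_grad_diff)
    next
      show "finite {0, x}" by simp
    next
      show "?g \<in> borel_measurable borel" by measurable
    qed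
    have "(\<integral>\<^sup>+y. ?f (x, y) \<partial>lborel) = (\<integral>\<^sup>+y. ?f (x, y) \<partial>distr (density lborel (\<lambda>u. ennreal \<bar>det (matrix (\<lambda>h. A u h + A (x - u) h))\<bar>)) lborel ?g)"
      unfolding d ..
    also have "\<dots> = (\<integral>\<^sup>+u. ?f (x, ?g u) \<partial>density lborel (\<lambda>u. ennreal \<bar>det (matrix (\<lambda>h. A u h + A (x - u) h))\<bar>))"
      by (subst nn_integral_distr) auto
    also have "\<dots> = (\<integral>\<^sup>+u. ennreal (jac (u, x - u)) * ?f (x, ?g u) \<partial>lborel)"
    proof (subst nn_integral_density)
      have "(\<lambda>u. jac (u, x - u)) \<in> borel_measurable lborel"
        by (rule measurable_compose[OF _ measurable_jac]) measurable
      then show "(\<lambda>u. ennreal \<bar>det (matrix (\<lambda>h. A u h + A (x - u) h))\<bar>) \<in> borel_measurable lborel"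
        unfolding jac_def prod.case by (rule measurable_compose[OF _ measurable_ennreal])
      show "(\<lambda>u. ?f (x, ?g u)) \<in> borel_measurable lborel"
        by measurable
      show "(\<integral>\<^sup>+u. ennreal \<bar>det (matrix (\<lambda>h. A u h + A (x - u) h))\<bar> * ?f (x, ?g u) \<partial>lborel)
          = (\<integral>\<^sup>+u. ennreal (jac (u, x - u)) * ?f (x, ?g u) \<partial>lborel)"
        unfolding jac_def prod.case ..
    qed
    finally show "(\<integral>\<^sup>+u. ennreal (jac (u, x - u)) * ?f (x, ?g u) \<partial>lborel) = (\<integral>\<^sup>+y. ?f (x, y) \<partial>lborel)" ..
  qed
  also have "\<dots> = emeasure lborel S"
    by (subst lborel.nn_integral_fst) (auto simp: lborel_prod)
  finally show "emeasure (distr \<mu> lborel \<Phi>) S = emeasure lborel S" .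
qed simp

end

section \<open>Gaussian integrals\<close>

lemma gaussian_fourier_real:
  fixes s e :: real assumes "e > 0"
  shows "integrable lborel (\<lambda>t. exp (\<i> * of_real (t * s) - of_real (e * t\<^sup>2)))"
    and "(LINT t|lborel. exp (\<i> * of_real (t * s) - of_real (e * t\<^sup>2))) = of_real (sqrt (pi / e) * exp (- (s\<^sup>2 / (4 * e))))"
proof -
  \<comment> \<open>The scale at which e t^2 becomes x^2 / 2, so that the integral is the
    characteristic function of the standard normal distribution.\<close>
  define c where "c = 1 / sqrt (2 * e)"
  have c: "c > 0" using assms by (simp add: c_def)
  have c2: "c\<^sup>2 = 1 / (2 * e)" using assms by (simp add: c_def power_divide)
  let ?f = "\<lambda>t. exp (\<i> * of_real (t * s) - of_real (e * t\<^sup>2)) :: complex"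
  have fc: "?f (c * x) = of_real (sqrt (2 * pi)) * (std_normal_density x *\<^sub>R iexp ((s * c) * x))" for x
  proof -
    have "e * (c * x)\<^sup>2 = x\<^sup>2 / 2" using assms c2 by (simp add: power_mult_distrib)
    then have "?f (c * x) = exp (\<i> * of_real (c * x * s) - of_real (x\<^sup>2 / 2))" by (simp only:)
    also have "\<dots> = iexp ((s * c) * x) * of_real (exp (- x\<^sup>2 / 2))"
      unfolding exp_of_real[symmetric] exp_add[symmetric] by (simp add: algebra_simps)
    also have "exp (- x\<^sup>2 / 2) = sqrt (2 * pi) * std_normal_density x"
      by (simp add: std_normal_density_def real_sqrt_mult)
    finally show ?thesis by (simp add: scaleR_conv_of_real mult_ac)
  qed
  have int: "integrable lborel (\<lambda>x. std_normal_density x *\<^sub>R iexp ((s * c) * x))"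
  proof (rule Bochner_Integration.integrable_bound[OF integrable_normal_density[of 1 0]])
    show "AE x in lborel. norm (std_normal_density x *\<^sub>R iexp ((s * c) * x)) \<le> norm (std_normal_density x)"
      by simp
  qed auto
  have val: "(LINT x|lborel. std_normal_density x *\<^sub>R iexp ((s * c) * x)) = of_real (exp (- ((s * c)\<^sup>2) / 2))"
    using fun_cong[OF char_std_normal_distribution, of "s * c"] unfolding char_def
    by (subst (asm) integral_density) auto
  have int2: "integrable lborel (\<lambda>x. ?f (0 + c * x))"
    unfolding add_0 fc using int by (rule integrable_mult_right)
  show "integrable lborel ?f"
    using int2 c by (subst lborel_integrable_real_affine_iff[symmetric, of c _ 0]) auto
  have "(LINT t|lborel. ?f t) = c *\<^sub>R (LINT x|lborel. ?f (0 + c * x))"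
    using c by (subst lborel_integral_real_affine[of c _ 0]) auto
  also have "\<dots> = of_real (c * sqrt (2 * pi) * exp (- ((s * c)\<^sup>2) / 2))"
    unfolding add_0 fc by (subst integral_mult_right_zero) (subst val, simp add: scaleR_conv_of_real)
  also have "c * sqrt (2 * pi) = sqrt (pi / e)"
    using assms by (simp add: c_def real_sqrt_mult real_sqrt_divide)
  also have "- ((s * c)\<^sup>2) / 2 = - (s\<^sup>2 / (4 * e))"
    using c2 by (simp add: power_mult_distrib)
  finally show "(LINT t|lborel. ?f t) = of_real (sqrt (pi / e) * exp (- (s\<^sup>2 / (4 * e))))" .
qed

lemma gaussian_fourier:
  fixes y :: "'a::euclidean_space" and e :: real assumes "e > 0"
  shows "integrable lborel (\<lambda>x::'a. exp (\<i> * of_real (x \<bullet> y) - of_real (e * (norm x)\<^sup>2)))" (is ?A)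
    and "(LINT x|lborel. exp (\<i> * of_real (x \<bullet> y) - of_real (e * (norm x)\<^sup>2)))
       = of_real (sqrt (pi / e) ^ DIM('a) * exp (- ((norm y)\<^sup>2 / (4 * e))))" (is ?B)
proof -
  let ?f = "\<lambda>b t. exp (\<i> * of_real (t * (y \<bullet> b)) - of_real (e * t\<^sup>2)) :: complex"
  interpret product_sigma_finite "\<lambda>b::'a. lborel :: real measure" ..
  have F: "(\<lambda>x::'a. exp (\<i> * of_real (x \<bullet> y) - of_real (e * (norm x)\<^sup>2))) = (\<lambda>x. \<Prod>b\<in>Basis. ?f b (x \<bullet> b))"
  proof
    fix x :: 'a
    have "x \<bullet> y = (\<Sum>b\<in>Basis. (x \<bullet> b) * (y \<bullet> b))" by (rule euclidean_inner)
    moreover have "(norm x)\<^sup>2 = (\<Sum>b\<in>Basis. (x \<bullet> b)\<^sup>2)"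
      unfolding power2_norm_eq_inner by (subst euclidean_inner) (simp add: power2_eq_square)
    ultimately show "exp (\<i> * of_real (x \<bullet> y) - of_real (e * (norm x)\<^sup>2)) = (\<Prod>b\<in>Basis. ?f b (x \<bullet> b))"
      by (simp add: exp_sum[symmetric] sum_subtractf sum_distrib_left)
  qed
  have int: "integrable lborel (?f b)" for b using gaussian_fourier_real(1)[OF assms] .
  have P: "(\<lambda>f. \<Prod>b\<in>Basis. ?f b ((\<Sum>b\<in>Basis. f b *\<^sub>R b) \<bullet> b)) = (\<lambda>f. \<Prod>b\<in>(Basis::'a set). ?f b (f b))"
    by (intro ext prod.cong) auto
  have "integrable (Pi\<^sub>M Basis (\<lambda>b::'a. lborel)) (\<lambda>f. \<Prod>b\<in>Basis. ?f b (f b))"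
    by (intro product_integrable_prod int) auto
  then show ?A unfolding F
    by (subst lborel_eq) (subst integrable_distr_eq, simp_all add: P)
  have "(LINT x|(lborel::'a measure). (\<Prod>b\<in>Basis. ?f b (x \<bullet> b))) = (LINT f|Pi\<^sub>M Basis (\<lambda>b::'a. lborel). (\<Prod>b\<in>Basis. ?f b (f b)))"
    by (subst lborel_eq) (subst integral_distr, simp_all add: P)
  also have "\<dots> = (\<Prod>b\<in>(Basis::'a set). LINT t|lborel. ?f b t)"
    by (intro product_integral_prod int) auto
  also have "\<dots> = of_real (\<Prod>b\<in>(Basis::'a set). sqrt (pi / e) * exp (- ((y \<bullet> b)\<^sup>2 / (4 * e))))"
    by (subst gaussian_fourier_real(2)[OF assms]) simp
  also have "(\<Prod>b\<in>(Basis::'a set). sqrt (pi / e) * exp (- ((y \<bullet> b)\<^sup>2 / (4 * e))))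
     = sqrt (pi / e) ^ DIM('a) * exp (- ((norm y)\<^sup>2 / (4 * e)))"
  proof -
    have "(norm y)\<^sup>2 = (\<Sum>b\<in>Basis. (y \<bullet> b)\<^sup>2)"
      unfolding power2_norm_eq_inner by (subst euclidean_inner) (simp add: power2_eq_square)
    then show ?thesis
      by (simp add: prod.distrib exp_sum[symmetric] sum_negf sum_divide_distrib)
  qed
  finally show ?B unfolding F .
qed

lemma gaussian_integral:
  fixes e :: real assumes "e > 0"
  shows "integrable lborel (\<lambda>x::'a::euclidean_space. exp (- (e * (norm x)\<^sup>2)))" (is ?A)
    and "(LINT x|lborel. exp (- (e * (norm (x::'a))\<^sup>2))) = sqrt (pi / e) ^ DIM('a)" (is ?B)
proof -
  have eq: "exp (\<i> * of_real (x \<bullet> 0) - of_real (e * (norm x)\<^sup>2)) = complex_of_real (exp (- (e * (norm x)\<^sup>2)))" for x :: 'a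
    by (simp add: exp_of_real[symmetric])
  have 1: "integrable lborel (\<lambda>x::'a. complex_of_real (exp (- (e * (norm x)\<^sup>2))))"
    using gaussian_fourier(1)[OF assms, of "0::'a"] unfolding eq .
  then have "integrable lborel (\<lambda>x::'a. Re (complex_of_real (exp (- (e * (norm x)\<^sup>2)))))"
    by (rule integrable_Re)
  then show ?A by simp
  have "complex_of_real (LINT x|lborel. exp (- (e * (norm (x::'a))\<^sup>2))) = (LINT x|lborel. complex_of_real (exp (- (e * (norm (x::'a))\<^sup>2))))"
    by (rule integral_complex_of_real[symmetric])
  also have "\<dots> = complex_of_real (sqrt (pi / e) ^ DIM('a))"
    using gaussian_fourier(2)[OF assms, of "0::'a"] unfolding eq by simp
  finally show ?B by (simp only: of_real_eq_iff)
qed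

text \<open>Integrating out x leaves a Gaussian in y with rate e + 1/(4e), and e (e + 1/(4e)) = 1/4
  + e^2. The value stays finite as e tends to 0, where it becomes (2 pi)^n in dimension n: the
  source of the power of pi in the final bound.\<close>

lemma gaussian_pairing:
  fixes e :: real assumes e: "e > 0"
  shows "(LINT p|(lborel :: ('a::euclidean_space \<times> 'a) measure). exp (\<i> * of_real (fst p \<bullet> snd p) - of_real (e * ((norm (fst p))\<^sup>2 + (norm (snd p))\<^sup>2))))
     = of_real ((pi / sqrt (1 / 4 + e\<^sup>2)) ^ DIM('a))"
proof -
  let ?f = "\<lambda>p::'a \<times> 'a. exp (\<i> * of_real (fst p \<bullet> snd p) - of_real (e * ((norm (fst p))\<^sup>2 + (norm (snd p))\<^sup>2))) :: complex"
  have m: "?f \<in> borel_measurable (lborel \<Otimes>\<^sub>M lborel)"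
    unfolding lborel_prod by (auto intro!: borel_measurable_continuous_onI continuous_intros)
  have int: "integrable (lborel \<Otimes>\<^sub>M lborel) ?f"
  proof (rule Bochner_Integration.integrable_bound)
    show "integrable (lborel \<Otimes>\<^sub>M lborel) (\<lambda>p::'a\<times>'a. exp (- (e * (norm p)\<^sup>2)))"
      unfolding lborel_prod by (rule gaussian_integral(1)[OF e])
    show "AE p in lborel \<Otimes>\<^sub>M lborel. norm (?f p) \<le> norm (exp (- (e * (norm p)\<^sup>2)))"
      by (auto simp: norm_prod_def)
  qed (rule m)
  have "(LINT p|lborel. ?f p) = (LINT y|lborel. LINT x|lborel. ?f (x, y))"
    using lborel_pair.integral_snd[of "\<lambda>x y. ?f (x, y)"] int by (simp add: case_prod_beta' lborel_prod)
  also have "\<dots> = (LINT y|lborel. of_real (sqrt (pi / e) ^ DIM('a) * exp (- ((e + 1 / (4 * e)) * (norm (y::'a))\<^sup>2))))"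
  proof (rule Bochner_Integration.integral_cong[OF refl])
    fix y :: 'a
    have "(LINT x|lborel. ?f (x, y)) = (LINT x|lborel. exp (- of_real (e * (norm y)\<^sup>2)) * exp (\<i> * of_real (x \<bullet> y) - of_real (e * (norm x)\<^sup>2)))"
      by (intro Bochner_Integration.integral_cong refl) (simp add: exp_add[symmetric] algebra_simps)
    also have "\<dots> = exp (- of_real (e * (norm y)\<^sup>2)) * of_real (sqrt (pi / e) ^ DIM('a) * exp (- ((norm y)\<^sup>2 / (4 * e))))"
      by (subst integral_mult_right_zero) (subst gaussian_fourier(2)[OF e], simp)
    also have "\<dots> = of_real (sqrt (pi / e) ^ DIM('a) * (exp (- (e * (norm y)\<^sup>2)) * exp (- ((norm y)\<^sup>2 / (4 * e)))))"
      by (simp add: exp_of_real[symmetric])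
    also have "exp (- (e * (norm y)\<^sup>2)) * exp (- ((norm y)\<^sup>2 / (4 * e))) = exp (- ((e + 1 / (4 * e)) * (norm (y::'a))\<^sup>2))"
      unfolding exp_add[symmetric] by (simp add: algebra_simps)
    finally show "(LINT x|lborel. ?f (x, y)) = of_real (sqrt (pi / e) ^ DIM('a) * exp (- ((e + 1 / (4 * e)) * (norm (y::'a))\<^sup>2)))" .
  qed
  also have "\<dots> = of_real (LINT y|lborel. sqrt (pi / e) ^ DIM('a) * exp (- ((e + 1 / (4 * e)) * (norm (y::'a))\<^sup>2)))"
    by (rule integral_complex_of_real)
  also have "(LINT y|lborel. sqrt (pi / e) ^ DIM('a) * exp (- ((e + 1 / (4 * e)) * (norm (y::'a))\<^sup>2)))
     = sqrt (pi / e) ^ DIM('a) * sqrt (pi / (e + 1 / (4 * e))) ^ DIM('a)"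
  proof -
    have "e + 1 / (4 * e) > 0" using e by (simp add: add_pos_pos)
    then show ?thesis
      by (subst integral_mult_right_zero) (auto simp: gaussian_integral(2))
  qed
  also have "\<dots> = (sqrt (pi / e) * sqrt (pi / (e + 1 / (4 * e)))) ^ DIM('a)"
    by (rule power_mult_distrib[symmetric])
  also have "sqrt (pi / e) * sqrt (pi / (e + 1 / (4 * e))) = pi / sqrt (1 / 4 + e\<^sup>2)"
  proof -
    have "sqrt (pi / e) * sqrt (pi / (e + 1 / (4 * e))) = sqrt ((pi * pi) / (e * (e + 1 / (4 * e))))"
      by (simp add: real_sqrt_mult[symmetric])
    also have "e * (e + 1 / (4 * e)) = 1 / 4 + e\<^sup>2" using e by (simp add: field_simps power2_eq_square)
    finally show ?thesis by (simp add: real_sqrt_divide)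
  qed
  finally show ?thesis .
qed

text \<open>On a ball, which is convex, the bound on the derivative dominates the difference
  quotients as well, so dominated convergence along sequences applies.\<close>

lemma has_field_derivative_integral:
  fixes f :: "complex \<Rightarrow> 'a \<Rightarrow> complex"
  assumes r: "r > 0"
    and der: "\<And>z x. z \<in> ball z0 r \<Longrightarrow> ((\<lambda>z. f z x) has_field_derivative f' z x) (at z)"
    and bnd: "\<And>z x. z \<in> ball z0 r \<Longrightarrow> norm (f' z x) \<le> g x"
    and g: "integrable M g"
    and f: "\<And>z. z \<in> ball z0 r \<Longrightarrow> integrable M (f z)"
    and f'[measurable]: "f' z0 \<in> borel_measurable M"
  shows "((\<lambda>z. LINT x|M. f z x) has_field_derivative (LINT x|M. f' z0 x)) (at z0)"
  unfolding has_field_derivative_iff tendsto_at_iff_sequentially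
proof (intro allI impI)
  fix X :: "nat \<Rightarrow> complex" assume X: "\<forall>i. X i \<in> UNIV - {z0}" "X \<longlonglongrightarrow> z0"
  have X0: "X i \<noteq> z0" for i using X(1) by auto
  have ev: "\<forall>\<^sub>F i in sequentially. X i \<in> ball z0 r"
    using X(2) r by (intro topological_tendstoD) auto
  then obtain k where k: "\<And>i. i \<ge> k \<Longrightarrow> X i \<in> ball z0 r"
    unfolding eventually_sequentially by blast
  \<comment> \<open>The shift drops the finitely many terms outside the ball, since domination is
    required for every index.\<close>
  define Y where "Y i = X (i + k)" for i
  have Y: "Y i \<in> ball z0 r" "Y i \<noteq> z0" for i using k X0 by (auto simp: Y_def)
  have Yl: "Y \<longlonglongrightarrow> z0" unfolding Y_def using X(2) by (rule LIMSEQ_ignore_initial_segment)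
  have z0: "z0 \<in> ball z0 r" using r by simp
  have "(\<lambda>i. LINT x|M. (f (Y i) x - f z0 x) / (Y i - z0)) \<longlonglongrightarrow> (LINT x|M. f' z0 x)"
  proof (rule integral_dominated_convergence[where w=g])
    show "AE x in M. (\<lambda>i. (f (Y i) x - f z0 x) / (Y i - z0)) \<longlonglongrightarrow> f' z0 x"
    proof (rule AE_I2)
      fix x
      have "((\<lambda>z. (f z x - f z0 x) / (z - z0)) \<longlongrightarrow> f' z0 x) (at z0)"
        using der[OF z0] by (simp add: has_field_derivative_iff)
      then show "(\<lambda>i. (f (Y i) x - f z0 x) / (Y i - z0)) \<longlonglongrightarrow> f' z0 x"
        using Yl Y(2) unfolding tendsto_at_iff_sequentially comp_def by auto
    qed
    show "AE x in M. norm ((f (Y i) x - f z0 x) / (Y i - z0)) \<le> g x" for i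
    proof (rule AE_I2)
      fix x
      have "norm (f (Y i) x - f z0 x) \<le> g x * norm (Y i - z0)"
        by (rule field_differentiable_bound[OF convex_ball[of z0 r], where f'="\<lambda>z. f' z x"])
           (use der bnd Y z0 in \<open>auto intro: has_field_derivative_at_within\<close>)
      then show "norm ((f (Y i) x - f z0 x) / (Y i - z0)) \<le> g x"
        using Y(2)[of i] by (simp add: norm_divide field_simps)
    qed
    show "(\<lambda>x. (f (Y i) x - f z0 x) / (Y i - z0)) \<in> borel_measurable M" for i
      using f[OF Y(1)] f[OF z0] by measurable
  qed (use g in auto)
  moreover have "(LINT x|M. (f (Y i) x - f z0 x) / (Y i - z0)) = ((LINT x|M. f (Y i) x) - (LINT x|M. f z0 x)) / (Y i - z0)" for i
    using f[OF Y(1)] f[OF z0] by simp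
  ultimately have "(\<lambda>i. ((LINT x|M. f (Y i) x) - (LINT x|M. f z0 x)) / (Y i - z0)) \<longlonglongrightarrow> (LINT x|M. f' z0 x)"
    by (simp only:)
  then show "((\<lambda>y. ((LINT x|M. f y x) - (LINT x|M. f z0 x)) / (y - z0)) \<circ> X) \<longlonglongrightarrow> (LINT x|M. f' z0 x)"
    unfolding Y_def comp_def by (rule LIMSEQ_offset)
qed

section \<open>Rotation of the oscillatory integral\<close>

lemma nn_integral_lborel_scaleR:
  fixes f :: "'a::euclidean_space \<Rightarrow> ennreal"
  assumes [measurable]: "f \<in> borel_measurable borel" and c: "c > 0"
  shows "ennreal (c ^ DIM('a)) * (\<integral>\<^sup>+x. f (c *\<^sub>R x) \<partial>lborel) = (\<integral>\<^sup>+x. f x \<partial>lborel)"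
proof -
  have "(\<integral>\<^sup>+x. f x \<partial>lborel) = (\<integral>\<^sup>+x. f x \<partial>density (distr lborel borel (\<lambda>x. 0 + c *\<^sub>R x)) (\<lambda>_. \<bar>c\<bar> ^ DIM('a)))"
    using c by (subst lborel_affine[of c 0]) auto
  also have "\<dots> = ennreal (c ^ DIM('a)) * (\<integral>\<^sup>+x. f (c *\<^sub>R x) \<partial>lborel)"
    using c by (simp add: nn_integral_density nn_integral_distr nn_integral_cmult)
  finally show ?thesis ..
qed

context smooth_norm begin

text \<open>Since \<open>jac\<close> is invariant under independent positive rescalings, only the
  Lebesgue factors s^n and t^n appear: \<open>\<mu>\<close> has degree n in each variable, not
  merely degree 2n jointly.\<close>

lemma nn_integral_\<mu>_scale:
  assumes f[measurable]: "f \<in> borel_measurable borel" and st: "s > 0" "t > 0"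
  shows "ennreal (s ^ CARD('n) * t ^ CARD('n)) * (\<integral>\<^sup>+p. f (s *\<^sub>R fst p, t *\<^sub>R snd p) \<partial>\<mu>) = (\<integral>\<^sup>+p. f p \<partial>\<mu>)"
proof -
  define F where "F = (\<lambda>p. ennreal (jac p) * f p)"
  have F[measurable]: "F \<in> borel_measurable borel" unfolding F_def by measurable
  have F2[measurable]: "case_prod (\<lambda>u v. F (u, v)) \<in> borel_measurable (lborel \<Otimes>\<^sub>M lborel)"
    unfolding lborel_prod by simp
  have Fs[measurable]: "case_prod (\<lambda>u v. F (s *\<^sub>R u, t *\<^sub>R v)) \<in> borel_measurable (lborel \<Otimes>\<^sub>M lborel)"
    unfolding lborel_prod case_prod_beta by measurable
  have Fs'[measurable]: "case_prod (\<lambda>u v. F (s *\<^sub>R u, v)) \<in> borel_measurable (lborel \<Otimes>\<^sub>M lborel)"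
    unfolding lborel_prod case_prod_beta by measurable
  have js: "jac (s *\<^sub>R u, t *\<^sub>R v) = jac (u, v)" for u v
    using st by (simp add: jac_def A_scale)
  have "(\<integral>\<^sup>+p. f (s *\<^sub>R fst p, t *\<^sub>R snd p) \<partial>\<mu>) = (\<integral>\<^sup>+p. F (s *\<^sub>R fst p, t *\<^sub>R snd p) \<partial>lborel)"
    by (subst nn_integral_\<mu>) (measurable, auto simp: F_def js intro!: nn_integral_cong)
  also have "\<dots> = (\<integral>\<^sup>+u. \<integral>\<^sup>+v. F (s *\<^sub>R u, t *\<^sub>R v) \<partial>lborel \<partial>lborel)"
    using lborel.nn_integral_fst[OF Fs] by (simp add: case_prod_beta' lborel_prod)
  finally have "ennreal (s ^ CARD('n) * t ^ CARD('n)) * (\<integral>\<^sup>+p. f (s *\<^sub>R fst p, t *\<^sub>R snd p) \<partial>\<mu>)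
     = ennreal (s ^ CARD('n)) * (\<integral>\<^sup>+u. ennreal (t ^ CARD('n)) * (\<integral>\<^sup>+v. F (s *\<^sub>R u, t *\<^sub>R v) \<partial>lborel) \<partial>lborel)"
    using st by (subst nn_integral_cmult) (auto simp: ennreal_mult mult.assoc)
  also have "\<dots> = ennreal (s ^ CARD('n)) * (\<integral>\<^sup>+u. (\<integral>\<^sup>+v. F (s *\<^sub>R u, v) \<partial>lborel) \<partial>lborel)"
    using nn_integral_lborel_scaleR[of "\<lambda>v. F (s *\<^sub>R u, v)" t for u] st by simp
  also have "\<dots> = (\<integral>\<^sup>+u. (\<integral>\<^sup>+v. F (u, v) \<partial>lborel) \<partial>lborel)"
    using nn_integral_lborel_scaleR[of "\<lambda>u. \<integral>\<^sup>+v. F (u, v) \<partial>lborel" s] st by simp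
  also have "\<dots> = (\<integral>\<^sup>+p. F p \<partial>lborel)"
    using lborel.nn_integral_fst[OF F2] by (simp add: case_prod_beta' lborel_prod)
  also have "\<dots> = (\<integral>\<^sup>+p. f p \<partial>\<mu>)"
    by (subst nn_integral_\<mu>) (auto simp: F_def)
  finally show ?thesis .
qed

text \<open>The factors r^n and r^(-n) cancel. These rescalings and the rotation belong to one
  complex one-parameter group.\<close>

lemma distr_\<mu>_squeeze:
  assumes "r > 0"
  shows "distr \<mu> \<mu> (\<lambda>p. (r *\<^sub>R fst p, (1 / r) *\<^sub>R snd p)) = \<mu>"
proof (rule measure_eqI)
  fix S assume "S \<in> sets (distr \<mu> \<mu> (\<lambda>p. (r *\<^sub>R fst p, (1 / r) *\<^sub>R snd p)))"
  then have S[measurable]: "S \<in> sets borel" by simp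
  have "emeasure (distr \<mu> \<mu> (\<lambda>p. (r *\<^sub>R fst p, (1 / r) *\<^sub>R snd p))) S
     = (\<integral>\<^sup>+p. indicator S (r *\<^sub>R fst p, (1 / r) *\<^sub>R snd p) \<partial>\<mu>)"
    using nn_integral_distr[of "\<lambda>p. (r *\<^sub>R fst p, (1 / r) *\<^sub>R snd p)" \<mu> \<mu> "indicator S"] by simp
  also have "\<dots> = (\<integral>\<^sup>+p. indicator S p \<partial>\<mu>)"
    using nn_integral_\<mu>_scale[of "indicator S" r "1 / r"] assms by (simp add: power_one_over)
  finally show "emeasure (distr \<mu> \<mu> (\<lambda>p. (r *\<^sub>R fst p, (1 / r) *\<^sub>R snd p))) S = emeasure \<mu> S"
    by simp
qed simp

text \<open>Let (X, Y) = \<open>\<Phi> (u, v)\<close>. Then \<open>gnorm2\<close> is the diagonal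
  part and \<open>crossterm\<close> half the mixed part of |X|^2 + |Y|^2, while \<open>twist\<close>
  is the mixed part of X \<bullet> Y, whose diagonal part is N(u)^2 - N(v)^2.\<close>

definition gnorm2 :: "(real,'n) vec \<Rightarrow> real" where "gnorm2 u = (norm u)\<^sup>2 + (norm (T u))\<^sup>2"
definition crossterm :: "(real,'n) vec \<times> (real,'n) vec \<Rightarrow> real" where
  "crossterm p = fst p \<bullet> snd p - T (fst p) \<bullet> T (snd p)"
definition twist :: "(real,'n) vec \<times> (real,'n) vec \<Rightarrow> real" where
  "twist p = snd p \<bullet> T (fst p) - fst p \<bullet> T (snd p)"

lemma measurable_gnorm2 [measurable]: "gnorm2 \<in> borel_measurable borel" unfolding gnorm2_def by measurable
lemma measurable_crossterm [measurable]: "crossterm \<in> borel_measurable borel" unfolding crossterm_def by measurable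
lemma measurable_twist [measurable]: "twist \<in> borel_measurable borel" unfolding twist_def by measurable

lemma gnorm2_nonneg [simp]: "0 \<le> gnorm2 u" by (simp add: gnorm2_def)

lemma gnorm2_scale: "gnorm2 (r *\<^sub>R u) = r\<^sup>2 * gnorm2 u"
  by (simp add: gnorm2_def T_scale power_mult_distrib algebra_simps)

lemma N_sq_le_gnorm2: "(N u)\<^sup>2 \<le> gnorm2 u"
proof -
  have "(N u)\<^sup>2 \<le> norm u * norm (T u)" using norm_cauchy_schwarz[of u "T u"] by (simp add: inner_T)
  also have "\<dots> \<le> gnorm2 u"
  proof -
    have "2 * (norm u * norm (T u)) \<le> gnorm2 u"
      using sum_squares_bound[of "norm u" "norm (T u)"] by (simp add: gnorm2_def mult.assoc)
    moreover have "0 \<le> norm u * norm (T u)" by simp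
    ultimately show ?thesis by linarith
  qed
  finally show ?thesis .
qed

text \<open>Both sides have degree 2 and are comparable to |u|^2, by \<open>T_bound\<close> and
  \<open>N_ge\<close>. The cap at 1 later gives \<kappa> sin t \<le> sin t in the first
  quadrant.\<close>

lemma gnorm2_le_N_sq: obtains \<kappa> where "0 < \<kappa>" "\<kappa> \<le> 1" "\<And>u. \<kappa> * gnorm2 u \<le> (N u)\<^sup>2"
proof -
  obtain C where C: "C > 0" "\<And>u. norm (T u) \<le> C * norm u" using T_bound by blast
  define \<kappa> where "\<kappa> = min 1 (\<eta> / (1 + C\<^sup>2))"
  have C2: "1 + C\<^sup>2 > 0" by (simp add: add_pos_nonneg)
  have "\<kappa> * gnorm2 u \<le> (N u)\<^sup>2" for u
  proof -
    have "(norm (T u))\<^sup>2 \<le> C\<^sup>2 * (norm u)\<^sup>2"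
      using power_mono[OF C(2)[of u], of 2] by (simp add: power_mult_distrib)
    then have "gnorm2 u \<le> (1 + C\<^sup>2) * (norm u)\<^sup>2" by (simp add: gnorm2_def algebra_simps)
    moreover have "\<kappa> \<le> \<eta> / (1 + C\<^sup>2)" "\<kappa> \<ge> 0" using \<eta>_pos C2 by (auto simp: \<kappa>_def)
    ultimately have "\<kappa> * gnorm2 u \<le> (\<eta> / (1 + C\<^sup>2)) * ((1 + C\<^sup>2) * (norm u)\<^sup>2)"
      by (intro mult_mono) (auto simp: gnorm2_def)
    also have "\<dots> = \<eta> * (norm u)\<^sup>2" using C2 by simp
    finally show ?thesis using N_ge[of u] by simp
  qed
  moreover have "\<kappa> > 0" using \<eta>_pos C2 by (simp add: \<kappa>_def)
  moreover have "\<kappa> \<le> 1" by (simp add: \<kappa>_def)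
  ultimately show ?thesis using that by blast
qed

lemma norm_\<Phi>: "(norm (\<Phi> p))\<^sup>2 = gnorm2 (fst p) + gnorm2 (snd p) + 2 * crossterm p"
proof -
  have "(norm (x + y))\<^sup>2 = (norm x)\<^sup>2 + (norm y)\<^sup>2 + 2 * (x \<bullet> y)" 
   and "(norm (x - y))\<^sup>2 = (norm x)\<^sup>2 + (norm y)\<^sup>2 - 2 * (x \<bullet> y)" for x y :: "(real,'n) vec"
    by (simp_all add: power2_norm_eq_inner algebra_simps inner_commute)
  moreover have "(norm (x, y))\<^sup>2 = (norm x)\<^sup>2 + (norm y)\<^sup>2" for x y :: "(real,'n) vec"
    by (simp add: norm_prod_def)
  ultimately show ?thesis by (simp add: \<Phi>_def gnorm2_def crossterm_def case_prod_beta)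
qed

lemma crossterm_bound: "\<bar>2 * crossterm p\<bar> \<le> gnorm2 (fst p) + gnorm2 (snd p)"
proof -
  have *: "\<bar>2 * (x \<bullet> y)\<bar> \<le> (norm x)\<^sup>2 + (norm y)\<^sup>2" for x y :: "(real,'n) vec"
    using Cauchy_Schwarz_ineq2[of x y] sum_squares_bound[of "norm x" "norm y"] by (simp add: abs_mult)
  show ?thesis using *[of "fst p" "snd p"] *[of "T (fst p)" "T (snd p)"]
    unfolding crossterm_def gnorm2_def right_diff_distrib by linarith
qed

text \<open>Coercivity of \<open>\<Phi>\<close>: N(u)^2 + N(v)^2 equals (u + v) \<bullet> T u - (T u
  - T v) \<bullet> v, so Young's inequality bounds it by |\<Phi>|^2 plus a part that is absorbed on
  the left. The cruder \<open>crossterm_bound\<close> would allow the mixed term to cancel the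
  diagonal one.\<close>

lemma norm_\<Phi>_ge:
  assumes k: "0 < \<kappa>" "\<And>u. \<kappa> * gnorm2 u \<le> (N u)\<^sup>2"
  shows "\<kappa>\<^sup>2 * (gnorm2 u + gnorm2 v) \<le> gnorm2 u + gnorm2 v + 2 * crossterm (u, v)"
proof -
  have young: "x \<bullet> y \<le> (norm x)\<^sup>2 / (2 * \<kappa>) + \<kappa> / 2 * (norm y)\<^sup>2" for x y :: "(real,'n) vec"
  proof -
    have "0 \<le> (norm x - \<kappa> * norm y)\<^sup>2" by simp
    then have "2 * \<kappa> * (norm x * norm y) \<le> (norm x)\<^sup>2 + \<kappa>\<^sup>2 * (norm y)\<^sup>2"
      by (simp add: power2_eq_square algebra_simps)
    then have "norm x * norm y \<le> (norm x)\<^sup>2 / (2 * \<kappa>) + \<kappa> / 2 * (norm y)\<^sup>2"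
      using k(1) by (simp add: field_simps power2_eq_square)
    then show ?thesis using norm_cauchy_schwarz[of x y] by linarith
  qed
  have "\<kappa> * (gnorm2 u + gnorm2 v) \<le> (N u)\<^sup>2 + (N v)\<^sup>2"
    using k(2)[of u] k(2)[of v] by (simp add: algebra_simps)
  also have "\<dots> = (u + v) \<bullet> T u + (- (T u - T v)) \<bullet> v"
    by (simp add: inner_T[symmetric] algebra_simps inner_commute)
  also have "\<dots> \<le> (norm (u + v))\<^sup>2 / (2 * \<kappa>) + \<kappa> / 2 * (norm (T u))\<^sup>2
      + ((norm (- (T u - T v)))\<^sup>2 / (2 * \<kappa>) + \<kappa> / 2 * (norm v)\<^sup>2)"
    by (intro add_mono young)
  also have "\<dots> = (norm (\<Phi> (u, v)))\<^sup>2 / (2 * \<kappa>) + \<kappa> / 2 * ((norm (T u))\<^sup>2 + (norm v)\<^sup>2)"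
    unfolding norm_minus_cancel by (simp add: \<Phi>_def norm_prod_def algebra_simps add_divide_distrib)
  also have "\<dots> \<le> (norm (\<Phi> (u, v)))\<^sup>2 / (2 * \<kappa>) + \<kappa> / 2 * (gnorm2 u + gnorm2 v)"
    using k(1) by (intro add_left_mono mult_left_mono) (auto simp: gnorm2_def)
  finally have "\<kappa> / 2 * (gnorm2 u + gnorm2 v) \<le> (norm (\<Phi> (u, v)))\<^sup>2 / (2 * \<kappa>)" by (simp add: field_simps)
  then have "\<kappa>\<^sup>2 * (gnorm2 u + gnorm2 v) \<le> (norm (\<Phi> (u, v)))\<^sup>2"
    using k(1) by (simp add: field_simps power2_eq_square)
  then show ?thesis by (simp add: norm_\<Phi>)
qed

text \<open>The Gaussian with rate l/2, pulled back along \<open>\<Phi>\<close>, is a majorant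
  because |\<Phi>|^2 is at most twice its diagonal part.\<close>

lemma integrable_exp_gnorm2:
  assumes "l > 0" shows "integrable \<mu> (\<lambda>p. exp (- (l * (gnorm2 (fst p) + gnorm2 (snd p)))))"
proof -
  have "integrable lborel (\<lambda>x::(real,'n) vec \<times> (real,'n) vec. exp (- ((l / 2) * (norm x)\<^sup>2)))"
    using assms by (intro gaussian_integral(1)) simp
  then have "integrable (distr \<mu> lborel \<Phi>) (\<lambda>x. exp (- ((l / 2) * (norm x)\<^sup>2)))"
    by (simp add: distr_\<mu>_\<Phi>)
  then have "integrable \<mu> (\<lambda>p. exp (- ((l / 2) * (norm (\<Phi> p))\<^sup>2)))"
    by (subst (asm) integrable_distr_eq) auto
  then show ?thesis
  proof (rule Bochner_Integration.integrable_bound)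
    show "AE p in \<mu>. norm (exp (- (l * (gnorm2 (fst p) + gnorm2 (snd p))))) \<le> norm (exp (- ((l / 2) * (norm (\<Phi> p))\<^sup>2)))"
    proof (rule AE_I2)
      fix p
      have "(norm (\<Phi> p))\<^sup>2 \<le> 2 * (gnorm2 (fst p) + gnorm2 (snd p))"
        using crossterm_bound[of p] by (simp add: norm_\<Phi>)
      then have "(l / 2) * (norm (\<Phi> p))\<^sup>2 \<le> (l / 2) * (2 * (gnorm2 (fst p) + gnorm2 (snd p)))"
        using assms by (intro mult_left_mono) auto
      also have "\<dots> = l * (gnorm2 (fst p) + gnorm2 (snd p))" by simp
      finally show "norm (exp (- (l * (gnorm2 (fst p) + gnorm2 (snd p))))) \<le> norm (exp (- ((l / 2) * (norm (\<Phi> p))\<^sup>2)))"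
        by simp
    qed
  qed simp
qed

text \<open>With \<open>w = exp (\<i> z)\<close>, \<open>X = \<surd>w u + v / \<surd>w\<close> and \<open>Y = \<surd>w T u - T v / \<surd>w\<close> this is
  \<open>\<i> X \<bullet> Y - e (X\<^sup>2 + Y\<^sup>2)\<close> for the bilinear extension of the inner product; at \<open>z = 0\<close>, \<open>(X, Y) = \<Phi> (u, v)\<close>.\<close>
definition phase :: "real \<Rightarrow> complex \<Rightarrow> (real,'n) vec \<times> (real,'n) vec \<Rightarrow> complex" where
  "phase e z p = \<i> * (exp (\<i> * z) * of_real ((N (fst p))\<^sup>2) - exp (- (\<i> * z)) * of_real ((N (snd p))\<^sup>2) + of_real (twist p))
     - of_real e * (exp (\<i> * z) * of_real (gnorm2 (fst p)) + exp (- (\<i> * z)) * of_real (gnorm2 (snd p)) + 2 * of_real (crossterm p))"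

definition phase' :: "real \<Rightarrow> complex \<Rightarrow> (real,'n) vec \<times> (real,'n) vec \<Rightarrow> complex" where
  "phase' e z p = - (exp (\<i> * z) * of_real ((N (fst p))\<^sup>2) + exp (- (\<i> * z)) * of_real ((N (snd p))\<^sup>2))
     - of_real e * \<i> * (exp (\<i> * z) * of_real (gnorm2 (fst p)) - exp (- (\<i> * z)) * of_real (gnorm2 (snd p)))"

lemma measurable_phase [measurable]: "phase e z \<in> borel_measurable borel" unfolding phase_def by measurable
lemma measurable_phase' [measurable]: "phase' e z \<in> borel_measurable borel" unfolding phase'_def by measurable

lemma phase_deriv: "((\<lambda>z. phase e z p) has_field_derivative phase' e z p) (at z)"
  unfolding phase_def phase'_def by (auto intro!: derivative_eq_intros simp: algebra_simps)

text \<open>A lower bound for the decay rate of exp (phase) at angle t. In the regularising Gaussian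
  the diagonal part carries cos t, whereas the mixed part stays fixed and is bounded below through 1
  - \<kappa>^2. The minimum also covers negative sin t, because differentiation at t = 0 needs a
  full neighbourhood.\<close>

definition rate :: "real \<Rightarrow> real \<Rightarrow> real \<Rightarrow> real" where
  "rate \<kappa> e t = min (\<kappa> * sin t) (sin t) + e * (cos t - 1 + \<kappa>\<^sup>2)"

lemma Re_phase_le:
  assumes k: "0 < \<kappa>" "\<kappa> \<le> 1" "\<And>u. \<kappa> * gnorm2 u \<le> (N u)\<^sup>2" and e: "e > 0"
  shows "Re (phase e z p) \<le> - (rate \<kappa> e (Re z) * (exp (- Im z) * gnorm2 (fst p) + exp (Im z) * gnorm2 (snd p)))"
proof -
  let ?u = "fst p" and ?v = "snd p" and ?t = "Re z" and ?s = "Im z"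
  define S where "S = exp (- ?s) * gnorm2 ?u + exp ?s * gnorm2 ?v"
  define B where "B = exp (- ?s) * (N ?u)\<^sup>2 + exp ?s * (N ?v)\<^sup>2"
  have E: "exp (\<i> * z) = of_real (exp (- ?s)) * (cos ?t + \<i> * sin ?t)"
    by (simp add: exp_eq_polar cis.ctr complex_eq_iff)
  have E': "exp (- (\<i> * z)) = of_real (exp ?s) * (cos ?t - \<i> * sin ?t)"
    by (simp add: exp_eq_polar cis.ctr complex_eq_iff)
  have Re: "Re (phase e z p) = - (sin ?t * B) - e * (cos ?t * S + 2 * crossterm p)"
    unfolding phase_def E E' B_def S_def by (simp add: algebra_simps)
  have S0: "S \<ge> 0" by (simp add: S_def)
  have B1: "\<kappa> * S \<le> B" 
  proof -
    have "\<kappa> * S = exp (- ?s) * (\<kappa> * gnorm2 ?u) + exp ?s * (\<kappa> * gnorm2 ?v)" by (simp add: S_def algebra_simps)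
    also have "\<dots> \<le> B" unfolding B_def by (intro add_mono mult_left_mono k) auto
    finally show ?thesis .
  qed
  have B2: "B \<le> S" unfolding B_def S_def by (intro add_mono mult_left_mono N_sq_le_gnorm2) auto
  \<comment> \<open>Coercivity of \<open>\<Phi>\<close> at the point rescaled by exp(-s/2) and
    exp(s/2) produces the weights in \<open>S\<close> and leaves \<open>crossterm\<close>
    unchanged.\<close>
  have "\<kappa>\<^sup>2 * (gnorm2 (exp (- ?s / 2) *\<^sub>R ?u) + gnorm2 (exp (?s / 2) *\<^sub>R ?v))
     \<le> gnorm2 (exp (- ?s / 2) *\<^sub>R ?u) + gnorm2 (exp (?s / 2) *\<^sub>R ?v) + 2 * crossterm (exp (- ?s / 2) *\<^sub>R ?u, exp (?s / 2) *\<^sub>R ?v)"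
    by (rule norm_\<Phi>_ge[OF k(1,3)])
  also have "crossterm (exp (- ?s / 2) *\<^sub>R ?u, exp (?s / 2) *\<^sub>R ?v) = crossterm p"
    by (simp add: crossterm_def T_scale mult.assoc[symmetric] exp_add[symmetric])
  also have "gnorm2 (exp (- ?s / 2) *\<^sub>R ?u) + gnorm2 (exp (?s / 2) *\<^sub>R ?v) = S"
    by (simp add: gnorm2_scale S_def exp_double[symmetric])
  finally have G: "2 * crossterm p \<ge> (\<kappa>\<^sup>2 - 1) * S" by (simp add: algebra_simps)
  have "min (\<kappa> * sin ?t) (sin ?t) * S \<le> sin ?t * B"
  proof (cases "sin ?t \<ge> 0")
    case True
    have "min (\<kappa> * sin ?t) (sin ?t) * S \<le> (\<kappa> * sin ?t) * S" using S0 by (intro mult_right_mono) auto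
    also have "\<dots> = sin ?t * (\<kappa> * S)" by simp
    also have "\<dots> \<le> sin ?t * B" using B1 True by (intro mult_left_mono)
    finally show ?thesis .
  next
    case False
    have "min (\<kappa> * sin ?t) (sin ?t) * S \<le> sin ?t * S" using S0 by (intro mult_right_mono) auto
    also have "\<dots> \<le> sin ?t * B" using B2 False by (intro mult_left_mono_neg) auto
    finally show ?thesis .
  qed
  moreover have "e * (cos ?t * S + 2 * crossterm p) \<ge> e * (cos ?t * S + (\<kappa>\<^sup>2 - 1) * S)"
    using G e by (intro mult_left_mono) auto
  ultimately show ?thesis unfolding Re rate_def S_def[symmetric] by (simp add: algebra_simps)
qed

lemma integrable_phase:
  assumes k: "0 < \<kappa>" "\<kappa> \<le> 1" "\<And>u. \<kappa> * gnorm2 u \<le> (N u)\<^sup>2" and e: "e > 0" and z: "rate \<kappa> e (Re z) > 0"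
  shows "integrable \<mu> (\<lambda>p. exp (phase e z p))"
proof -
  define m where "m = rate \<kappa> e (Re z) * exp (- \<bar>Im z\<bar>)"
  have m: "m > 0" using z by (simp add: m_def)
  show ?thesis
  proof (rule Bochner_Integration.integrable_bound[OF integrable_exp_gnorm2[OF m]])
    show "AE p in \<mu>. norm (exp (phase e z p)) \<le> norm (exp (- (m * (gnorm2 (fst p) + gnorm2 (snd p)))))"
    proof (rule AE_I2)
      fix p
      have "m * (gnorm2 (fst p) + gnorm2 (snd p)) = rate \<kappa> e (Re z) * (exp (- \<bar>Im z\<bar>) * gnorm2 (fst p) + exp (- \<bar>Im z\<bar>) * gnorm2 (snd p))"
        by (simp add: m_def algebra_simps)
      also have "\<dots> \<le> rate \<kappa> e (Re z) * (exp (- Im z) * gnorm2 (fst p) + exp (Im z) * gnorm2 (snd p))"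
        using z by (intro mult_left_mono add_mono mult_right_mono) auto
      finally show "norm (exp (phase e z p)) \<le> norm (exp (- (m * (gnorm2 (fst p) + gnorm2 (snd p)))))"
        using Re_phase_le[OF k e, of z p] by simp
    qed
  qed simp
qed

section \<open>The integral as a holomorphic function of the complex angle\<close>

definition rotated :: "real \<Rightarrow> complex \<Rightarrow> complex" where
  "rotated e z = (LINT p|\<mu>. exp (phase e z p))"

text \<open>Moving \<open>z\<close> vertically rescales \<open>w\<close> by a positive factor, which \<open>(u, v) \<mapsto> (r u, v / r)\<close> absorbs.\<close>
lemma rotated_vertical: "rotated e (z + \<i> * of_real s) = rotated e z"
proof -
  define r where "r = exp (- s / 2)"
  have r: "r > 0" by (simp add: r_def)
  have r2: "r\<^sup>2 = exp (- s)" "(1 / r)\<^sup>2 = exp s"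
    by (simp_all add: r_def exp_double[symmetric] power_divide exp_minus field_simps)
  let ?h = "\<lambda>p. (r *\<^sub>R fst p, (1 / r) *\<^sub>R snd p)"
  have E: "exp (\<i> * (z + \<i> * of_real s)) = exp (\<i> * z) * of_real (exp (- s))"
    "exp (- (\<i> * (z + \<i> * of_real s))) = exp (- (\<i> * z)) * of_real (exp s)"
    unfolding exp_of_real[symmetric] exp_add[symmetric] by (simp_all add: algebra_simps)
  have "phase e (z + \<i> * of_real s) p = phase e z (?h p)" for p
  proof -
    have "twist (?h p) = twist p" "crossterm (?h p) = crossterm p" using r by (simp_all add: twist_def crossterm_def T_scale)
    moreover have "(N (fst (?h p)))\<^sup>2 = exp (- s) * (N (fst p))\<^sup>2" "(N (snd (?h p)))\<^sup>2 = exp s * (N (snd p))\<^sup>2"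
      by (simp_all only: fst_conv snd_conv N_scale power_mult_distrib power2_abs r2)
    moreover have "gnorm2 (fst (?h p)) = exp (- s) * gnorm2 (fst p)" "gnorm2 (snd (?h p)) = exp s * gnorm2 (snd p)"
      by (simp_all only: fst_conv snd_conv gnorm2_scale r2)
    ultimately show ?thesis unfolding phase_def E by (simp only: of_real_mult mult_ac)
  qed
  then have "rotated e (z + \<i> * of_real s) = (LINT p|\<mu>. exp (phase e z (?h p)))" by (simp add: rotated_def)
  also have "\<dots> = (LINT p|distr \<mu> \<mu> ?h. exp (phase e z p))"
    by (subst integral_distr) auto
  also have "\<dots> = rotated e z" unfolding distr_\<mu>_squeeze[OF r] rotated_def ..
  finally show ?thesis .
qed

text \<open>The integral is holomorphic in \<open>z\<close> and constant along vertical lines.\<close>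
lemma rotated_deriv:
  assumes k: "0 < \<kappa>" "\<kappa> \<le> 1" "\<And>u. \<kappa> * gnorm2 u \<le> (N u)\<^sup>2" and e: "e > 0" and z0: "rate \<kappa> e (Re z0) > 0"
  shows "(rotated e has_field_derivative 0) (at z0)"
proof -
  define m0 where "m0 = rate \<kappa> e (Re z0) / 2"
  have m0: "m0 > 0" using z0 by (simp add: m0_def)
  have "continuous_on UNIV (\<lambda>z. rate \<kappa> e (Re z))"
    unfolding rate_def by (intro continuous_intros)
  then have "\<forall>\<^sub>F z in at z0. rate \<kappa> e (Re z) > m0"
    using z0 by (intro order_tendstoD(1)[of _ "rate \<kappa> e (Re z0)"]) (auto simp: continuous_on_eq_continuous_at isCont_def m0_def)
  then obtain r0 where r0: "r0 > 0" "\<And>z. z \<noteq> z0 \<Longrightarrow> dist z z0 < r0 \<Longrightarrow> rate \<kappa> e (Re z) > m0"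
    unfolding eventually_at by auto
  define r where "r = min r0 1"
  define H where "H = \<bar>Im z0\<bar> + 1"
  have r: "r > 0" using r0 by (simp add: r_def)
  have rt: "rate \<kappa> e (Re z) > m0" "\<bar>Im z\<bar> \<le> H" if "z \<in> ball z0 r" for z
  proof -
    show "rate \<kappa> e (Re z) > m0" using r0(2)[of z] that z0 m0 by (cases "z = z0") (auto simp: r_def m0_def dist_commute)
    have "\<bar>Im z - Im z0\<bar> \<le> norm (z - z0)" using abs_Im_le_cmod[of "z - z0"] by simp
    also have "\<dots> < 1" using that by (simp add: r_def dist_norm norm_minus_commute)
    finally show "\<bar>Im z\<bar> \<le> H" by (simp add: H_def)
  qed
  define l where "l = m0 * exp (- H)"
  have l: "l > 0" using m0 by (simp add: l_def)
  define C where "C = (1 + e) * exp H * (2 / l)"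
  have "(rotated e has_field_derivative (LINT p|\<mu>. exp (phase e z0 p) * phase' e z0 p)) (at z0)"
    unfolding rotated_def
  proof (rule has_field_derivative_integral[OF r, where f'="\<lambda>z p. exp (phase e z p) * phase' e z p"
        and g="\<lambda>p. C * exp (- ((l / 2) * (gnorm2 (fst p) + gnorm2 (snd p))))"])
    fix z p assume z: "z \<in> ball z0 r"
    let ?S = "gnorm2 (fst p) + gnorm2 (snd p)"
    show "((\<lambda>z. exp (phase e z p)) has_field_derivative exp (phase e z p) * phase' e z p) (at z)"
      by (auto intro!: derivative_eq_intros phase_deriv)
    have "l * ?S = m0 * (exp (- H) * gnorm2 (fst p) + exp (- H) * gnorm2 (snd p))"
      by (simp add: l_def algebra_simps)
    also have "\<dots> \<le> rate \<kappa> e (Re z) * (exp (- Im z) * gnorm2 (fst p) + exp (Im z) * gnorm2 (snd p))"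
      using rt[OF z] m0 by (intro mult_mono add_mono mult_right_mono) auto
    finally have "Re (phase e z p) \<le> - (l * ?S)" using Re_phase_le[OF k e, of z p] by linarith
    then have 1: "norm (exp (phase e z p)) \<le> exp (- (l * ?S))" by simp
    have n1: "norm (exp (\<i> * z)) \<le> exp H" "norm (exp (- (\<i> * z))) \<le> exp H" using rt(2)[OF z] by auto
    have "norm (phase' e z p) \<le> norm (exp (\<i> * z)) * (N (fst p))\<^sup>2 + norm (exp (- (\<i> * z))) * (N (snd p))\<^sup>2
        + e * (norm (exp (\<i> * z)) * gnorm2 (fst p) + norm (exp (- (\<i> * z))) * gnorm2 (snd p))"
    proof -
      have "norm (phase' e z p) \<le> norm (exp (\<i> * z) * of_real ((N (fst p))\<^sup>2) + exp (- (\<i> * z)) * of_real ((N (snd p))\<^sup>2))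
         + norm (of_real e * \<i> * (exp (\<i> * z) * of_real (gnorm2 (fst p)) - exp (- (\<i> * z)) * of_real (gnorm2 (snd p))))"
        unfolding phase'_def by (rule order_trans[OF norm_triangle_ineq4]) (simp only: norm_minus_cancel order_refl)
      also have "\<dots> \<le> (norm (exp (\<i> * z) * of_real ((N (fst p))\<^sup>2)) + norm (exp (- (\<i> * z)) * of_real ((N (snd p))\<^sup>2)))
         + e * (norm (exp (\<i> * z) * of_real (gnorm2 (fst p))) + norm (exp (- (\<i> * z)) * of_real (gnorm2 (snd p))))"
        using e norm_triangle_ineq4[of "exp (\<i> * z) * of_real (gnorm2 (fst p))" "exp (- (\<i> * z)) * of_real (gnorm2 (snd p))"]
        by (intro add_mono norm_triangle_ineq) (simp add: norm_mult)
      finally show ?thesis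
        by (simp only: norm_mult norm_of_real abs_power2 abs_of_nonneg[OF gnorm2_nonneg])
    qed
    also have "\<dots> \<le> exp H * gnorm2 (fst p) + exp H * gnorm2 (snd p) + e * (exp H * gnorm2 (fst p) + exp H * gnorm2 (snd p))"
      using n1 e by (intro add_mono mult_mono N_sq_le_gnorm2 order_refl) auto
    also have "\<dots> = (1 + e) * exp H * ?S" by (simp add: algebra_simps)
    finally have 2: "norm (phase' e z p) \<le> (1 + e) * exp H * ?S" .
    \<comment> \<open>Trades the linear growth of \<open>phase'\<close> for half of the exponential
      decay, which leaves an integrable majorant with rate l/2.\<close>
    have 3: "?S \<le> 2 / l * exp (l / 2 * ?S)"
      using exp_ge_add_one_self[of "l / 2 * ?S"] l by (simp add: field_simps)
    have "norm (exp (phase e z p) * phase' e z p) \<le> exp (- (l * ?S)) * ((1 + e) * exp H * ?S)"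
      unfolding norm_mult by (intro mult_mono 1 2) auto
    also have "\<dots> \<le> exp (- (l * ?S)) * ((1 + e) * exp H * (2 / l * exp (l / 2 * ?S)))"
      using e 3 by (intro mult_left_mono) auto
    also have "\<dots> = C * (exp (- (l * ?S)) * exp (l / 2 * ?S))" by (simp add: C_def)
    also have "exp (- (l * ?S)) * exp (l / 2 * ?S) = exp (- ((l / 2) * ?S))"
      unfolding exp_add[symmetric] by (simp add: algebra_simps)
    finally show "norm (exp (phase e z p) * phase' e z p) \<le> C * exp (- ((l / 2) * ?S))" .
  next
    show "integrable \<mu> (\<lambda>p. C * exp (- ((l / 2) * (gnorm2 (fst p) + gnorm2 (snd p)))))"
      using l by (intro integrable_mult_right integrable_exp_gnorm2) simp
    show "integrable \<mu> (\<lambda>p. exp (phase e z p))" if "z \<in> ball z0 r" for z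
      using rt(1)[OF that] m0 by (intro integrable_phase[OF k e]) simp
  qed simp
  then obtain D where D: "(rotated e has_field_derivative D) (at z0)" by blast
  have "((\<lambda>s::real. rotated e (z0 + \<i> * of_real s)) has_vector_derivative (\<i> * D)) (at 0)"
  proof -
    have "((\<lambda>s::real. z0 + \<i> * of_real s) has_vector_derivative \<i>) (at 0)"
      by (auto intro!: derivative_eq_intros simp: has_vector_derivative_def scaleR_conv_of_real)
    moreover have "(rotated e has_field_derivative D) (at (z0 + \<i> * of_real 0))" using D by simp
    ultimately show ?thesis using field_vector_diff_chain_at[of "\<lambda>s::real. z0 + \<i> * of_real s" \<i> 0 "rotated e" D] by (simp add: comp_def)
  qed
  moreover have "((\<lambda>s::real. rotated e (z0 + \<i> * of_real s)) has_vector_derivative 0) (at 0)"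
    unfolding rotated_vertical by (rule has_vector_derivative_const)
  ultimately have "\<i> * D = 0" by (rule vector_derivative_unique_at)
  then show ?thesis using D by simp
qed

text \<open>In the first quadrant sin t + cos t \<ge> 1, so e \<le> \<kappa> gives e (1 - cos t)
  \<le> \<kappa> sin t, and the positive term e \<kappa>^2 is left over.\<close>

lemma rate_pos:
  assumes k: "0 < \<kappa>" "\<kappa> \<le> 1" and e: "0 < e" "e \<le> \<kappa>" and t: "0 \<le> t" "t \<le> pi / 2"
  shows "rate \<kappa> e t > 0"
proof -
  have s: "sin t \<ge> 0" "cos t \<ge> 0" using t by (auto intro!: sin_ge_zero cos_ge_zero)
  have "1 \<le> (sin t + cos t)\<^sup>2"
    using s by (simp add: power2_sum mult_nonneg_nonneg)
  then have "1 \<le> sin t + cos t" using s by (simp add: power2_le_imp_le[of 1 "sin t + cos t"] abs_square_le_1 one_le_power)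
  then have "e * (1 - cos t) \<le> \<kappa> * sin t" using e s k by (intro mult_mono) auto
  moreover have "\<kappa> * sin t \<le> sin t" using k s mult_right_mono[of \<kappa> 1 "sin t"] by simp
  moreover have "e * \<kappa>\<^sup>2 > 0" using k e by simp
  ultimately show ?thesis by (simp add: rate_def algebra_simps)
qed

text \<open>Angle pi/2 of w means turning u and v by pi/4, since w enters through its square root.
  The condition e \<le> \<kappa> keeps \<open>rate\<close> positive, hence the derivative zero,
  along the whole segment.\<close>

lemma rotated_endpoints:
  assumes k: "0 < \<kappa>" "\<kappa> \<le> 1" "\<And>u. \<kappa> * gnorm2 u \<le> (N u)\<^sup>2" and e: "0 < e" "e \<le> \<kappa>"
  shows "rotated e (of_real (pi / 2)) = rotated e 0"
proof -
  let ?S = "closed_segment 0 (of_real (pi / 2)) :: complex set"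
  have "\<exists>c. \<forall>z\<in>?S. rotated e z = c"
  proof (rule has_field_derivative_zero_constant)
    fix z :: complex assume "z \<in> ?S"
    then obtain t where t: "0 \<le> t" "t \<le> 1" "z = of_real (t * (pi / 2))"
      by (auto simp: in_segment scaleR_conv_of_real)
    have Re: "Re z = t * (pi / 2)" unfolding t(3) Re_complex_of_real ..
    have "t * (pi / 2) \<le> 1 * (pi / 2)" using t by (intro mult_right_mono) auto
    then have "rate \<kappa> e (Re z) > 0" unfolding Re using t(1) by (intro rate_pos k e) auto
    then show "(rotated e has_field_derivative 0) (at z within ?S)"
      using rotated_deriv[OF k e(1)] has_field_derivative_at_within by blast
  qed simp
  then show ?thesis by force
qed

text \<open>At angle 0 the integrand is the regularised pairing composed with \<open>\<Phi>\<close>,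
  and \<open>\<Phi>\<close> transports \<open>\<mu>\<close> to Lebesgue measure.\<close>

lemma rotated_zero:
  assumes "e > 0"
  shows "rotated e 0 = of_real ((pi / sqrt (1 / 4 + e\<^sup>2)) ^ CARD('n))"
proof -
  let ?f = "\<lambda>p::(real,'n) vec \<times> (real,'n) vec. exp (\<i> * of_real (fst p \<bullet> snd p) - of_real (e * ((norm (fst p))\<^sup>2 + (norm (snd p))\<^sup>2))) :: complex"
  have m: "?f \<in> borel_measurable borel"
    by (auto intro!: borel_measurable_continuous_onI continuous_intros)
  have "phase e 0 p = \<i> * of_real (fst (\<Phi> p) \<bullet> snd (\<Phi> p)) - of_real (e * ((norm (fst (\<Phi> p)))\<^sup>2 + (norm (snd (\<Phi> p)))\<^sup>2))" for p
  proof -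
    have 1: "fst (\<Phi> p) \<bullet> snd (\<Phi> p) = (N (fst p))\<^sup>2 - (N (snd p))\<^sup>2 + twist p"
      by (simp add: \<Phi>_def case_prod_beta twist_def inner_T[symmetric] algebra_simps)
    have 2: "(norm (fst (\<Phi> p)))\<^sup>2 + (norm (snd (\<Phi> p)))\<^sup>2 = gnorm2 (fst p) + gnorm2 (snd p) + 2 * crossterm p"
      unfolding norm_\<Phi>[symmetric] by (simp add: norm_prod_def)
    show ?thesis unfolding 1 2 phase_def by simp
  qed
  then have "rotated e 0 = (LINT p|\<mu>. ?f (\<Phi> p))" unfolding rotated_def by simp
  also have "\<dots> = (LINT p|distr \<mu> lborel \<Phi>. ?f p)"
    using m by (subst integral_distr) auto
  also have "\<dots> = of_real ((pi / sqrt (1 / 4 + e\<^sup>2)) ^ CARD('n))"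
    unfolding distr_\<mu>_\<Phi> using gaussian_pairing[OF assms, where 'a="(real,'n) vec"] by simp
  finally show ?thesis .
qed

section \<open>The lower bound for the Gaussian mass\<close>

definition gauss_mass :: real where
  "gauss_mass = (LINT p|\<mu>. exp (- ((N (fst p))\<^sup>2 + (N (snd p))\<^sup>2)))"

lemma integrable_gauss:
  assumes "l > 0"
  shows "integrable \<mu> (\<lambda>p. exp (- (l * ((N (fst p))\<^sup>2 + (N (snd p))\<^sup>2))))"
proof -
  obtain \<kappa> where k: "0 < \<kappa>" "\<kappa> \<le> 1" "\<And>u. \<kappa> * gnorm2 u \<le> (N u)\<^sup>2" using gnorm2_le_N_sq by blast
  have lk: "l * \<kappa> > 0" using assms k by simp
  show ?thesis
  proof (rule Bochner_Integration.integrable_bound[OF integrable_exp_gnorm2[OF lk]])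
    show "AE p in \<mu>. norm (exp (- (l * ((N (fst p))\<^sup>2 + (N (snd p))\<^sup>2)))) \<le> norm (exp (- (l * \<kappa> * (gnorm2 (fst p) + gnorm2 (snd p)))))"
    proof (rule AE_I2)
      fix p
      have "l * (\<kappa> * (gnorm2 (fst p) + gnorm2 (snd p))) \<le> l * ((N (fst p))\<^sup>2 + (N (snd p))\<^sup>2)"
        using k(3)[of "fst p"] k(3)[of "snd p"] assms by (intro mult_left_mono) (auto simp: algebra_simps)
      then show "norm (exp (- (l * ((N (fst p))\<^sup>2 + (N (snd p))\<^sup>2)))) \<le> norm (exp (- (l * \<kappa> * (gnorm2 (fst p) + gnorm2 (snd p)))))"
        by (simp add: mult.assoc)
    qed
  qed simp
qed

text \<open>Rescaling both variables by sqrt l multiplies \<open>\<mu>\<close> by (sqrt l)^(2n) =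
  l^n.\<close>

lemma gauss_mass_scale:
  assumes "l > 0"
  shows "(LINT p|\<mu>. exp (- (l * ((N (fst p))\<^sup>2 + (N (snd p))\<^sup>2)))) = gauss_mass / l ^ CARD('n)"
proof -
  let ?f = "\<lambda>p. ennreal (exp (- ((N (fst p))\<^sup>2 + (N (snd p))\<^sup>2)))"
  have sq: "sqrt l > 0" using assms by simp
  have nn: "(\<integral>\<^sup>+p. ennreal (exp (- (l * ((N (fst p))\<^sup>2 + (N (snd p))\<^sup>2)))) \<partial>\<mu>) = ennreal (LINT p|\<mu>. exp (- (l * ((N (fst p))\<^sup>2 + (N (snd p))\<^sup>2))))" if "l > 0" for l
    using integrable_gauss[OF that] by (intro nn_integral_eq_integral) auto
  have "sqrt l ^ CARD('n) * sqrt l ^ CARD('n) = l ^ CARD('n)"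
    using assms by (simp add: power_mult_distrib[symmetric])
  then have "ennreal (l ^ CARD('n)) * (\<integral>\<^sup>+p. ?f (sqrt l *\<^sub>R fst p, sqrt l *\<^sub>R snd p) \<partial>\<mu>) = (\<integral>\<^sup>+p. ?f p \<partial>\<mu>)"
    using nn_integral_\<mu>_scale[of ?f, OF _ sq sq] by simp
  also have "(\<lambda>p. ?f (sqrt l *\<^sub>R fst p, sqrt l *\<^sub>R snd p)) = (\<lambda>p. ennreal (exp (- (l * ((N (fst p))\<^sup>2 + (N (snd p))\<^sup>2)))))"
    using assms by (simp add: N_scale power_mult_distrib algebra_simps)
  finally have "ennreal (l ^ CARD('n) * (LINT p|\<mu>. exp (- (l * ((N (fst p))\<^sup>2 + (N (snd p))\<^sup>2))))) = ennreal gauss_mass"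
    using nn[OF assms] nn[of 1] assms by (simp add: ennreal_mult' gauss_mass_def)
  then have "l ^ CARD('n) * (LINT p|\<mu>. exp (- (l * ((N (fst p))\<^sup>2 + (N (snd p))\<^sup>2)))) = gauss_mass"
    using assms by (subst (asm) ennreal_inj) (auto simp: gauss_mass_def intro!: mult_nonneg_nonneg)
  then show ?thesis using assms by (simp add: field_simps)
qed

text \<open>At angle pi/2 the diagonal part of the regularising Gaussian is purely imaginary and
  drops out of the absolute value. The mixed part costs at most the fraction e / \<kappa> of N(u)^2
  + N(v)^2, which homogeneity turns into the factor (1 - e / \<kappa>)^n.\<close>

lemma gauss_mass_ge_aux:
  assumes k: "0 < \<kappa>" "\<kappa> \<le> 1" "\<And>u. \<kappa> * gnorm2 u \<le> (N u)\<^sup>2" and e: "0 < e" "e < \<kappa>"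
  shows "(pi / sqrt (1 / 4 + e\<^sup>2)) ^ CARD('n) * (1 - e / \<kappa>) ^ CARD('n) \<le> gauss_mass"
proof -
  define l where "l = 1 - e / \<kappa>"
  have l: "l > 0" using k e by (simp add: l_def)
  have "norm (rotated e (of_real (pi / 2))) \<le> (LINT p|\<mu>. norm (exp (phase e (of_real (pi / 2)) p)))"
    unfolding rotated_def by (rule integral_norm_bound)
  also have "\<dots> \<le> (LINT p|\<mu>. exp (- (l * ((N (fst p))\<^sup>2 + (N (snd p))\<^sup>2))))"
  proof (rule integral_mono)
    show "integrable \<mu> (\<lambda>p. norm (exp (phase e (of_real (pi / 2)) p)))"
      using k e rate_pos[OF k(1,2), of e "pi / 2"] by (intro integrable_norm integrable_phase) auto
    show "integrable \<mu> (\<lambda>p. exp (- (l * ((N (fst p))\<^sup>2 + (N (snd p))\<^sup>2))))"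
      by (rule integrable_gauss[OF l])
    fix p
    have "exp (\<i> * (of_real pi / 2)) = \<i>" by (simp add: exp_eq_polar cis.ctr complex_eq_iff)
    moreover have "exp (- (\<i> * (of_real pi / 2))) = - \<i>" by (simp add: exp_eq_polar cis.ctr complex_eq_iff)
    ultimately have "Re (phase e (of_real (pi / 2)) p) = - ((N (fst p))\<^sup>2 + (N (snd p))\<^sup>2) - e * (2 * crossterm p)"
      unfolding phase_def by simp
    also have "\<dots> \<le> - ((N (fst p))\<^sup>2 + (N (snd p))\<^sup>2) + e * (((N (fst p))\<^sup>2 + (N (snd p))\<^sup>2) / \<kappa>)"
    proof -
      have "- (2 * crossterm p) \<le> gnorm2 (fst p) + gnorm2 (snd p)" using crossterm_bound[of p] by linarith
      also have "\<dots> \<le> ((N (fst p))\<^sup>2 + (N (snd p))\<^sup>2) / \<kappa>"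
        using k(1) k(3)[of "fst p"] k(3)[of "snd p"] by (simp add: field_simps)
      finally have "e * - (2 * crossterm p) \<le> e * (((N (fst p))\<^sup>2 + (N (snd p))\<^sup>2) / \<kappa>)"
        using e by (intro mult_left_mono) auto
      then show ?thesis by simp
    qed
    also have "\<dots> = - (l * ((N (fst p))\<^sup>2 + (N (snd p))\<^sup>2))" using k by (simp add: l_def field_simps)
    finally show "norm (exp (phase e (of_real (pi / 2)) p)) \<le> exp (- (l * ((N (fst p))\<^sup>2 + (N (snd p))\<^sup>2)))"
      by simp
  qed
  also have "\<dots> = gauss_mass / l ^ CARD('n)" by (rule gauss_mass_scale[OF l])
  finally have "norm (rotated e 0) \<le> gauss_mass / l ^ CARD('n)"
    using rotated_endpoints[OF k, of e] e by simp
  then have "(pi / sqrt (1 / 4 + e\<^sup>2)) ^ CARD('n) \<le> gauss_mass / l ^ CARD('n)"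
    unfolding rotated_zero[OF e(1)] norm_of_real by linarith
  then show ?thesis using l by (simp add: l_def[symmetric] field_simps)
qed

theorem gauss_mass_ge: "(2 * pi) ^ CARD('n) \<le> gauss_mass"
proof -
  obtain \<kappa> where k: "0 < \<kappa>" "\<kappa> \<le> 1" "\<And>u. \<kappa> * gnorm2 u \<le> (N u)\<^sup>2" using gnorm2_le_N_sq by blast
  have "((\<lambda>e. (pi / sqrt (1 / 4 + e\<^sup>2)) ^ CARD('n) * (1 - e / \<kappa>) ^ CARD('n)) \<longlongrightarrow>
     (pi / sqrt (1 / 4 + 0\<^sup>2)) ^ CARD('n) * (1 - 0 / \<kappa>) ^ CARD('n)) (at_right 0)"
    by (intro tendsto_intros) (use k in auto)
  moreover have "(pi / sqrt (1 / 4 + 0\<^sup>2)) ^ CARD('n) * (1 - 0 / \<kappa>) ^ CARD('n) = (2 * pi) ^ CARD('n)"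
    by (simp add: real_sqrt_divide mult.commute)
  moreover have "\<forall>\<^sub>F e in at_right 0. (pi / sqrt (1 / 4 + e\<^sup>2)) ^ CARD('n) * (1 - e / \<kappa>) ^ CARD('n) \<le> gauss_mass"
    unfolding eventually_at_right_field using k gauss_mass_ge_aux[OF k] by (intro exI[of _ \<kappa>]) auto
  ultimately show ?thesis
    using tendsto_upperbound[OF _ _ trivial_limit_at_right_real] by (simp only:)
qed

end

section \<open>Radial integrals\<close>

lemma emeasure_lborel_power_density:
  fixes t :: real assumes "t \<ge> 0" "k > 0"
  shows "(\<integral>\<^sup>+x. ennreal (real k * x ^ (k - 1)) * indicator {0..t} x \<partial>lborel) = ennreal (t ^ k)"
proof -
  have "(\<integral>\<^sup>+x. ennreal (real k * x ^ (k - 1)) * indicator {0..t} x \<partial>lborel) = ennreal (t ^ k - 0 ^ k)"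
    using assms by (intro nn_integral_FTC_Icc) (auto intro!: derivative_eq_intros)
  then show ?thesis using assms by (simp add: power_0_left)
qed

text \<open>The level condition fixes the distribution function of \<open>r\<close>, so the image of
  \<open>M\<close> on the half-line has density c k t^(k - 1). Norms, sums of two norms, gauges and
  support functions all enter through this formula.\<close>

lemma nn_integral_radial:
  fixes r :: "'a \<Rightarrow> real" and g :: "real \<Rightarrow> ennreal"
  assumes r[measurable]: "r \<in> borel_measurable M" and g[measurable]: "g \<in> borel_measurable borel"
    and r0: "\<And>x. x \<in> space M \<Longrightarrow> 0 \<le> r x" and k: "k > 0" and c: "c < top"
    and level: "\<And>t. t > 0 \<Longrightarrow> emeasure M {x \<in> space M. r x \<le> t} = c * ennreal (t ^ k)"
  shows "(\<integral>\<^sup>+x. g (r x) \<partial>M) = c * (\<integral>\<^sup>+t. g t * ennreal (real k * t ^ (k - 1)) * indicator {0..} t \<partial>lborel)"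
proof -
  define D where "D = density lborel (\<lambda>t. c * (ennreal (real k * t ^ (k - 1)) * indicator {0..} t))"
  \<comment> \<open>Level 0 lies outside the hypothesis; it is null by letting t decrease to
    0.\<close>
  have lev0: "emeasure M {x \<in> space M. r x \<le> 0} \<le> 0"
  proof (rule tendsto_lowerbound)
    have "((\<lambda>t::real. t ^ k) \<longlongrightarrow> 0 ^ k) (at_right 0)" by (intro tendsto_intros)
    then have "((\<lambda>t. ennreal (t ^ k)) \<longlongrightarrow> ennreal 0) (at_right 0)" using k by (intro tendsto_ennrealI) (simp add: power_0_left)
    then have "((\<lambda>t. c * ennreal (t ^ k)) \<longlongrightarrow> c * ennreal 0) (at_right 0)" using c by (intro ennreal_tendsto_cmult)
    then show "((\<lambda>t. c * ennreal (t ^ k)) \<longlongrightarrow> 0) (at_right (0::real))" by simp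
    show "\<forall>\<^sub>F t in at_right 0. emeasure M {x \<in> space M. r x \<le> 0} \<le> c * ennreal (t ^ k)"
      unfolding eventually_at_right_field
    proof (intro exI[of _ 1] conjI allI impI)
      fix t :: real assume "0 < t" "t < 1"
      then show "emeasure M {x \<in> space M. r x \<le> 0} \<le> c * ennreal (t ^ k)"
        unfolding level[OF \<open>0 < t\<close>, symmetric] by (intro emeasure_mono) auto
    qed simp
  qed simp
  have lev: "emeasure M {x \<in> space M. r x \<le> t} = (if t \<le> 0 then 0 else c * ennreal (t ^ k))" for t
  proof (cases "t \<le> 0")
    case True
    then have "emeasure M {x \<in> space M. r x \<le> t} \<le> emeasure M {x \<in> space M. r x \<le> 0}"
      by (intro emeasure_mono) auto
    with True lev0 show ?thesis by simp
  qed (use level in simp)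
  have levD: "emeasure D {..t} = (if t \<le> 0 then 0 else c * ennreal (t ^ k))" for t
  proof -
    have "emeasure D {..t} = (\<integral>\<^sup>+x. c * (ennreal (real k * x ^ (k - 1)) * indicator {0..t} x) \<partial>lborel)"
      unfolding D_def by (subst emeasure_density) (auto intro!: nn_integral_cong simp: indicator_def)
    also have "\<dots> = c * (\<integral>\<^sup>+x. ennreal (real k * x ^ (k - 1)) * indicator {0..t} x \<partial>lborel)"
      by (rule nn_integral_cmult) measurable
    also have "\<dots> = (if t \<le> 0 then 0 else c * ennreal (t ^ k))"
    proof (cases "t \<le> 0")
      case True
      have "AE x in lborel. ennreal (real k * x ^ (k - 1)) * indicator {0..t} x = 0"
        using AE_lborel_singleton[of "0::real"] by eventually_elim (use True in \<open>auto simp: indicator_def\<close>)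
      then have "(\<integral>\<^sup>+x. ennreal (real k * x ^ (k - 1)) * indicator {0..t} x \<partial>lborel) = 0"
        by (subst nn_integral_0_iff_AE) auto
      then show ?thesis using True by simp
    next
      case False
      then show ?thesis using emeasure_lborel_power_density[of t k] k by simp
    qed
    finally show ?thesis .
  qed
  have "distr M borel r = D"
  proof (rule measure_eqI_generator_eq[where \<Omega>=UNIV and E="range (\<lambda>t::real. {..t})" and A="\<lambda>n. {..real n}"])
    show "Int_stable (range (\<lambda>t::real. {..t}))" by (auto simp: Int_stable_def)
    show "emeasure (distr M borel r) X = emeasure D X" if "X \<in> range (\<lambda>t::real. {..t})" for X
    proof -
      from that obtain t where X: "X = {..t}" by auto
      have "emeasure (distr M borel r) X = emeasure M {x \<in> space M. r x \<le> t}"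
        unfolding X by (subst emeasure_distr) (auto intro!: arg_cong[where f="emeasure M"])
      then show ?thesis unfolding X lev levD .
    qed
    show "sets (distr M borel r) = sigma_sets UNIV (range (\<lambda>t::real. {..t}))"
      by (simp add: borel_eq_atMost)
    show "sets D = sigma_sets UNIV (range (\<lambda>t::real. {..t}))"
      by (simp add: D_def borel_eq_atMost)
    show "(\<Union>n. {..real n}) = UNIV" by (auto simp: real_arch_simple)
    show "emeasure (distr M borel r) {..real n} \<noteq> \<infinity>" for n
    proof -
      have "emeasure (distr M borel r) {..real n} = emeasure M {x \<in> space M. r x \<le> real n}"
        by (subst emeasure_distr) (auto intro!: arg_cong[where f="emeasure M"])
      then show ?thesis using c unfolding lev by (auto simp: ennreal_mult_eq_top_iff)
    qed
  qed auto
  then have "(\<integral>\<^sup>+t. g t \<partial>D) = (\<integral>\<^sup>+t. g t \<partial>distr M borel r)" by simp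
  also have "\<dots> = (\<integral>\<^sup>+x. g (r x) \<partial>M)" by (rule nn_integral_distr) auto
  finally have "(\<integral>\<^sup>+x. g (r x) \<partial>M) = (\<integral>\<^sup>+t. g t \<partial>D)" ..
  also have "\<dots> = (\<integral>\<^sup>+t. c * (g t * ennreal (real k * t ^ (k - 1)) * indicator {0..} t) \<partial>lborel)"
    unfolding D_def by (subst nn_integral_density) (auto intro!: nn_integral_cong simp: mult_ac)
  also have "\<dots> = c * (\<integral>\<^sup>+t. g t * ennreal (real k * t ^ (k - 1)) * indicator {0..} t \<partial>lborel)"
    by (rule nn_integral_cmult) measurable
  finally show ?thesis .
qed

definition radial_integral :: "(real \<Rightarrow> ennreal) \<Rightarrow> nat \<Rightarrow> ennreal" where
  "radial_integral g k = (\<integral>\<^sup>+t. g t * ennreal (real k * t ^ (k - 1)) * indicator {0..} t \<partial>lborel)"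

lemma radial_integral_exp: 
  assumes "k > 0" shows "radial_integral (\<lambda>t. ennreal (exp (- t))) k = ennreal (fact k)"
proof -
  have "radial_integral (\<lambda>t. ennreal (exp (- t))) k = (\<integral>\<^sup>+t. ennreal (real k) * (ennreal (t ^ (k - 1) * exp (- t)) * indicator {0..} t) \<partial>lborel)"
    unfolding radial_integral_def
    by (intro nn_integral_cong) (auto simp: indicator_def ennreal_mult' mult_ac)
  also have "\<dots> = ennreal (real k) * (\<integral>\<^sup>+t. ennreal (t ^ (k - 1) * exp (- t)) * indicator {0..} t \<partial>lborel)"
    by (rule nn_integral_cmult) measurable
  also have "(\<integral>\<^sup>+t. ennreal (t ^ (k - 1) * exp (- t)) * indicator {0..} t \<partial>lborel) = ennreal (fact (k - 1))"
    using nn_intergal_power_times_exp_Ici[of "k - 1"] by (simp add: ennreal_fact)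
  also have "ennreal (real k) * ennreal (fact (k - 1)) = ennreal (fact k)"
    using assms by (simp add: ennreal_mult'[symmetric] fact_reduce)
  finally show ?thesis .
qed

lemma emeasure_norm_le:
  assumes "t > 0"
  shows "emeasure lborel {x::'a::euclidean_space. norm x \<le> t} = ennreal (unit_ball_vol (real DIM('a))) * ennreal (t ^ DIM('a))"
proof -
  have "{x::'a. norm x \<le> t} = cball 0 t" by (auto simp: dist_norm)
  then show ?thesis using assms emeasure_cball[of t "0::'a"] by (simp add: ennreal_mult')
qed

text \<open>The Euclidean norm serves as test case: the Gaussian integral pi^(n/2) is the volume of
  the unit ball times the radial integral.\<close>

lemma radial_integral_gauss:
  "radial_integral (\<lambda>t. ennreal (exp (- t\<^sup>2))) DIM('a::euclidean_space) = ennreal (Gamma (real DIM('a) / 2 + 1))"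
proof -
  let ?n = "DIM('a)"
  have G: "Gamma (real ?n / 2 + 1) > 0" by (intro Gamma_real_pos) simp
  have "ennreal (sqrt pi ^ ?n) = (\<integral>\<^sup>+x. ennreal (exp (- (norm (x::'a))\<^sup>2)) \<partial>lborel)"
    using gaussian_integral[of 1, where 'a='a] nn_integral_eq_integral[of lborel "\<lambda>x::'a. exp (- (norm x)\<^sup>2)"] by simp
  also have "\<dots> = ennreal (unit_ball_vol (real ?n)) * radial_integral (\<lambda>t. ennreal (exp (- t\<^sup>2))) ?n"
    unfolding radial_integral_def
    by (rule nn_integral_radial[where r=norm and g="\<lambda>t. ennreal (exp (- t\<^sup>2))"]) (auto simp: emeasure_norm_le)
  finally have eq: "ennreal (unit_ball_vol (real ?n)) * radial_integral (\<lambda>t. ennreal (exp (- t\<^sup>2))) ?n = ennreal (sqrt pi ^ ?n)" ..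
  have u: "unit_ball_vol (real ?n) > 0" by (simp add: unit_ball_vol_pos)
  have "unit_ball_vol (real ?n) = pi powr (real ?n / 2) / Gamma (real ?n / 2 + 1)"
    by (simp add: unit_ball_vol_def)
  also have "pi powr (real ?n / 2) = sqrt pi ^ ?n"
    by (simp add: powr_half_sqrt_powr powr_realpow real_sqrt_power)
  finally have v: "sqrt pi ^ ?n = unit_ball_vol (real ?n) * Gamma (real ?n / 2 + 1)" by (simp only: nonzero_eq_divide_eq[OF less_imp_neq[OF G, symmetric]])
  have "ennreal (unit_ball_vol (real ?n)) * radial_integral (\<lambda>t. ennreal (exp (- t\<^sup>2))) ?n
     = ennreal (unit_ball_vol (real ?n)) * ennreal (Gamma (real ?n / 2 + 1))"
    unfolding eq v using G u by (simp add: ennreal_mult')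
  then show ?thesis using u by (simp add: ennreal_mult_cancel_left)
qed

text \<open>The integral is k B(k, k + 1) = (k!)^2 / (2k)!, the constant of the Rogers-Shephard
  inequality.\<close>

lemma radial_integral_beta:
  assumes "k > 0"
  shows "radial_integral (\<lambda>t. ennreal ((1 - t) ^ k) * indicator {0..1} t) k = ennreal ((fact k)\<^sup>2 / fact (2 * k))"
proof -
  have B: "real k * Beta (real k) (real (Suc k)) = (fact k)\<^sup>2 / fact (2 * k)"
  proof -
    have "Gamma (real k) = fact (k - 1)" "Gamma (real (Suc k)) = fact k" "Gamma (real k + real (Suc k)) = fact (2 * k)"
      using Gamma_fact[of "k - 1", where 'a=real] Gamma_fact[of k, where 'a=real] Gamma_fact[of "2 * k", where 'a=real] assms
      by (simp_all add: of_nat_diff algebra_simps)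
    then show ?thesis using fact_reduce[OF assms, where 'a=real] by (simp add: Beta_def power2_eq_square)
  qed
  have "((\<lambda>t. t powr (real k - 1) * (1 - t) powr (real (Suc k) - 1)) has_integral Beta (real k) (real (Suc k))) {0..1}"
    using assms by (intro has_integral_Beta_real) auto
  then have "((\<lambda>t. t ^ (k - 1) * (1 - t) ^ k) has_integral Beta (real k) (real (Suc k))) {0..1}"
  proof (rule has_integral_spike[where S="{0, 1}", rotated 2])
    fix t :: real assume "t \<in> {0..1} - {0, 1}"
    then have t: "0 < t" "0 < 1 - t" by auto
    have "t powr (real k - 1) = t ^ (k - 1)" using t(1) assms powr_realpow[of t "k - 1"] by (simp add: of_nat_diff)
    moreover have "(1 - t) powr (real (Suc k) - 1) = (1 - t) ^ k" using powr_realpow[OF t(2), of k] by simp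
    ultimately show "t ^ (k - 1) * (1 - t) ^ k = t powr (real k - 1) * (1 - t) powr (real (Suc k) - 1)" by simp
  qed simp
  then have "((\<lambda>t. real k * (t ^ (k - 1) * (1 - t) ^ k)) has_integral (real k * Beta (real k) (real (Suc k)))) {0..1}"
    by (rule has_integral_mult_right)
  then have "(\<integral>\<^sup>+t. ennreal (real k * (t ^ (k - 1) * (1 - t) ^ k)) * indicator {0..1} t \<partial>lborel) = ennreal ((fact k)\<^sup>2 / fact (2 * k))"
    unfolding B by (intro nn_integral_has_integral_lebesgue') auto
  also have "(\<integral>\<^sup>+t. ennreal (real k * (t ^ (k - 1) * (1 - t) ^ k)) * indicator {0..1} t \<partial>lborel)
     = radial_integral (\<lambda>t. ennreal ((1 - t) ^ k) * indicator {0..1} t) k"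
    unfolding radial_integral_def
    by (intro nn_integral_cong) (auto simp: indicator_def ennreal_mult'[symmetric] mult_ac)
  finally show ?thesis .
qed

section \<open>The Mahler volume of a smooth unit ball\<close>

lemma closed_polar_body: "closed (polar_body K)"
proof -
  have "polar_body K = (\<Inter>x\<in>K. {y. x \<bullet> y \<le> 1})" by (auto simp: polar_body_def)
  then show ?thesis by (auto intro!: closed_INT closed_halfspace_le)
qed

lemma bounded_polar_body:
  assumes "r > 0" "cball 0 r \<subseteq> K" shows "bounded (polar_body K)"
proof -
  have "norm y \<le> 1 / r" if "y \<in> polar_body K" for y
  proof (cases "y = 0")
    case False
    have "(r / norm y) *\<^sub>R y \<in> K" using assms False by (intro subsetD[OF assms(2)]) simp
    then have "((r / norm y) *\<^sub>R y) \<bullet> y \<le> 1" using that by (auto simp: polar_body_def)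
    moreover have "((r / norm y) *\<^sub>R y) \<bullet> y = r * norm y"
      using False by (simp add: power2_norm_eq_inner[symmetric] power2_eq_square)
    ultimately show ?thesis using assms(1) by (simp add: field_simps)
  qed (use assms in simp)
  then show ?thesis by (auto simp: bounded_iff)
qed

lemma compact_polar_body:
  assumes "r > 0" "cball 0 r \<subseteq> K" shows "compact (polar_body K)"
  using closed_polar_body bounded_polar_body[OF assms] by (simp add: compact_eq_bounded_closed)

lemma emeasure_lborel_compact:
  "compact S \<Longrightarrow> emeasure lborel S = ennreal (measure lebesgue S)"
  using emeasure_compact_finite[of S]
  by (subst emeasure_eq_ennreal_measure) (auto simp: measure_completion compact_imp_closed borel_closed)



context smooth_norm begin

text \<open>A constant that is never computed: it cancels between the Gaussian mass and the mass of
  the set N u + N v \<le> 1.\<close>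

definition box_mass :: ennreal where "box_mass = emeasure \<mu> {p. N (fst p) \<le> 1 \<and> N (snd p) \<le> 1}"

lemma box_mass_finite: "box_mass < top"
proof -
  let ?f = "\<lambda>p. exp (- ((N (fst p))\<^sup>2 + (N (snd p))\<^sup>2))"
  have int: "integrable \<mu> ?f" using integrable_gauss[of 1] by simp
  have "box_mass = (\<integral>\<^sup>+p. indicator {p. N (fst p) \<le> 1 \<and> N (snd p) \<le> 1} p \<partial>\<mu>)"
    unfolding box_mass_def by (subst nn_integral_indicator) auto
  also have "\<dots> \<le> (\<integral>\<^sup>+p. ennreal (exp 2 * ?f p) \<partial>\<mu>)"
  proof (rule nn_integral_mono)
    fix p
    have "1 \<le> exp 2 * ?f p" if "N (fst p) \<le> 1" "N (snd p) \<le> 1"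
    proof -
      have "(N (fst p))\<^sup>2 \<le> 1" "(N (snd p))\<^sup>2 \<le> 1" using that N_nonneg by (auto intro!: power_le_one)
      then have "1 \<le> exp (2 + - ((N (fst p))\<^sup>2 + (N (snd p))\<^sup>2))" by simp
      then show ?thesis unfolding exp_add .
    qed
    then show "indicator {p. N (fst p) \<le> 1 \<and> N (snd p) \<le> 1} p \<le> ennreal (exp 2 * ?f p)"
      by (auto simp: indicator_def simp del: mult_exp_exp)
  qed
  also have "\<dots> < top"
    using int by (subst nn_integral_eq_integral) auto
  finally show ?thesis .
qed

lemma box_mass_level:
  assumes "s > 0" "t > 0"
  shows "emeasure \<mu> {p. N (fst p) \<le> s \<and> N (snd p) \<le> t} = box_mass * ennreal (t ^ CARD('n)) * ennreal (s ^ CARD('n))"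
proof -
  let ?I = "indicator {p. N (fst p) \<le> s \<and> N (snd p) \<le> t} :: _ \<Rightarrow> ennreal"
  have "ennreal (s ^ CARD('n) * t ^ CARD('n)) * (\<integral>\<^sup>+p. ?I (s *\<^sub>R fst p, t *\<^sub>R snd p) \<partial>\<mu>) = (\<integral>\<^sup>+p. ?I p \<partial>\<mu>)"
    by (rule nn_integral_\<mu>_scale) (use assms in auto)
  also have "(\<lambda>p. ?I (s *\<^sub>R fst p, t *\<^sub>R snd p)) = indicator {p. N (fst p) \<le> 1 \<and> N (snd p) \<le> 1}"
    using assms by (auto simp: fun_eq_iff indicator_def N_scale)
  finally show ?thesis
    using assms by (simp add: box_mass_def ennreal_mult mult_ac)
qed

text \<open>The one-variable formula is applied in u with v confined to a level set, and again in v
  with weight \<open>g (N (fst p))\<close>. The second application needs a finite constant, hence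
  the condition on \<open>g\<close>.\<close>

lemma nn_integral_biradial:
  assumes g[measurable]: "g \<in> borel_measurable borel" and h[measurable]: "h \<in> borel_measurable borel"
    and gf: "radial_integral g CARD('n) < top"
  shows "(\<integral>\<^sup>+p. g (N (fst p)) * h (N (snd p)) \<partial>\<mu>) = box_mass * radial_integral g CARD('n) * radial_integral h CARD('n)"
proof -
  have 1: "(\<integral>\<^sup>+p. g (N (fst p)) * indicator {p. N (snd p) \<le> t} p \<partial>\<mu>) = box_mass * radial_integral g CARD('n) * ennreal (t ^ CARD('n))" if t: "t > 0" for t
  proof -
    let ?M = "density \<mu> (indicator {p. N (snd p) \<le> t})"
    have "(\<integral>\<^sup>+p. g (N (fst p)) * indicator {p. N (snd p) \<le> t} p \<partial>\<mu>) = (\<integral>\<^sup>+p. g (N (fst p)) \<partial>?M)"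
      by (subst nn_integral_density) (auto simp: mult_ac)
    also have "\<dots> = (box_mass * ennreal (t ^ CARD('n))) * radial_integral g CARD('n)"
      unfolding radial_integral_def
    proof (rule nn_integral_radial)
      fix s :: real assume s: "s > 0"
      have "emeasure ?M {p \<in> space ?M. N (fst p) \<le> s} = (\<integral>\<^sup>+p. indicator {p. N (snd p) \<le> t} p * indicator {p \<in> space ?M. N (fst p) \<le> s} p \<partial>\<mu>)"
        by (rule emeasure_density) auto
      also have "\<dots> = (\<integral>\<^sup>+p. indicator {p. N (fst p) \<le> s \<and> N (snd p) \<le> t} p \<partial>\<mu>)"
        by (rule nn_integral_cong) (auto simp: indicator_def)
      also have "\<dots> = box_mass * ennreal (t ^ CARD('n)) * ennreal (s ^ CARD('n))"
        using box_mass_level[OF s t] by simp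
      finally show "emeasure ?M {p \<in> space ?M. N (fst p) \<le> s} = box_mass * ennreal (t ^ CARD('n)) * ennreal (s ^ CARD('n))" .
    qed (use N_nonneg box_mass_finite in \<open>auto simp: ennreal_mult_less_top\<close>)
    finally show ?thesis by (simp add: mult_ac)
  qed
  let ?M = "density \<mu> (\<lambda>p. g (N (fst p)))"
  have "(\<integral>\<^sup>+p. g (N (fst p)) * h (N (snd p)) \<partial>\<mu>) = (\<integral>\<^sup>+p. h (N (snd p)) \<partial>?M)"
    by (subst nn_integral_density) auto
  also have "\<dots> = box_mass * radial_integral g CARD('n) * radial_integral h CARD('n)"
    unfolding radial_integral_def[of h]
  proof (rule nn_integral_radial)
    fix t :: real assume t: "t > 0"
    have "emeasure ?M {p \<in> space ?M. N (snd p) \<le> t} = (\<integral>\<^sup>+p. g (N (fst p)) * indicator {p. N (snd p) \<le> t} p \<partial>\<mu>)"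
      by (subst emeasure_density) auto
    then show "emeasure ?M {p \<in> space ?M. N (snd p) \<le> t} = box_mass * radial_integral g CARD('n) * ennreal (t ^ CARD('n))"
      using 1[OF t] by simp
  qed (use N_nonneg box_mass_finite gf in \<open>auto simp: ennreal_mult_less_top\<close>)
  finally show ?thesis .
qed

text \<open>Both \<open>gauss_mass\<close> and \<open>sum_mass\<close> are multiples of \<open>box_mass\<close> by the degree \<open>n\<close> homogeneity of \<open>\<mu>\<close> in each variable;
  \<open>sum_mass\<close> is bounded by the Mahler volume since \<open>\<Phi>\<close> maps \<open>{N u + N v \<le> 1}\<close> into the product of the unit ball and its polar.\<close>
lemma gauss_mass_eq: "ennreal gauss_mass = box_mass * ennreal (Gamma (real CARD('n) / 2 + 1)) * ennreal (Gamma (real CARD('n) / 2 + 1))"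
proof -
  let ?g = "\<lambda>t::real. ennreal (exp (- t\<^sup>2))"
  have R: "radial_integral ?g CARD('n) = ennreal (Gamma (real CARD('n) / 2 + 1))"
    using radial_integral_gauss[where 'a="(real,'n) vec"] by simp
  have "ennreal gauss_mass = (\<integral>\<^sup>+p. ennreal (exp (- ((N (fst p))\<^sup>2 + (N (snd p))\<^sup>2))) \<partial>\<mu>)"
    unfolding gauss_mass_def using integrable_gauss[of 1] by (intro nn_integral_eq_integral[symmetric]) auto
  also have "\<dots> = (\<integral>\<^sup>+p. ?g (N (fst p)) * ?g (N (snd p)) \<partial>\<mu>)"
    by (intro nn_integral_cong) (simp add: ennreal_mult'[symmetric] exp_add[symmetric])
  also have "\<dots> = box_mass * radial_integral ?g CARD('n) * radial_integral ?g CARD('n)"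
    by (rule nn_integral_biradial) (auto simp: R)
  finally show ?thesis unfolding R .
qed

definition sum_mass :: ennreal where "sum_mass = emeasure \<mu> {p. N (fst p) + N (snd p) \<le> 1}"

text \<open>The integral of exp (- N u - N v) is evaluated radially in N u + N v, which has 2n as
  its exponent, and as a product of two radial integrals. Comparison gives the ratio (n!)^2 / (2n)!
  of the two masses.\<close>

lemma sum_mass_eq: "sum_mass * ennreal (fact (2 * CARD('n))) = box_mass * ennreal (fact CARD('n)) * ennreal (fact CARD('n))"
proof -
  let ?g = "\<lambda>t::real. ennreal (exp (- t))"
  have R: "radial_integral ?g CARD('n) = ennreal (fact CARD('n))"
    by (rule radial_integral_exp) simp
  have lev: "emeasure \<mu> {p. N (fst p) + N (snd p) \<le> t} = sum_mass * ennreal (t ^ (2 * CARD('n)))" if t: "t > 0" for t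
  proof -
    let ?I = "indicator {p. N (fst p) + N (snd p) \<le> t} :: _ \<Rightarrow> ennreal"
    have "ennreal (t ^ CARD('n) * t ^ CARD('n)) * (\<integral>\<^sup>+p. ?I (t *\<^sub>R fst p, t *\<^sub>R snd p) \<partial>\<mu>) = (\<integral>\<^sup>+p. ?I p \<partial>\<mu>)"
      by (rule nn_integral_\<mu>_scale) (use t in auto)
    also have "(\<lambda>p. ?I (t *\<^sub>R fst p, t *\<^sub>R snd p)) = indicator {p. N (fst p) + N (snd p) \<le> 1}"
      using t by (auto simp: fun_eq_iff indicator_def N_scale distrib_left[symmetric])
    finally have "ennreal (t ^ CARD('n) * t ^ CARD('n)) * sum_mass = emeasure \<mu> {p. N (fst p) + N (snd p) \<le> t}"
      by (simp add: sum_mass_def)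
    moreover have "t ^ CARD('n) * t ^ CARD('n) = t ^ (2 * CARD('n))" by (simp add: mult_2 power_add)
    ultimately show ?thesis by (simp only: mult.commute)
  qed
  have fin: "sum_mass < top"
  proof -
    have "sum_mass \<le> box_mass" unfolding sum_mass_def box_mass_def
      by (intro emeasure_mono) (auto intro: order_trans[rotated] simp: N_nonneg)
    then show ?thesis using box_mass_finite by (rule order.strict_trans1)
  qed
  have "(\<integral>\<^sup>+p. ?g (N (fst p) + N (snd p)) \<partial>\<mu>) = sum_mass * radial_integral ?g (2 * CARD('n))"
    unfolding radial_integral_def
    by (rule nn_integral_radial) (use N_nonneg fin lev in \<open>auto\<close>)
  also have "radial_integral ?g (2 * CARD('n)) = ennreal (fact (2 * CARD('n)))"
    by (rule radial_integral_exp) simp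
  finally have "sum_mass * ennreal (fact (2 * CARD('n))) = (\<integral>\<^sup>+p. ?g (N (fst p) + N (snd p)) \<partial>\<mu>)" ..
  also have "\<dots> = (\<integral>\<^sup>+p. ?g (N (fst p)) * ?g (N (snd p)) \<partial>\<mu>)"
    by (intro nn_integral_cong) (simp add: ennreal_mult'[symmetric] exp_add[symmetric])
  also have "\<dots> = box_mass * radial_integral ?g CARD('n) * radial_integral ?g CARD('n)"
    by (rule nn_integral_biradial) (auto simp: R)
  finally show ?thesis unfolding R .
qed

lemma unit_ball_cball: obtains r where "r > 0" "cball 0 r \<subseteq> {x. N x \<le> 1}"
proof -
  obtain C where C: "C > 0" "\<And>u. N u \<le> C * norm u" using N_bound by blast
  have "N u \<le> 1" if "norm u \<le> 1 / C" for u
  proof -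
    have "N u \<le> C * norm u" by (rule C)
    also have "\<dots> \<le> C * (1 / C)" using that C(1) by (intro mult_left_mono) auto
    finally show ?thesis using C(1) by simp
  qed
  with C(1) show ?thesis by (intro that[of "1 / C"]) auto
qed

lemma compact_unit_ball: "compact {x. N x \<le> 1}"
proof -
  have "norm u \<le> sqrt (1 / \<eta>)" if "N u \<le> 1" for u
  proof -
    have "\<eta> * (norm u)\<^sup>2 \<le> 1" using N_ge[of u] power_le_one[OF N_nonneg that, of 2] by linarith
    then have "(norm u)\<^sup>2 \<le> 1 / \<eta>" using \<eta>_pos by (simp add: field_simps)
    then show ?thesis by (rule real_le_rsqrt)
  qed
  then have "bounded {x. N x \<le> 1}" by (auto simp: bounded_iff)
  moreover have "closed {x. N x \<le> 1}" by (intro closed_Collect_le continuous_on_N continuous_intros)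
  ultimately show ?thesis by (simp add: compact_eq_bounded_closed)
qed

theorem mahler_volume_unit_ball:
  "(2 * pi) ^ CARD('n) * (fact CARD('n))\<^sup>2 / (fact (2 * CARD('n)) * (Gamma (real CARD('n) / 2 + 1))\<^sup>2)
     \<le> mahler_volume {x. N x \<le> 1}"
proof -
  let ?L = "{x. N x \<le> 1}" and ?P = "polar_body {x. N x \<le> 1}"
  let ?G = "Gamma (real CARD('n) / 2 + 1)"
  obtain r where r: "r > 0" "cball 0 r \<subseteq> ?L" using unit_ball_cball by blast
  have cP: "compact ?P" by (rule compact_polar_body[OF r])
  have [measurable]: "?L \<in> sets borel" "?P \<in> sets borel"
    using cP compact_unit_ball by (auto simp: borel_compact)
  \<comment> \<open>The triangle inequality for \<open>N\<close> comes from \<open>T_le\<close> at u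
    + v; evenness of \<open>N\<close> accounts for the minus sign in the second component.\<close>
  have sub: "\<Phi> p \<in> ?L \<times> ?P" if p: "N (fst p) + N (snd p) \<le> 1" for p
  proof -
    obtain u v where uv: "p = (u, v)" by (cases p)
    have "(N (u + v))\<^sup>2 = u \<bullet> T (u + v) + v \<bullet> T (u + v)" by (simp add: inner_T[symmetric] inner_add_left)
    also have "\<dots> \<le> N u * N (u + v) + N v * N (u + v)" by (intro add_mono T_le)
    finally have "N (u + v) * N (u + v) \<le> (N u + N v) * N (u + v)" by (simp add: power2_eq_square algebra_simps)
    then have "N (u + v) \<le> N u + N v"
      using N_nonneg[of "u + v"] N_nonneg[of u] N_nonneg[of v] by (cases "N (u + v) = 0") (auto simp: mult_le_cancel_right)
    then have 1: "u + v \<in> ?L" using p uv by simp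
    have "x \<bullet> (T u - T v) \<le> 1" if "N x \<le> 1" for x
    proof -
      have "x \<bullet> (T u - T v) = x \<bullet> T u + (- x) \<bullet> T v" by (simp add: inner_diff_right)
      also have "\<dots> \<le> N x * N u + N (- x) * N v" by (intro add_mono T_le)
      also have "N (- x) = N x" using N_scale[of "-1" x] by simp
      also have "N x * N u + N x * N v \<le> 1 * N u + 1 * N v"
        using that N_nonneg by (intro add_mono mult_right_mono) auto
      also have "\<dots> \<le> 1" using p uv by simp
      finally show ?thesis .
    qed
    then have 2: "T u - T v \<in> ?P" by (auto simp: polar_body_def)
    show ?thesis using 1 2 by (simp add: uv \<Phi>_def)
  qed
  have "sum_mass \<le> emeasure \<mu> (\<Phi> -` (?L \<times> ?P) \<inter> space \<mu>)"
    unfolding sum_mass_def using sub by (intro emeasure_mono) (auto intro!: measurable_sets_borel[OF measurable_\<Phi>] borel_Times)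
  also have "\<dots> = emeasure (distr \<mu> lborel \<Phi>) (?L \<times> ?P)"
    by (subst emeasure_distr) (auto intro: borel_Times)
  also have "\<dots> = emeasure (lborel \<Otimes>\<^sub>M lborel) (?L \<times> ?P)"
    unfolding distr_\<mu>_\<Phi> lborel_prod ..
  also have "\<dots> = emeasure lborel ?L * emeasure lborel ?P"
    by (intro lborel.emeasure_pair_measure_Times) auto
  also have "\<dots> = ennreal (mahler_volume ?L)"
    by (simp add: emeasure_lborel_compact cP compact_unit_ball mahler_volume_def ennreal_mult')
  finally have w: "sum_mass \<le> ennreal (mahler_volume ?L)" .
  have G: "?G > 0" by (intro Gamma_real_pos) simp
  \<comment> \<open>The factor (n!)^2 lets \<open>box_mass\<close> be eliminated without a division
    in the extended reals.\<close>
  have "ennreal (gauss_mass * (fact CARD('n))\<^sup>2) = sum_mass * ennreal (fact (2 * CARD('n)) * ?G\<^sup>2)"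
  proof -
    have "ennreal (gauss_mass * (fact CARD('n))\<^sup>2) = ennreal gauss_mass * (ennreal (fact CARD('n)) * ennreal (fact CARD('n)))"
      by (simp add: ennreal_mult'' power2_eq_square)
    also have "\<dots> = (box_mass * ennreal (fact CARD('n)) * ennreal (fact CARD('n))) * (ennreal ?G * ennreal ?G)"
      unfolding gauss_mass_eq by (simp only: mult_ac)
    also have "\<dots> = sum_mass * (ennreal (fact (2 * CARD('n))) * (ennreal ?G * ennreal ?G))"
      unfolding sum_mass_eq[symmetric] by (simp only: mult_ac)
    also have "ennreal (fact (2 * CARD('n))) * (ennreal ?G * ennreal ?G) = ennreal (fact (2 * CARD('n)) * ?G\<^sup>2)"
      using G by (simp add: ennreal_mult'' power2_eq_square)
    finally show ?thesis .
  qed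
  also have "\<dots> \<le> ennreal (mahler_volume ?L) * ennreal (fact (2 * CARD('n)) * ?G\<^sup>2)"
    by (intro mult_right_mono w) simp
  also have "\<dots> = ennreal (mahler_volume ?L * (fact (2 * CARD('n)) * ?G\<^sup>2))"
    by (simp add: ennreal_mult'' G)
  finally have "gauss_mass * (fact CARD('n))\<^sup>2 \<le> mahler_volume ?L * (fact (2 * CARD('n)) * ?G\<^sup>2)"
    by (subst (asm) ennreal_le_iff) (auto simp: mahler_volume_def)
  moreover have "(2 * pi) ^ CARD('n) * (fact CARD('n))\<^sup>2 \<le> gauss_mass * (fact CARD('n))\<^sup>2"
    by (intro mult_right_mono gauss_mass_ge) simp
  ultimately have "(2 * pi) ^ CARD('n) * (fact CARD('n))\<^sup>2 \<le> mahler_volume ?L * (fact (2 * CARD('n)) * ?G\<^sup>2)"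
    by linarith
  moreover have "fact (2 * CARD('n)) * ?G\<^sup>2 > 0" by (intro mult_pos_pos zero_less_power G) simp
  ultimately show ?thesis by (simp only: pos_divide_le_eq)
qed

end

section \<open>Smooth norms from finitely many slabs\<close>

text \<open>The graph of the convex function x^d lies above its tangent at \<open>a\<close>. Summed
  over normalised terms this yields Hoelder's inequality for the exponents d and d / (d -
  1).\<close>

lemma young_even_power:
  fixes a b :: real assumes "even d" "d > 0"
  shows "real d * (a ^ (d - 1) * b) \<le> (real d - 1) * a ^ d + b ^ d"
proof -
  have "convex_on UNIV (\<lambda>x::real. x ^ d)" using assms by (intro convex_power_even)
  then have *: "b ^ d - a ^ d \<ge> (real d * a ^ (d - 1)) * (b - a)"
    by (rule convex_on_imp_above_tangent) (auto intro!: derivative_eq_intros)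
  define p where "p = a ^ (d - 1)"
  have "a ^ d = p * a" unfolding p_def using assms(2) by (metis power_minus_mult)
  then show ?thesis using * unfolding p_def[symmetric] by (simp add: algebra_simps)
qed

lemma cauchy_schwarz_two_terms: 
  fixes a b c d :: real assumes "a \<ge> 0" "b \<ge> 0" "c \<ge> 0" "d \<ge> 0"
  shows "a * b + c * d \<le> sqrt (a\<^sup>2 + c\<^sup>2) * sqrt (b\<^sup>2 + d\<^sup>2)"
proof -
  have "(a * b + c * d)\<^sup>2 \<le> (a\<^sup>2 + c\<^sup>2) * (b\<^sup>2 + d\<^sup>2)"
    using zero_le_power2[of "a * d - b * c"] by (simp add: power2_eq_square algebra_simps)
  then have "a * b + c * d \<le> sqrt ((a\<^sup>2 + c\<^sup>2) * (b\<^sup>2 + d\<^sup>2))" by (rule real_le_rsqrt)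
  then show ?thesis by (simp add: real_sqrt_mult)
qed

text \<open>The norm will satisfy N^2 = Q + \<eta> |x|^2, where the square root of \<open>Q\<close>
  is the l^(2m) norm of the values a \<bullet> x. Even exponents give smoothness away from 0, large
  \<open>m\<close> brings this close to the maximum of |a \<bullet> x|, whose unit ball is an
  intersection of slabs, and the Euclidean term supplies strong convexity. The separation property
  keeps \<open>P\<close> positive off the origin.\<close>

locale power_norm =
  fixes F :: "(real^'n::{finite,wellorder}) set" and m :: nat and \<eta> :: real
  assumes finF: "finite F" and m: "m > 0" and \<eta>: "\<eta> > 0"
    and sep: "x \<noteq> 0 \<Longrightarrow> \<exists>a\<in>F. a \<bullet> x \<noteq> 0"
begin

definition P :: "(real,'n) vec \<Rightarrow> real" where "P x = (\<Sum>a\<in>F. (a \<bullet> x) ^ (2 * m))"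
definition Q :: "(real,'n) vec \<Rightarrow> real" where "Q x = P x powr (1 / real m)"
definition T0 :: "(real,'n) vec \<Rightarrow> (real,'n) vec" where
  "T0 x = (P x powr (1 / real m - 1)) *\<^sub>R (\<Sum>a\<in>F. (a \<bullet> x) ^ (2 * m - 1) *\<^sub>R a)"
definition N :: "(real,'n) vec \<Rightarrow> real" where "N x = sqrt (Q x + \<eta> * (norm x)\<^sup>2)"
definition T :: "(real,'n) vec \<Rightarrow> (real,'n) vec" where "T x = T0 x + \<eta> *\<^sub>R x"
text \<open>The Hessian enters through its existence, so it is left as an abstract
  derivative.\<close>

definition A :: "(real,'n) vec \<Rightarrow> (real,'n) vec \<Rightarrow> (real,'n) vec" where
  "A x = (if x = 0 then (\<lambda>h. 0) else frechet_derivative T (at x))"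

lemma P_nonneg: "P x \<ge> 0"
  unfolding P_def by (intro sum_nonneg) simp

lemma P_pos: assumes "x \<noteq> 0" shows "P x > 0"
proof -
  obtain a where "a \<in> F" "a \<bullet> x \<noteq> 0" using sep[OF assms] by blast
  then show ?thesis unfolding P_def using finF m
    by (intro sum_pos2[of F a]) (auto simp: zero_less_power_eq)
qed

lemma P_scale: "P (r *\<^sub>R x) = r ^ (2 * m) * P x"
  by (simp add: P_def power_mult_distrib sum_distrib_left)

lemma P_zero [simp]: "P 0 = 0"
  using m by (simp add: P_def)

lemma Q_nonneg: "Q x \<ge> 0" by (simp add: Q_def)

lemma Q_scale: "Q (r *\<^sub>R x) = r\<^sup>2 * Q x"
proof -
  have "(r ^ (2 * m)) powr (1 / real m) = r\<^sup>2"
  proof (cases "r = 0")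
    case False
    then have "r\<^sup>2 > 0" by simp
    have "r ^ (2 * m) = (r\<^sup>2) powr real m" using \<open>r\<^sup>2 > 0\<close> by (simp add: powr_realpow power_mult)
    then show ?thesis using m \<open>r\<^sup>2 > 0\<close> by (simp add: powr_powr)
  qed (use m in simp)
  then show ?thesis unfolding Q_def P_scale using P_nonneg[of x]
    by (subst powr_mult) auto
qed

lemma T0_scale: "T0 (r *\<^sub>R x) = r *\<^sub>R T0 x"
proof (cases "r = 0")
  case True
  then show ?thesis using m by (simp add: T0_def)
next
  case False
  then have r2: "r\<^sup>2 > 0" by simp
  have "(r ^ (2 * m)) powr (1 / real m - 1) * r ^ (2 * m - 1) = r"
  proof -
    have "r ^ (2 * m) = (r\<^sup>2) powr real m" using r2 by (simp add: powr_realpow power_mult)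
    then have "(r ^ (2 * m)) powr (1 / real m - 1) = (r\<^sup>2) powr (1 - real m)"
      using m by (simp add: powr_powr right_diff_distrib)
    moreover have "r ^ (2 * m - 1) = r * (r\<^sup>2) powr (real m - 1)"
    proof -
      have "2 * m - 1 = Suc (2 * (m - 1))" using m by simp
      then show ?thesis using m r2 by (simp add: powr_realpow[symmetric] power_mult of_nat_diff)
    qed
    ultimately show ?thesis using r2 False by (simp add: powr_add[symmetric])
  qed
  then have c: "(r ^ (2 * m) * P x) powr (1 / real m - 1) * r ^ (2 * m - 1) = r * P x powr (1 / real m - 1)"
    using P_nonneg[of x] by (subst powr_mult) (auto simp: mult_ac)
  have "(\<Sum>a\<in>F. (a \<bullet> (r *\<^sub>R x)) ^ (2 * m - 1) *\<^sub>R a) = r ^ (2 * m - 1) *\<^sub>R (\<Sum>a\<in>F. (a \<bullet> x) ^ (2 * m - 1) *\<^sub>R a)"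
    by (simp add: scaleR_sum_right power_mult_distrib)
  then show ?thesis unfolding T0_def P_scale scaleR_scaleR by (simp only: scaleR_scaleR c)
qed

lemma inner_T0: "x \<bullet> T0 x = Q x"
proof -
  have "(a \<bullet> x) ^ (2 * m - 1) * (a \<bullet> x) = (a \<bullet> x) ^ (2 * m)" for a
    using m power_minus_mult[of "2 * m" "a \<bullet> x"] by simp
  then have "x \<bullet> (\<Sum>a\<in>F. (a \<bullet> x) ^ (2 * m - 1) *\<^sub>R a) = P x"
    by (simp add: P_def inner_sum_right inner_commute[of x])
  then have "x \<bullet> T0 x = P x powr (1 / real m - 1) * P x" by (simp add: T0_def)
  also have "\<dots> = Q x"
    using P_nonneg[of x] by (cases "P x = 0") (auto simp: Q_def powr_diff)
  finally show ?thesis .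
qed

lemma P_eq: "P x = sqrt (Q x) ^ (2 * m)"
proof -
  have "sqrt (Q x) ^ (2 * m) = Q x ^ m" using Q_nonneg by (simp add: power_mult)
  also have "\<dots> = P x"
    using m P_nonneg[of x] by (cases "P x = 0") (auto simp: Q_def powr_powr powr_realpow[symmetric])
  finally show ?thesis ..
qed

text \<open>Hoelder's inequality for the exponents 2m and 2m / (2m - 1): both vectors are normalised
  to Q = 1 and Young's inequality is summed over \<open>F\<close>.\<close>

lemma T0_le: "x \<bullet> T0 u \<le> sqrt (Q x) * sqrt (Q u)"
proof (cases "x = 0 \<or> u = 0")
  case True
  have "T0 0 = 0" using T0_scale[of 0 0] by simp
  with True show ?thesis by (auto intro!: mult_nonneg_nonneg Q_nonneg)
next
  case False
  define s t where "s = sqrt (Q u)" and "t = sqrt (Q x)"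
  have st: "s > 0" "t > 0" using P_pos False by (auto simp: s_def t_def Q_def less_imp_neq[symmetric])
  have Ps: "P u = s ^ (2 * m)" "P x = t ^ (2 * m)" by (simp_all add: s_def t_def P_eq)
  let ?d = "2 * m"
  have "(\<Sum>a\<in>F. real ?d * ((a \<bullet> u / s) ^ (?d - 1) * (a \<bullet> x / t))) \<le> (\<Sum>a\<in>F. (real ?d - 1) * (a \<bullet> u / s) ^ ?d + (a \<bullet> x / t) ^ ?d)"
    using m by (intro sum_mono young_even_power) auto
  also have "\<dots> = (real ?d - 1) * (P u / s ^ ?d) + P x / t ^ ?d"
    by (simp add: P_def sum.distrib sum_distrib_left sum_divide_distrib power_divide)
  also have "\<dots> = real ?d" using st unfolding Ps by simp
  finally have "real ?d * (\<Sum>a\<in>F. (a \<bullet> u / s) ^ (?d - 1) * (a \<bullet> x / t)) \<le> real ?d * 1"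
    by (simp add: sum_distrib_left)
  then have "(\<Sum>a\<in>F. (a \<bullet> u / s) ^ (?d - 1) * (a \<bullet> x / t)) \<le> 1"
    using m by (subst (asm) mult_le_cancel_left_pos) auto
  moreover have "(\<Sum>a\<in>F. (a \<bullet> u / s) ^ (?d - 1) * (a \<bullet> x / t)) = (\<Sum>a\<in>F. (a \<bullet> u) ^ (?d - 1) * (a \<bullet> x)) / (s ^ (?d - 1) * t)"
    by (simp add: sum_divide_distrib power_divide)
  ultimately have 1: "(\<Sum>a\<in>F. (a \<bullet> u) ^ (?d - 1) * (a \<bullet> x)) \<le> s ^ (?d - 1) * t"
    using st by (simp add: divide_le_eq)
  have "x \<bullet> T0 u = P u powr (1 / real m - 1) * (\<Sum>a\<in>F. (a \<bullet> u) ^ (?d - 1) * (a \<bullet> x))"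
    by (simp add: T0_def inner_sum_right inner_commute[of x])
  also have "\<dots> \<le> P u powr (1 / real m - 1) * (s ^ (?d - 1) * t)"
    by (intro mult_left_mono 1) simp
  also have "P u powr (1 / real m - 1) * (s ^ (?d - 1) * t) = t * s"
  proof -
    have "P u = s powr real ?d" using st Ps powr_realpow[of s ?d] by simp
    then have "P u powr (1 / real m - 1) = s powr (2 - real ?d)" using m by (simp add: powr_powr right_diff_distrib)
    moreover have "s ^ (?d - 1) = s powr (real ?d - 1)" using st m powr_realpow[of s "?d - 1"] by (simp add: of_nat_diff)
    moreover have "s powr (2 - real ?d) * s powr (real ?d - 1) = s" using st by (simp add: powr_add[symmetric])
    ultimately show ?thesis by (simp add: mult.assoc[symmetric]) 
  qed
  finally show ?thesis by (simp add: s_def t_def)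
qed

lemma N_sq: "(N x)\<^sup>2 = Q x + \<eta> * (norm x)\<^sup>2"
  using Q_nonneg[of x] \<eta> by (simp add: N_def)

lemma P_deriv: "(P has_derivative (\<lambda>h. \<Sum>a\<in>F. real (2 * m) * (a \<bullet> u) ^ (2 * m - 1) * (a \<bullet> h))) (at u)"
  unfolding P_def by (auto intro!: derivative_eq_intros sum.cong simp: fun_eq_iff mult_ac)

lemma Q_deriv:
  assumes "u \<noteq> 0" shows "(Q has_derivative (\<lambda>h. 2 * (T0 u \<bullet> h))) (at u)"
proof -
  have "((\<lambda>x. P x powr (1 / real m)) has_derivative
     (\<lambda>h. P u powr (1 / real m) * (0 * ln (P u) + (\<Sum>a\<in>F. real (2 * m) * (a \<bullet> u) ^ (2 * m - 1) * (a \<bullet> h)) * (1 / real m) / P u))) (at u)"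
    by (rule has_derivative_powr[OF P_deriv has_derivative_const P_pos[OF assms]]) simp
  moreover have "P u powr (1 / real m) * (0 * ln (P u) + (\<Sum>a\<in>F. real (2 * m) * (a \<bullet> u) ^ (2 * m - 1) * (a \<bullet> h)) * (1 / real m) / P u) = 2 * (T0 u \<bullet> h)" for h
  proof -
    have "(\<Sum>a\<in>F. real (2 * m) * (a \<bullet> u) ^ (2 * m - 1) * (a \<bullet> h)) = real (2 * m) * (\<Sum>a\<in>F. (a \<bullet> u) ^ (2 * m - 1) * (a \<bullet> h))"
      by (simp add: sum_distrib_left mult_ac)
    moreover have "T0 u \<bullet> h = P u powr (1 / real m - 1) * (\<Sum>a\<in>F. (a \<bullet> u) ^ (2 * m - 1) * (a \<bullet> h))"
      by (simp add: T0_def inner_sum_left)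
    ultimately show ?thesis using m P_pos[OF assms] by (simp add: powr_diff)
  qed
  ultimately show ?thesis unfolding Q_def[abs_def] by simp
qed

text \<open>Quadratic growth yields the derivative of N^2 at the origin, where
  \<open>Q_deriv\<close> does not apply.\<close>

lemma Q_le: obtains C where "C \<ge> 0" "\<And>x. Q x \<le> C * (norm x)\<^sup>2"
proof -
  define B where "B = (\<Sum>a\<in>F. norm a ^ (2 * m))"
  have B: "B \<ge> 0" unfolding B_def by (intro sum_nonneg) simp
  have "Q x \<le> B powr (1 / real m) * (norm x)\<^sup>2" for x
  proof (cases "x = 0")
    case False
    have "P x \<le> (\<Sum>a\<in>F. (norm a * norm x) ^ (2 * m))"
      unfolding P_def
    proof (rule sum_mono)
      fix a
      have "(a \<bullet> x) ^ (2 * m) = \<bar>a \<bullet> x\<bar> ^ (2 * m)" by (simp add: power_even_abs)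
      also have "\<dots> \<le> (norm a * norm x) ^ (2 * m)" by (intro power_mono Cauchy_Schwarz_ineq2) simp
      finally show "(a \<bullet> x) ^ (2 * m) \<le> (norm a * norm x) ^ (2 * m)" .
    qed
    also have "\<dots> = B * norm x ^ (2 * m)" by (simp add: B_def power_mult_distrib sum_distrib_right)
    finally have "Q x \<le> (B * norm x ^ (2 * m)) powr (1 / real m)"
      unfolding Q_def using P_nonneg by (intro powr_mono2) auto
    also have "\<dots> = B powr (1 / real m) * (norm x ^ (2 * m)) powr (1 / real m)"
      using B by (intro powr_mult)
    also have "(norm x ^ (2 * m)) powr (1 / real m) = (norm x)\<^sup>2"
    proof -
      have "norm x ^ (2 * m) = ((norm x)\<^sup>2) powr real m" using False by (simp add: powr_realpow power_mult)
      then show ?thesis using m by (simp add: powr_powr)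
    qed
    finally show ?thesis .
  qed (simp add: Q_def)
  then show ?thesis by (intro that[of "B powr (1 / real m)"]) auto
qed

text \<open>For strong monotonicity, the Euclidean part contributes exactly \<eta> |u - w|^2 and the
  rest is nonnegative by \<open>T0_le\<close> and the arithmetic-geometric mean inequality. Second
  derivatives exist off the origin because \<open>P\<close> is positive there.\<close>

lemma smooth_norm: "smooth_norm N T A \<eta>"
proof
  show "\<eta> > 0" by (rule \<eta>)
  show "0 \<le> N u" for u by (simp add: N_def Q_nonneg \<eta> less_imp_le)
  show "N (r *\<^sub>R u) = \<bar>r\<bar> * N u" for r u
  proof -
    have "Q (r *\<^sub>R u) + \<eta> * (norm (r *\<^sub>R u))\<^sup>2 = r\<^sup>2 * (Q u + \<eta> * (norm u)\<^sup>2)"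
      by (simp add: Q_scale power_mult_distrib algebra_simps)
    then show ?thesis by (simp add: N_def real_sqrt_mult)
  qed
  show "T (r *\<^sub>R u) = r *\<^sub>R T u" for r u by (simp add: T_def T0_scale scaleR_add_right mult.commute)
  show "u \<bullet> T u = (N u)\<^sup>2" for u
    by (simp add: N_sq T_def inner_add_right inner_T0 power2_norm_eq_inner)
  \<comment> \<open>Cauchy-Schwarz in the plane combines the l^(2m) part with the Euclidean
    part.\<close>
  have Tle: "x \<bullet> T0 u + \<eta> * (norm x * norm u) \<le> N x * N u" for x u
  proof -
    have "x \<bullet> T0 u + \<eta> * (norm x * norm u) \<le> sqrt (Q x) * sqrt (Q u) + (sqrt \<eta> * norm x) * (sqrt \<eta> * norm u)"
    proof -
      have "(sqrt \<eta> * norm x) * (sqrt \<eta> * norm u) = (sqrt \<eta> * sqrt \<eta>) * (norm x * norm u)" by (simp only: mult_ac)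
      also have "sqrt \<eta> * sqrt \<eta> = \<eta>" using \<eta> by simp
      finally show ?thesis using T0_le[of x u] by linarith
    qed
    also have "\<dots> \<le> sqrt ((sqrt (Q x))\<^sup>2 + (sqrt \<eta> * norm x)\<^sup>2) * sqrt ((sqrt (Q u))\<^sup>2 + (sqrt \<eta> * norm u)\<^sup>2)"
      by (intro cauchy_schwarz_two_terms) (use \<eta> Q_nonneg in auto)
    also have "\<dots> = N x * N u" using \<eta> Q_nonneg by (simp add: N_def power_mult_distrib)
    finally show ?thesis .
  qed
  show "x \<bullet> T u \<le> N x * N u" for x u
  proof -
    have "x \<bullet> T u = x \<bullet> T0 u + \<eta> * (x \<bullet> u)" by (simp add: T_def inner_add_right)
    also have "\<dots> \<le> x \<bullet> T0 u + \<eta> * (norm x * norm u)"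
      using \<eta> norm_cauchy_schwarz[of x u] by (intro add_left_mono mult_left_mono) auto
    finally show ?thesis using Tle[of x u] by linarith
  qed
  show "((\<lambda>x. (N x)\<^sup>2 / 2) has_derivative (\<lambda>h. T u \<bullet> h)) (at u)" for u
  proof (cases "u = 0")
    case False
    have "((\<lambda>x. (Q x + \<eta> * (x \<bullet> x)) / 2) has_derivative (\<lambda>h. T u \<bullet> h)) (at u)"
      by (rule derivative_eq_intros Q_deriv[OF False] refl | simp)+
         (simp add: fun_eq_iff T_def inner_add_left inner_add_right inner_commute)
    then show ?thesis unfolding N_sq power2_norm_eq_inner .
  next
    case True
    obtain C where C: "C \<ge> 0" "\<And>x. Q x \<le> C * (norm x)\<^sup>2" using Q_le by blast
    have T0: "T 0 = 0" using T0_scale[of 0 0] by (simp add: T_def)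
    have N0: "N 0 = 0" by (simp add: N_def Q_def)
    have "((\<lambda>h. norm ((N (0 + h))\<^sup>2 / 2 - (N 0)\<^sup>2 / 2 - T 0 \<bullet> h) / norm h) \<longlongrightarrow> 0) (at 0)"
    proof (rule tendsto_0_le[where f="\<lambda>h. norm h" and K="(C + \<eta>) / 2"])
      show "((\<lambda>h::(real,'n) vec. norm h) \<longlongrightarrow> 0) (at 0)" by (intro tendsto_norm_zero tendsto_ident_at)
      show "\<forall>\<^sub>F h in at 0. norm (norm ((N (0 + h))\<^sup>2 / 2 - (N 0)\<^sup>2 / 2 - T 0 \<bullet> h) / norm h) \<le> norm (norm h) * ((C + \<eta>) / 2)"
      proof (rule always_eventually, rule allI)
        fix h :: "(real,'n) vec"
        have "(N h)\<^sup>2 \<le> (C + \<eta>) * (norm h)\<^sup>2" using C(2)[of h] by (simp add: N_sq algebra_simps)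
        then show "norm (norm ((N (0 + h))\<^sup>2 / 2 - (N 0)\<^sup>2 / 2 - T 0 \<bullet> h) / norm h) \<le> norm (norm h) * ((C + \<eta>) / 2)"
          by (cases "h = 0") (simp_all add: T0 N0 divide_le_eq power2_eq_square mult_ac)
      qed
    qed
    moreover have "bounded_linear (\<lambda>h. T 0 \<bullet> h)" by (rule bounded_linear_inner_right)
    ultimately show ?thesis unfolding True has_derivative_at by simp
  qed
  show "(T has_derivative A u) (at u)" if u: "u \<noteq> 0" for u
  proof -
    have "\<exists>D. ((\<lambda>x. P x powr (1 / real m - 1)) has_derivative D) (at u)"
      by (rule exI, rule has_derivative_powr[OF P_deriv has_derivative_const P_pos[OF u]]) simp
    then obtain D where D: "((\<lambda>x. P x powr (1 / real m - 1)) has_derivative D) (at u)" by blast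
    have "\<exists>E. ((\<lambda>x. (a \<bullet> x) ^ (2 * m - 1) *\<^sub>R a) has_derivative E) (at u)" for a
      by (rule exI) (rule has_derivative_scaleR_left[OF has_derivative_power[OF has_derivative_inner_right[OF has_derivative_ident]]])
    then obtain E where E: "\<And>a. ((\<lambda>x. (a \<bullet> x) ^ (2 * m - 1) *\<^sub>R a) has_derivative E a) (at u)" by metis
    have "\<exists>D. (T has_derivative D) (at u)"
      unfolding T_def[abs_def] T0_def
      by (rule exI, rule has_derivative_add[OF has_derivative_scaleR[OF D has_derivative_sum[OF E]]
            has_derivative_scaleR_right[OF has_derivative_ident]])
    then have "T differentiable (at u)" unfolding differentiable_def .
    then show ?thesis using u frechet_derivative_works[of T "at u"] by (simp add: A_def)
  qed
  show "\<eta> * (norm (u - w))\<^sup>2 \<le> (T u - T w) \<bullet> (u - w)" for u w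
  proof -
    have "(T u - T w) \<bullet> (u - w) = Q u + Q w - (w \<bullet> T0 u) - (u \<bullet> T0 w) + \<eta> * (norm (u - w))\<^sup>2"
      by (simp add: T_def inner_T0[symmetric] power2_norm_eq_inner algebra_simps inner_commute)
    moreover have "w \<bullet> T0 u + u \<bullet> T0 w \<le> 2 * (sqrt (Q u) * sqrt (Q w))"
      using T0_le[of w u] T0_le[of u w] by (simp add: mult_ac)
    moreover have "2 * (sqrt (Q u) * sqrt (Q w)) \<le> Q u + Q w"
      using sum_squares_bound[of "sqrt (Q u)" "sqrt (Q w)"] Q_nonneg by (simp add: mult.assoc)
    ultimately show ?thesis by linarith
  qed
  show "A 0 = (\<lambda>h. 0)" by (simp add: A_def)
qed

end

section \<open>Symmetric bodies\<close>

lemma polar_body_scale: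
  assumes "r > 0" "K \<subseteq> (\<lambda>x. r *\<^sub>R x) ` L"
  shows "polar_body L \<subseteq> (\<lambda>x. r *\<^sub>R x) ` polar_body K"
proof
  fix y assume y: "y \<in> polar_body L"
  have "(1 / r) *\<^sub>R y \<in> polar_body K"
    unfolding polar_body_def
  proof (intro CollectI ballI)
    fix x assume "x \<in> K"
    then obtain l where l: "l \<in> L" "x = r *\<^sub>R l" using assms(2) by blast
    then show "x \<bullet> ((1 / r) *\<^sub>R y) \<le> 1" using y assms(1) by (auto simp: polar_body_def)
  qed
  then show "y \<in> (\<lambda>x. r *\<^sub>R x) ` polar_body K" using assms(1) by (intro image_eqI[of _ _ "(1 / r) *\<^sub>R y"]) auto
qed

lemma measure_scaleR: "measure lebesgue ((\<lambda>x::'a::euclidean_space. r *\<^sub>R x) ` S) = \<bar>r\<bar> ^ DIM('a) * measure lebesgue S"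
  using measure_lebesgue_affine[of r "0::'a" S] by simp

text \<open>Inclusions up to the factor r pass to the polar bodies with the same factor, so volume
  and polar volume lose r^n each.\<close>

lemma mahler_volume_perturb:
  fixes K L :: "'a::euclidean_space set"
  assumes r: "r > 0" and cK: "compact K" "compact (polar_body K)" "compact L" "compact (polar_body L)"
    and KL: "K \<subseteq> (\<lambda>x. r *\<^sub>R x) ` L" "L \<subseteq> (\<lambda>x. r *\<^sub>R x) ` K"
  shows "mahler_volume L \<le> r ^ (2 * DIM('a)) * mahler_volume K"
proof -
  have sc: "(\<lambda>x. r *\<^sub>R x) ` S \<in> lmeasurable" if "compact S" for S :: "'a set"
    using that by (intro lmeasurable_compact compact_scaling)
  have "measure lebesgue L \<le> measure lebesgue ((\<lambda>x. r *\<^sub>R x) ` K)"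
    using KL(2) by (intro measure_mono_fmeasurable sc cK) (use cK in \<open>auto intro: lmeasurable_compact fmeasurableD\<close>)
  then have 1: "measure lebesgue L \<le> r ^ DIM('a) * measure lebesgue K" using r by (simp add: measure_scaleR)
  have "measure lebesgue (polar_body L) \<le> measure lebesgue ((\<lambda>x. r *\<^sub>R x) ` polar_body K)"
    by (intro measure_mono_fmeasurable sc cK polar_body_scale[OF r KL(1)])
       (use cK in \<open>auto intro: lmeasurable_compact fmeasurableD\<close>)
  then have 2: "measure lebesgue (polar_body L) \<le> r ^ DIM('a) * measure lebesgue (polar_body K)" using r by (simp add: measure_scaleR)
  have "mahler_volume L \<le> (r ^ DIM('a) * measure lebesgue K) * (r ^ DIM('a) * measure lebesgue (polar_body K))"
    unfolding mahler_volume_def using 1 2 r by (intro mult_mono) auto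
  also have "\<dots> = r ^ (2 * DIM('a)) * mahler_volume K"
    unfolding mahler_volume_def mult_2 power_add by (simp only: mult_ac)
  finally show ?thesis .
qed

text \<open>The frontier of \<open>(1 + d) K\<close> is compact and covered by the open half-spaces \<open>{x. 1 < y \<bullet> x}\<close> with \<open>y\<close> in the polar body.\<close>
lemma finite_slab_approximation:
  fixes K :: "'a::euclidean_space set"
  assumes K: "compact K" "convex K" and r: "r > 0" "cball 0 r \<subseteq> K" and d: "d > 0"
  obtains F where "finite F" "F \<subseteq> polar_body K" "\<And>x. (\<And>a. a \<in> F \<Longrightarrow> a \<bullet> x \<le> 1) \<Longrightarrow> x \<in> (\<lambda>x. (1 + d) *\<^sub>R x) ` K"
proof -
  let ?D = "(\<lambda>x. (1 + d) *\<^sub>R x) ` K"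
  have cD: "compact ?D" using K by (intro compact_scaling)
  have K0: "0 \<in> K" using r by auto
  \<comment> \<open>Weights 1/(1 + d) at x and d/(1 + d) at a point of the inner ball show that (1 +
    d) K contains the d r neighbourhood of \<open>K\<close>; so its frontier misses
    \<open>K\<close>.\<close>
  have int: "ball x (d * r) \<subseteq> ?D" if x: "x \<in> K" for x
  proof
    fix z assume "z \<in> ball x (d * r)"
    then have "norm (z - x) < d * r" by (simp add: dist_norm norm_minus_commute)
    then have "norm (z - x) / d \<le> r" using d by (simp add: pos_divide_le_eq mult.commute)
    then have "norm ((1 / d) *\<^sub>R (z - x)) \<le> r" using d by (simp only: norm_scaleR) simp
    then have "(1 / d) *\<^sub>R (z - x) \<in> K" using r by auto
    then have "(1 / (1 + d)) *\<^sub>R x + (d / (1 + d)) *\<^sub>R ((1 / d) *\<^sub>R (z - x)) \<in> K"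
      using d x by (intro convexD[OF K(2)]) (auto simp: field_simps)
    then have k: "(1 / (1 + d)) *\<^sub>R z \<in> K" using d by (simp add: algebra_simps)
    have "z = (1 + d) *\<^sub>R ((1 / (1 + d)) *\<^sub>R z)" using d by simp
    then show "z \<in> ?D" using k by (rule image_eqI)
  qed
  have KintD: "K \<subseteq> interior ?D"
  proof
    fix x assume "x \<in> K"
    then show "x \<in> interior ?D" using int[of x] d r(1) by (intro interiorI[of "ball x (d * r)"]) auto
  qed
  have "\<exists>y\<in>polar_body K. 1 < y \<bullet> x" if x: "x \<notin> K" for x
  proof -
    obtain a b where ab: "a \<bullet> x < b" "\<forall>k\<in>K. b < a \<bullet> k"
      using separating_hyperplane_closed_point[OF K(2) compact_imp_closed[OF K(1)] x] by blast
    have b: "b < 0" using ab(2) K0 by force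
    have "(1 / b) *\<^sub>R a \<in> polar_body K"
      unfolding polar_body_def
    proof (intro CollectI ballI)
      fix k assume "k \<in> K"
      then have "b < a \<bullet> k" using ab by blast
      then show "k \<bullet> ((1 / b) *\<^sub>R a) \<le> 1" using b by (simp add: divide_le_eq inner_commute)
    qed
    moreover have "1 < ((1 / b) *\<^sub>R a) \<bullet> x" using b ab(1) by (simp add: less_divide_eq)
    ultimately show ?thesis by blast
  qed
  then have cover: "frontier ?D \<subseteq> (\<Union>y\<in>polar_body K. {x. 1 < y \<bullet> x})"
    using KintD by (force simp: frontier_def)
  have "compact (frontier ?D)" using cD by (rule compact_frontier)
  then obtain F where F: "F \<subseteq> polar_body K" "finite F" "frontier ?D \<subseteq> (\<Union>y\<in>F. {x. 1 < y \<bullet> x})"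
    by (rule compactE_image[OF _ _ cover]) (auto intro: open_halfspace_gt)
  have "x \<in> ?D" if x: "\<And>a. a \<in> F \<Longrightarrow> a \<bullet> x \<le> 1" for x
  proof (rule ccontr)
    assume "x \<notin> ?D"
    moreover have "0 \<in> ?D" using KintD K0 interior_subset by blast
    \<comment> \<open>The segment leaves (1 + d) K at some t x with t \<le> 1, where a member of
      \<open>F\<close> exceeds 1; it then exceeds 1 at x too.\<close>
    ultimately have "closed_segment 0 x \<inter> frontier ?D \<noteq> {}"
      by (intro connected_Int_frontier) auto
    then obtain t where t: "0 \<le> t" "t \<le> 1" "t *\<^sub>R x \<in> frontier ?D" by (auto simp: in_segment)
    then obtain y where y: "y \<in> F" "1 < y \<bullet> (t *\<^sub>R x)" using F(3) by blast
    have "t * (y \<bullet> x) \<le> t * 1" using x[OF y(1)] t by (intro mult_left_mono) auto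
    then show False using y(2) t by simp
  qed
  with F show ?thesis by (intro that[of F]) auto
qed

definition symmetric_bound :: "nat \<Rightarrow> real" where
  "symmetric_bound n = (2 * pi) ^ n * (fact n)\<^sup>2 / (fact (2 * n) * (Gamma (real n / 2 + 1))\<^sup>2)"

text \<open>Symmetry turns the half-spaces of \<open>finite_slab_approximation\<close> into slabs |a
  \<bullet> x| \<le> 1. The unit ball of the associated power norm is within the factor 1 + d of
  \<open>K\<close> in both directions, and the resulting factor (1 + d)^(2n) disappears as d tends
  to 0.\<close>

theorem mahler_volume_symmetric:
  fixes K :: "(real^'n::{finite,wellorder}) set"
  assumes K: "compact K" "convex K" and r: "r > 0" "cball 0 r \<subseteq> K"
    and sym: "\<And>x. x \<in> K \<Longrightarrow> - x \<in> K"
  shows "symmetric_bound CARD('n) \<le> mahler_volume K"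
proof -
  have cP: "compact (polar_body K)" by (rule compact_polar_body[OF r])
  obtain R where R: "R > 0" "\<And>x. x \<in> K \<Longrightarrow> norm x \<le> R"
    using compact_imp_bounded[OF K(1)] unfolding bounded_pos by blast
  have step: "symmetric_bound CARD('n) \<le> (1 + d) ^ (2 * CARD('n)) * mahler_volume K" if d: "d > 0" for d :: real
  proof -
    obtain F where F: "finite F" "F \<subseteq> polar_body K"
      "\<And>x. (\<And>a. a \<in> F \<Longrightarrow> a \<bullet> x \<le> 1) \<Longrightarrow> x \<in> (\<lambda>x. (1 + d) *\<^sub>R x) ` K"
      using finite_slab_approximation[OF K r d] by blast
    \<comment> \<open>A nonzero vector annihilated by \<open>F\<close> would place a multiple of
      excessive length in (1 + d) K.\<close>
    have Fsep: "\<exists>a\<in>F. a \<bullet> x \<noteq> 0" if x: "x \<noteq> 0" for x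
    proof (rule ccontr)
      assume "\<not> (\<exists>a\<in>F. a \<bullet> x \<noteq> 0)"
      then have "((1 + d) * (R + 1) / norm x) *\<^sub>R x \<in> (\<lambda>x. (1 + d) *\<^sub>R x) ` K" by (intro F(3)) simp
      then obtain k where k: "k \<in> K" "((1 + d) * (R + 1) / norm x) *\<^sub>R x = (1 + d) *\<^sub>R k" by blast
      have "norm (((1 + d) * (R + 1) / norm x) *\<^sub>R x) = (1 + d) * (R + 1)" using x d R by simp
      then have "norm k = R + 1" using d unfolding k(2) by simp
      then show False using R(2)[OF k(1)] by simp
    qed
    \<comment> \<open>Bounds \<open>P\<close> on \<open>K\<close>. Its m-th root tends to 1; the
      added 1 makes the base visibly positive.\<close>
    define c where "c = real (card F) + 1"
    have "(\<lambda>m. c powr (1 / real (Suc m))) \<longlonglongrightarrow> c powr 0"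
      by (intro tendsto_powr tendsto_const LIMSEQ_Suc[OF lim_1_over_n]) (simp_all add: c_def)
    then have "\<forall>\<^sub>F m in sequentially. c powr (1 / real (Suc m)) < 1 + d"
      using d by (intro order_tendstoD) (auto simp: c_def)
    then obtain m0 where m0: "c powr (1 / real (Suc m0)) < 1 + d"
      by (auto simp: eventually_sequentially)
    define m where "m = Suc m0"
    \<comment> \<open>Keeps the Euclidean term below d on \<open>K\<close>; with Q \<le> 1 + d this
      gives N^2 \<le> 1 + 2d \<le> (1 + d)^2.\<close>
    define e where "e = d / R\<^sup>2"
    have e: "e > 0" using d R by (simp add: e_def)
    interpret pn: power_norm F m e
      by unfold_locales (use F e Fsep in \<open>auto simp: m_def\<close>)
    interpret sn: smooth_norm pn.N pn.T pn.A e by (rule pn.smooth_norm)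
    let ?L = "{x. pn.N x \<le> 1}"
    have abs: "\<bar>a \<bullet> x\<bar> \<le> 1" if "a \<in> F" "x \<in> K" for a x
    proof -
      have "a \<in> polar_body K" using that F by auto
      then have pa: "y \<bullet> a \<le> 1" if "y \<in> K" for y using that by (simp add: polar_body_def)
      show ?thesis using pa[OF that(2)] pa[OF sym[OF that(2)]]
        unfolding inner_commute[of a x] inner_minus_left by linarith
    qed
    have KL: "K \<subseteq> (\<lambda>x. (1 + d) *\<^sub>R x) ` ?L"
    proof
      fix x assume x: "x \<in> K"
      have "pn.P x \<le> (\<Sum>a\<in>F. 1)" unfolding pn.P_def
      proof (rule sum_mono)
        fix a assume "a \<in> F"
        then have "\<bar>a \<bullet> x\<bar> ^ (2 * m) \<le> 1" by (intro power_le_one abs x) auto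
        then show "(a \<bullet> x) ^ (2 * m) \<le> 1" by (simp add: power_even_abs)
      qed
      then have "pn.P x \<le> c" by (simp add: c_def)
      then have "pn.Q x \<le> c powr (1 / real m)"
        unfolding pn.Q_def using pn.P_nonneg by (intro powr_mono2) auto
      then have 1: "pn.Q x \<le> 1 + d" using m0 by (simp add: m_def)
      have "e * (norm x)\<^sup>2 \<le> e * R\<^sup>2" using e R(2)[OF x] by (intro mult_left_mono power_mono) auto
      also have "\<dots> = d" using R by (simp add: e_def)
      finally have "(pn.N x)\<^sup>2 \<le> (1 + d)\<^sup>2"
        using 1 zero_le_power2[of d] unfolding pn.N_sq power2_sum power_one by linarith
      then have N: "pn.N x \<le> 1 + d" by (rule power2_le_imp_le) (use d in simp)
      have "pn.N ((1 / (1 + d)) *\<^sub>R x) \<le> 1" using N d by (simp add: sn.N_scale)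
      moreover have "x = (1 + d) *\<^sub>R ((1 / (1 + d)) *\<^sub>R x)" using d by simp
      ultimately show "x \<in> (\<lambda>x. (1 + d) *\<^sub>R x) ` ?L" by blast
    qed
    have LK: "?L \<subseteq> (\<lambda>x. (1 + d) *\<^sub>R x) ` K"
    proof
      fix x assume "x \<in> ?L"
      then have "(pn.N x)\<^sup>2 \<le> 1" using sn.N_nonneg by (auto intro: power_le_one)
      moreover have "e * (norm x)\<^sup>2 \<ge> 0" using e by simp
      ultimately have "pn.Q x \<le> 1" by (simp add: pn.N_sq)
      then have "sqrt (pn.Q x) ^ (2 * m) \<le> 1" by (intro power_le_one) (auto simp: pn.Q_nonneg)
      then have P: "pn.P x \<le> 1" using pn.P_eq by simp
      show "x \<in> (\<lambda>x. (1 + d) *\<^sub>R x) ` K"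
      proof (rule F(3))
        fix a assume a: "a \<in> F"
        have "(a \<bullet> x) ^ (2 * m) \<le> pn.P x" unfolding pn.P_def
          using F(1) a by (intro member_le_sum) auto
        then have "\<bar>a \<bullet> x\<bar> ^ (2 * m) \<le> 1" using P by (simp add: power_even_abs)
        then have "\<bar>a \<bullet> x\<bar> \<le> 1" 
          by (metis power_mono_iff abs_ge_zero zero_le_one power_one m_def zero_less_Suc mult_pos_pos zero_less_numeral)
        then show "a \<bullet> x \<le> 1" by linarith
      qed
    qed
    obtain \<rho> where \<rho>: "\<rho> > 0" "cball 0 \<rho> \<subseteq> ?L" using sn.unit_ball_cball by blast
    have "symmetric_bound CARD('n) \<le> mahler_volume ?L"
      unfolding symmetric_bound_def by (rule sn.mahler_volume_unit_ball)
    also have "\<dots> \<le> (1 + d) ^ (2 * DIM((real,'n) vec)) * mahler_volume K"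
      by (rule mahler_volume_perturb) (use d K cP sn.compact_unit_ball compact_polar_body[OF \<rho>] KL LK in auto)
    finally show ?thesis by simp
  qed
  have "((\<lambda>d. (1 + d) ^ (2 * CARD('n)) * mahler_volume K) \<longlongrightarrow> (1 + 0) ^ (2 * CARD('n)) * mahler_volume K) (at_right 0)"
    by (intro tendsto_intros)
  then have "symmetric_bound CARD('n) \<le> (1 + 0) ^ (2 * CARD('n)) * mahler_volume K"
    by (rule tendsto_lowerbound) (auto simp: eventually_at_right_field intro!: exI[of _ 1] step)
  then show ?thesis by simp
qed

section \<open>Difference bodies\<close>

definition gauge :: "'a::euclidean_space set \<Rightarrow> 'a \<Rightarrow> real" where
  "gauge S x = Inf {t. 0 \<le> t \<and> x \<in> (\<lambda>y. t *\<^sub>R y) ` S}"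

text \<open>Gauges and support functions have dilates of a fixed body as level sets for t > 0; level
  0 is recovered as the intersection of the levels 1/(n + 1).\<close>

lemma borel_measurable_sublevelI:
  fixes f :: "'a::topological_space \<Rightarrow> real"
  assumes nonneg: "\<And>x. 0 \<le> f x" and lev: "\<And>t. t > 0 \<Longrightarrow> closed {x. f x \<le> t}"
  shows "f \<in> borel_measurable borel"
proof (rule borel_measurableI_le)
  fix t :: real
  consider "t < 0" | "t = 0" | "t > 0" by linarith
  then show "{x \<in> space borel. f x \<le> t} \<in> sets borel"
  proof cases
    case 1
    then have "{x \<in> space borel. f x \<le> t} = {}" using nonneg by (auto simp: not_le intro: order.strict_trans2)
    then show ?thesis by (simp only: sets.empty_sets)
  next
    case 2
    have "{x. f x \<le> 0} = (\<Inter>n::nat. {x. f x \<le> 1 / real (Suc n)})"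
    proof (intro set_eqI iffI; clarsimp)
      fix x assume *: "f x \<le> 0"
      show "f x \<le> 1 / (1 + real n)" for n using order_trans[OF *] by simp
    next
      fix x assume *: "\<forall>n. f x \<le> 1 / (1 + real n)"
      show "f x \<le> 0"
      proof (rule field_le_epsilon)
        fix e :: real assume "e > 0"
        then obtain n where "inverse (real (Suc n)) < e" using reals_Archimedean by blast
        then show "f x \<le> 0 + e" using spec[OF *, of n] by (simp add: inverse_eq_divide)
      qed
    qed
    also have "closed \<dots>" using lev by (intro closed_INT) simp
    finally show ?thesis using 2 by (simp add: borel_closed)
  next
    case 3
    then show ?thesis using lev by (simp add: borel_closed)
  qed
qed

context
  fixes S :: "'a::euclidean_space set" and \<rho> :: real
  assumes S: "compact S" "convex S" and \<rho>: "\<rho> > 0" "cball 0 \<rho> \<subseteq> S"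
begin

lemma gauge_set_nonempty: "{t. 0 \<le> t \<and> x \<in> (\<lambda>y. t *\<^sub>R y) ` S} \<noteq> {}"
proof (cases "x = 0")
  case True
  have "0 \<in> S" using \<rho> by auto
  then have "0 \<in> {t. 0 \<le> t \<and> x \<in> (\<lambda>y. t *\<^sub>R y) ` S}" using True by auto
  then show ?thesis by blast
next
  case False
  have "(\<rho> / norm x) *\<^sub>R x \<in> S" using \<rho> False by (intro subsetD[OF \<rho>(2)]) simp
  moreover have "x = (norm x / \<rho>) *\<^sub>R ((\<rho> / norm x) *\<^sub>R x)" using False \<rho> by simp
  ultimately have "norm x / \<rho> \<in> {t. 0 \<le> t \<and> x \<in> (\<lambda>y. t *\<^sub>R y) ` S}" using \<rho> by fastforce
  then show ?thesis by blast
qed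

lemma gauge_nonneg: "0 \<le> gauge S x"
  unfolding gauge_def using gauge_set_nonempty by (rule cInf_greatest) simp

text \<open>Every s > t is admissible, by convexity and 0 \<in> S, and closedness of
  \<open>S\<close> carries this to s = t.\<close>

lemma gauge_le_iff: assumes "t > 0" shows "gauge S x \<le> t \<longleftrightarrow> x \<in> (\<lambda>y. t *\<^sub>R y) ` S"
proof
  assume "x \<in> (\<lambda>y. t *\<^sub>R y) ` S"
  then show "gauge S x \<le> t" unfolding gauge_def
    using assms by (intro cInf_lower) (auto intro: bdd_belowI[of _ 0])
next
  assume le: "gauge S x \<le> t"
  have mem: "(1 / s) *\<^sub>R x \<in> S" if "s > t" for s
  proof -
    have "gauge S x < s" using le that by simp
    then obtain u where u: "0 \<le> u" "x \<in> (\<lambda>y. u *\<^sub>R y) ` S" "u < s"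
      unfolding gauge_def using cInf_lessD[OF gauge_set_nonempty] by blast
    then obtain y where y: "y \<in> S" "x = u *\<^sub>R y" by blast
    have "0 \<in> S" using \<rho> by auto
    then have "(u / s) *\<^sub>R y + (1 - u / s) *\<^sub>R 0 \<in> S"
      using u y that assms by (intro convexD[OF S(2)]) auto
    then show ?thesis by (simp add: y)
  qed
  have "((\<lambda>s. (1 / s) *\<^sub>R x) \<longlongrightarrow> (1 / t) *\<^sub>R x) (at_right t)"
    using assms by (intro tendsto_intros) simp
  then have "(1 / t) *\<^sub>R x \<in> S"
    by (rule Lim_in_closed_set[OF compact_imp_closed[OF S(1)], rotated 2])
       (auto simp: eventually_at_right_field mem intro!: exI[of _ "t + 1"])
  then show "x \<in> (\<lambda>y. t *\<^sub>R y) ` S" using assms by (intro image_eqI[of _ _ "(1 / t) *\<^sub>R x"]) auto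
qed

lemma measurable_gauge: "gauge S \<in> borel_measurable borel"
proof (rule borel_measurable_sublevelI[OF gauge_nonneg])
  fix t :: real assume "t > 0"
  then have "{x. gauge S x \<le> t} = (\<lambda>y. t *\<^sub>R y) ` S" using gauge_le_iff by auto
  then show "closed {x. gauge S x \<le> t}" using S by (simp add: compact_scaling compact_imp_closed)
qed

lemma emeasure_gauge_le:
  assumes "t > 0" shows "emeasure lborel {x. gauge S x \<le> t} = ennreal (measure lebesgue S) * ennreal (t ^ DIM('a))"
proof -
  have "{x. gauge S x \<le> t} = (\<lambda>y. t *\<^sub>R y) ` S" using gauge_le_iff[OF assms] by auto
  then have "emeasure lborel {x. gauge S x \<le> t} = ennreal (measure lebesgue ((\<lambda>y. t *\<^sub>R y) ` S))"
    using S by (simp add: emeasure_lborel_compact compact_scaling)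
  then show ?thesis using assms by (simp add: measure_scaleR ennreal_mult' mult.commute)
qed

end

lemma nn_integral_lborel_reflect:
  fixes f :: "'a::euclidean_space \<Rightarrow> ennreal"
  assumes [measurable]: "f \<in> borel_measurable borel"
  shows "(\<integral>\<^sup>+x. f (z - x) \<partial>lborel) = (\<integral>\<^sup>+x. f x \<partial>lborel)"
proof -
  have "distr lborel borel (\<lambda>x. z - x) = (lborel :: 'a measure)"
    by (subst (2) lborel_affine[of "-1" z]) (simp_all add: density_1)
  then have "(\<integral>\<^sup>+x. f x \<partial>lborel) = (\<integral>\<^sup>+x. f x \<partial>distr lborel borel (\<lambda>x. z - x))" by simp
  also have "\<dots> = (\<integral>\<^sup>+x. f (z - x) \<partial>lborel)" by (rule nn_integral_distr) measurable
  finally show ?thesis ..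
qed

lemma compact_convex_difference_body:
  fixes K :: "'a::euclidean_space set"
  assumes "compact K" "convex K"
  shows "compact {x - y | x y. x \<in> K \<and> y \<in> K}" "convex {x - y | x y. x \<in> K \<and> y \<in> K}"
proof -
  show "compact {x - y | x y. x \<in> K \<and> y \<in> K}" by (rule compact_differences[OF assms(1) assms(1)])
  have "{x - y | x y. x \<in> K \<and> y \<in> K} = (\<Union>x\<in>K. \<Union>y\<in>K. {x - y})" by auto
  then show "convex {x - y | x y. x \<in> K \<and> y \<in> K}" using convex_differences[OF assms(2) assms(2)] by simp
qed

text \<open>If \<open>x = t (a - b)\<close> with \<open>a, b \<in> K\<close>, then \<open>K \<inter> (x + K)\<close> contains \<open>(1 - t) K + t a\<close>. Integrating the volume of
  \<open>K \<inter> (x + K)\<close> over \<open>x\<close> gives the square of the volume of \<open>K\<close>.\<close>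
theorem rogers_shephard:
  fixes K :: "'a::euclidean_space set"
  assumes K: "compact K" "convex K" and r: "r > 0" "cball 0 r \<subseteq> K"
  shows "(fact DIM('a))\<^sup>2 / fact (2 * DIM('a)) * measure lebesgue {x - y | x y. x \<in> K \<and> y \<in> K} \<le> measure lebesgue K"
proof -
  let ?n = "DIM('a)"
  define S where "S = {x - y | x y. x \<in> K \<and> y \<in> K}"
  have S: "compact S" "convex S"
    unfolding S_def by (rule compact_convex_difference_body[OF K])+
  have K0: "0 \<in> K" using r by auto
  have rS: "cball 0 r \<subseteq> S" using r(2) K0 unfolding S_def by force
  have n0: "?n > 0" by simp
  have Kb[measurable]: "K \<in> sets borel" using K by (simp add: borel_compact)
  let ?I = "indicator K :: 'a \<Rightarrow> ennreal"
  define f where "f x = (\<integral>\<^sup>+z. ?I z * ?I (z - x) \<partial>lborel)" for x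
  let ?v = "measure lebesgue K"
  have vK: "emeasure lborel K = ennreal ?v" by (rule emeasure_lborel_compact[OF K(1)])
  have vpos: "?v > 0"
  proof -
    have "measure lebesgue (cball (0::'a) r) \<le> ?v"
      using r K by (intro measure_mono_fmeasurable) (auto intro: lmeasurable_compact fmeasurableD)
    moreover have "measure lebesgue (cball (0::'a) r) > 0"
      using r content_cball_pos[of r "0::'a"] by (simp add: measure_completion)
    ultimately show ?thesis by linarith
  qed
  \<comment> \<open>At a point x of gauge t this profile bounds the ratio of the volume of K
    \<inter> (x + K), which is \<open>f x\<close>, to that of K from below.\<close>
  define G where "G t = ennreal ((1 - t) ^ ?n) * indicator {0..1} t" for t :: real
  have Gm[measurable]: "G \<in> borel_measurable borel" unfolding G_def by measurable
  have lower: "G (gauge S x) * ennreal ?v \<le> f x" if x: "x \<noteq> 0" for x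
  proof (cases "gauge S x \<le> 1")
    case False
    then show ?thesis by (simp add: G_def)
  next
    case True
    define t where "t = gauge S x"
    have t01: "0 \<le> t" "t \<le> 1" using gauge_nonneg[OF S r(1) rS] True by (auto simp: t_def)
    \<comment> \<open>Boundedness of K - K keeps the gauge of a nonzero point positive.\<close>
    have "t \<noteq> 0"
    proof
      assume "t = 0"
      obtain R where R: "R > 0" "\<And>y. y \<in> S \<Longrightarrow> norm y \<le> R"
        using compact_imp_bounded[OF S(1)] unfolding bounded_pos by blast
      have s: "norm x / (2 * R) > 0" using x R by simp
      have "x \<in> (\<lambda>y. (norm x / (2 * R)) *\<^sub>R y) ` S"
        using gauge_le_iff[OF S r(1) rS s, of x] s \<open>t = 0\<close> by (simp add: t_def)
      then obtain y where y: "y \<in> S" "x = (norm x / (2 * R)) *\<^sub>R y" by blast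
      then have "norm x = (norm x / (2 * R)) * norm y" using R by (metis abs_of_nonneg less_imp_le norm_scaleR s)
      also have "\<dots> \<le> (norm x / (2 * R)) * R" using R(2)[OF y(1)] s by (intro mult_left_mono) auto
      finally show False using x R by simp
    qed
    then have t: "0 < t" using t01 by simp
    then have "x \<in> (\<lambda>y. t *\<^sub>R y) ` S" using gauge_le_iff[OF S r(1) rS t, of x] by (simp add: t_def)
    then obtain a b where ab: "a \<in> K" "b \<in> K" "x = t *\<^sub>R (a - b)" by (auto simp: S_def)
    let ?W = "(\<lambda>k. (1 - t) *\<^sub>R k + t *\<^sub>R a) ` K"
    have cW: "compact ?W" by (intro compact_continuous_image K continuous_intros)
    \<comment> \<open>The same k is moved towards a and towards b; the two resulting points of
      \<open>K\<close> differ by exactly t (a - b) = x.\<close>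
    have W: "z \<in> K \<and> z - x \<in> K" if z: "z \<in> ?W" for z
    proof -
      obtain k where k: "k \<in> K" "z = (1 - t) *\<^sub>R k + t *\<^sub>R a" using z by blast
      have 1: "(1 - t) *\<^sub>R k + t *\<^sub>R a \<in> K" using k ab t01 by (intro convexD[OF K(2)]) auto
      have 2: "(1 - t) *\<^sub>R k + t *\<^sub>R b \<in> K" using k ab t01 by (intro convexD[OF K(2)]) auto
      have "z - x = (1 - t) *\<^sub>R k + t *\<^sub>R b" by (simp add: k ab algebra_simps)
      then show ?thesis using 1 2 k(2) by (simp only: simp_thms)
    qed
    have "measure lebesgue ?W = (1 - t) ^ ?n * ?v"
      using measure_lebesgue_affine[of "1 - t" "t *\<^sub>R a" K] t01 by (simp add: add.commute)
    then have "G (gauge S x) * ennreal ?v = emeasure lborel ?W"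
      using t01 by (simp add: G_def t_def[symmetric] emeasure_lborel_compact[OF cW] ennreal_mult')
    also have "\<dots> = (\<integral>\<^sup>+z. indicator ?W z \<partial>lborel)" using cW by (simp add: borel_compact)
    also have "\<dots> \<le> f x" unfolding f_def
      using W by (intro nn_integral_mono) (auto simp: indicator_def)
    finally show ?thesis .
  qed
  have Gg[measurable]: "(\<lambda>x. G (gauge S x)) \<in> borel_measurable borel"
    using measurable_gauge[OF S r(1) rS] Gm by measurable
  have "(\<integral>\<^sup>+x. G (gauge S x) \<partial>lborel) = ennreal (measure lebesgue S) * radial_integral G ?n"
    unfolding radial_integral_def
    by (rule nn_integral_radial)
       (use measurable_gauge[OF S r(1) rS] gauge_nonneg[OF S r(1) rS] emeasure_gauge_le[OF S r(1) rS] in auto)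
  also have "radial_integral G ?n = ennreal ((fact ?n)\<^sup>2 / fact (2 * ?n))"
    unfolding G_def by (rule radial_integral_beta[OF n0])
  finally have 1: "(\<integral>\<^sup>+x. G (gauge S x) \<partial>lborel) = ennreal (measure lebesgue S) * ennreal ((fact ?n)\<^sup>2 / fact (2 * ?n))" .
  have "(\<integral>\<^sup>+x. G (gauge S x) \<partial>lborel) * ennreal ?v = (\<integral>\<^sup>+x. G (gauge S x) * ennreal ?v \<partial>lborel)"
    by (rule nn_integral_multc[symmetric]) simp
  also have "\<dots> \<le> (\<integral>\<^sup>+x. f x \<partial>lborel)"
  proof (rule nn_integral_mono_AE)
    show "AE x in lborel. G (gauge S x) * ennreal ?v \<le> f x"
      using AE_lborel_singleton[of "0::'a"] by eventually_elim (rule lower)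
  qed
  also have "\<dots> = (\<integral>\<^sup>+z. \<integral>\<^sup>+x. ?I z * ?I (z - x) \<partial>lborel \<partial>lborel)"
  proof -
    have "(\<lambda>(z, x). ?I z * ?I (z - x)) \<in> borel_measurable (lborel \<Otimes>\<^sub>M lborel)"
      unfolding lborel_prod case_prod_beta by measurable
    then show ?thesis unfolding f_def by (rule lborel_pair.Fubini')
  qed
  also have "\<dots> = (\<integral>\<^sup>+z. ?I z * ennreal ?v \<partial>lborel)"
  proof (rule nn_integral_cong)
    fix z :: 'a
    have "(\<integral>\<^sup>+x. ?I z * ?I (z - x) \<partial>lborel) = ?I z * (\<integral>\<^sup>+x. ?I (z - x) \<partial>lborel)"
      by (rule nn_integral_cmult) measurable
    also have "(\<integral>\<^sup>+x. ?I (z - x) \<partial>lborel) = (\<integral>\<^sup>+x. ?I x \<partial>lborel)"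
      by (rule nn_integral_lborel_reflect) measurable
    finally show "(\<integral>\<^sup>+x. ?I z * ?I (z - x) \<partial>lborel) = ?I z * ennreal ?v" by (simp add: vK)
  qed
  also have "\<dots> = ennreal ?v * ennreal ?v"
    by (subst nn_integral_multc) (auto simp: vK)
  finally have "ennreal (measure lebesgue S * ((fact ?n)\<^sup>2 / fact (2 * ?n)) * ?v) \<le> ennreal (?v * ?v)"
    unfolding 1 by (simp add: ennreal_mult' del: times_divide_eq_right)
  then have "measure lebesgue S * ((fact ?n)\<^sup>2 / fact (2 * ?n)) * ?v \<le> ?v * ?v"
    by (subst (asm) ennreal_le_iff) auto
  then have "measure lebesgue S * ((fact ?n)\<^sup>2 / fact (2 * ?n)) \<le> ?v" by (rule mult_right_le_imp_le[OF _ vpos])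
  then show ?thesis by (simp add: S_def mult.commute)
qed

section \<open>Support functions and the volume of the polar body\<close>

definition support_fun :: "'a::euclidean_space set \<Rightarrow> 'a \<Rightarrow> real" where
  "support_fun K y = Sup ((\<lambda>x. x \<bullet> y) ` K)"

lemma support_fun_le_iff:
  assumes "compact K" "K \<noteq> {}" shows "support_fun K y \<le> t \<longleftrightarrow> (\<forall>x\<in>K. x \<bullet> y \<le> t)"
proof -
  have "compact ((\<lambda>x. x \<bullet> y) ` K)" using assms by (intro compact_continuous_image continuous_intros)
  then have "bdd_above ((\<lambda>x. x \<bullet> y) ` K)" by (intro bounded_imp_bdd_above compact_imp_bounded)
  then show ?thesis unfolding support_fun_def using assms by (simp add: cSup_le_iff)
qed

lemma support_fun_upper:
  assumes "compact K" "x \<in> K" shows "x \<bullet> y \<le> support_fun K y"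
  using support_fun_le_iff[of K y "support_fun K y"] assms by blast

lemma support_fun_level:
  assumes "compact K" "K \<noteq> {}" "t > 0" shows "{y. support_fun K y \<le> t} = (\<lambda>y. t *\<^sub>R y) ` polar_body K"
proof (intro set_eqI iffI)
  fix y assume "y \<in> {y. support_fun K y \<le> t}"
  then have "\<forall>x\<in>K. x \<bullet> y \<le> t" using support_fun_le_iff[OF assms(1,2)] by simp
  then have "(1 / t) *\<^sub>R y \<in> polar_body K" using assms(3) by (auto simp: polar_body_def divide_le_eq)
  then show "y \<in> (\<lambda>y. t *\<^sub>R y) ` polar_body K" using assms(3) by (intro image_eqI[of _ _ "(1 / t) *\<^sub>R y"]) auto
next
  fix y assume "y \<in> (\<lambda>y. t *\<^sub>R y) ` polar_body K"
  then obtain z where z: "z \<in> polar_body K" "y = t *\<^sub>R z" by blast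
  have "x \<bullet> y \<le> t" if "x \<in> K" for x
  proof -
    have "x \<bullet> z \<le> 1" using z(1) that by (simp add: polar_body_def)
    then show ?thesis using assms(3) by (simp add: z(2) mult_left_le)
  qed
  then show "y \<in> {y. support_fun K y \<le> t}" using support_fun_le_iff[OF assms(1,2)] by simp
qed

context
  fixes K :: "'a::euclidean_space set" and r :: real
  assumes K: "compact K" and r: "r > 0" "cball 0 r \<subseteq> K"
begin

lemma support_fun_nonneg: "0 \<le> support_fun K y"
  using support_fun_upper[OF K subsetD[OF r(2)], of 0 y] r(1) by simp

lemma measurable_support_fun: "support_fun K \<in> borel_measurable borel"
proof (rule borel_measurable_sublevelI[OF support_fun_nonneg])
  fix t :: real assume "t > 0"
  then show "closed {x. support_fun K x \<le> t}"
    using r compact_polar_body[OF r] by (subst support_fun_level[OF K]) (auto intro!: compact_imp_closed compact_scaling)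
qed

text \<open>The support function is the gauge of the polar body, so the radial formula applies.
  Polar volumes become integrals over one common space, where support functions can be compared
  pointwise.\<close>

lemma nn_integral_exp_support_fun:
  "(\<integral>\<^sup>+y. ennreal (exp (- support_fun K y)) \<partial>lborel) = ennreal (measure lebesgue (polar_body K)) * ennreal (fact DIM('a))"
proof -
  have "(\<integral>\<^sup>+y. ennreal (exp (- support_fun K y)) \<partial>lborel)
      = ennreal (measure lebesgue (polar_body K)) * radial_integral (\<lambda>t. ennreal (exp (- t))) DIM('a)"
    unfolding radial_integral_def
  proof (rule nn_integral_radial)
    fix t :: real assume t: "t > 0"
    have "K \<noteq> {}" using r by auto
    then have "{x \<in> space lborel. support_fun K x \<le> t} = (\<lambda>y. t *\<^sub>R y) ` polar_body K"
      using support_fun_level[OF K _ t] by simp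
    then show "emeasure lborel {x \<in> space lborel. support_fun K x \<le> t} = ennreal (measure lebesgue (polar_body K)) * ennreal (t ^ DIM('a))"
      using t compact_polar_body[OF r]
      by (simp add: emeasure_lborel_compact compact_scaling measure_scaleR ennreal_mult' mult.commute)
  qed (use measurable_support_fun support_fun_nonneg in auto)
  then show ?thesis by (simp add: radial_integral_exp)
qed

end

text \<open>The support function of \<open>(K - K) / 2\<close> at \<open>y\<close> is the mean of those of \<open>K\<close> at \<open>y\<close> and \<open>- y\<close>, and \<open>exp\<close> is convex.\<close>
lemma measure_polar_half_difference:
  fixes K :: "'a::euclidean_space set"
  assumes K: "compact K" and r: "r > 0" "cball 0 r \<subseteq> K"
  defines "D \<equiv> (\<lambda>x. (1 / 2) *\<^sub>R x) ` {x - y | x y. x \<in> K \<and> y \<in> K}"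
  assumes rD: "cball 0 r \<subseteq> D"
  shows "measure lebesgue (polar_body D) \<le> measure lebesgue (polar_body K)"
proof -
  have D: "compact D" unfolding D_def by (intro compact_scaling compact_differences K)
  let ?h = "support_fun K"
  have hm[measurable]: "?h \<in> borel_measurable borel" by (rule measurable_support_fun[OF K r])
  have le: "(?h y + ?h (- y)) / 2 \<le> support_fun D y" for y
  proof -
    have "a \<bullet> y + b \<bullet> (- y) \<le> 2 * support_fun D y" if "a \<in> K" "b \<in> K" for a b
    proof -
      have "(1 / 2) *\<^sub>R (a - b) \<in> D" using that by (auto simp: D_def)
      then have "((1 / 2) *\<^sub>R (a - b)) \<bullet> y \<le> support_fun D y" by (rule support_fun_upper[OF D])
      then show ?thesis by (simp add: inner_diff_left)
    qed
    \<comment> \<open>The supremum over \<open>a\<close> is taken with \<open>b\<close> fixed, and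
      the one over \<open>b\<close> afterwards.\<close>
    then have "\<forall>a\<in>K. a \<bullet> y \<le> 2 * support_fun D y - b \<bullet> (- y)" if "b \<in> K" for b using that by force
    then have 1: "?h y \<le> 2 * support_fun D y - b \<bullet> (- y)" if "b \<in> K" for b
      using support_fun_le_iff[OF K] that by blast
    then have "\<forall>b\<in>K. b \<bullet> (- y) \<le> 2 * support_fun D y - ?h y" by force
    moreover have "K \<noteq> {}" using r by auto
    ultimately have "?h (- y) \<le> 2 * support_fun D y - ?h y" using support_fun_le_iff[OF K] by blast
    then show ?thesis by simp
  qed
  have refl: "(\<integral>\<^sup>+y. ennreal (exp (- ?h (- y))) \<partial>lborel) = (\<integral>\<^sup>+y. ennreal (exp (- ?h y)) \<partial>lborel)"
    using nn_integral_lborel_reflect[of "\<lambda>y. ennreal (exp (- ?h y))" 0] by simp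
  have "ennreal (measure lebesgue (polar_body D)) * ennreal (fact DIM('a)) = (\<integral>\<^sup>+y. ennreal (exp (- support_fun D y)) \<partial>lborel)"
    by (rule nn_integral_exp_support_fun[OF D r(1) rD, symmetric])
  also have "\<dots> \<le> (\<integral>\<^sup>+y. ennreal (1 / 2) * (ennreal (exp (- ?h y)) + ennreal (exp (- ?h (- y)))) \<partial>lborel)"
  proof (rule nn_integral_mono)
    fix y
    have "exp (- support_fun D y) \<le> exp (- ?h y / 2) * exp (- ?h (- y) / 2)"
      unfolding exp_add[symmetric] using le[of y] by (simp add: add_divide_distrib)
    also have "\<dots> \<le> ((exp (- ?h y / 2))\<^sup>2 + (exp (- ?h (- y) / 2))\<^sup>2) / 2"
      using sum_squares_bound[of "exp (- ?h y / 2)" "exp (- ?h (- y) / 2)"] by simp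
    also have "\<dots> = 1 / 2 * (exp (- ?h y) + exp (- ?h (- y)))"
      by (simp add: exp_double[symmetric])
    finally have "ennreal (exp (- support_fun D y)) \<le> ennreal (1 / 2 * (exp (- ?h y) + exp (- ?h (- y))))"
      by (rule ennreal_leI)
    also have "\<dots> = ennreal (1 / 2) * ennreal (exp (- ?h y) + exp (- ?h (- y)))"
      by (rule ennreal_mult') simp
    also have "ennreal (exp (- ?h y) + exp (- ?h (- y))) = ennreal (exp (- ?h y)) + ennreal (exp (- ?h (- y)))"
      by (rule ennreal_plus) auto
    finally show "ennreal (exp (- support_fun D y)) \<le> ennreal (1 / 2) * (ennreal (exp (- ?h y)) + ennreal (exp (- ?h (- y))))" .
  qed
  also have "\<dots> = ennreal (1 / 2) * ((\<integral>\<^sup>+y. ennreal (exp (- ?h y)) \<partial>lborel) + (\<integral>\<^sup>+y. ennreal (exp (- ?h (- y))) \<partial>lborel))"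
    by (subst nn_integral_cmult) (auto simp: nn_integral_add)
  also have "\<dots> = (\<integral>\<^sup>+y. ennreal (exp (- ?h y)) \<partial>lborel)"
  proof -
    have "ennreal (1 / 2) * (x + x) = x" for x
    proof -
      have "ennreal (1 / 2) * (x + x) = (ennreal (1 / 2) * 2) * x" by (simp add: mult_2[symmetric] mult.assoc)
      also have "ennreal (1 / 2) * 2 = 1"
        using ennreal_mult[of "1 / 2" 2] by simp
      finally show ?thesis by simp
    qed
    then show ?thesis unfolding refl .
  qed
  also have "\<dots> = ennreal (measure lebesgue (polar_body K)) * ennreal (fact DIM('a))"
    by (rule nn_integral_exp_support_fun[OF K r])
  finally have "ennreal (measure lebesgue (polar_body D) * fact DIM('a)) \<le> ennreal (measure lebesgue (polar_body K) * fact DIM('a))"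
    by (simp add: ennreal_mult')
  then show ?thesis by (subst (asm) ennreal_le_iff) auto
qed

text \<open>The body D = (K - K) / 2 has 2^(-n) times the volume of K - K, hence at most 2^(-n)
  (2n)! / (n!)^2 times that of K, and its polar is no larger in volume. So the symmetric bound for D
  is multiplied by 2^n (n!)^2 / (2n)!.\<close>

theorem mahler_volume_ge:
  fixes K :: "(real^'n::{finite,wellorder}) set"
  assumes K: "compact K" "convex K" and r: "r > 0" "cball 0 r \<subseteq> K"
  shows "4 ^ CARD('n) * fact CARD('n) ^ 4 * pi ^ CARD('n) / (fact (2 * CARD('n)) ^ 2 * Gamma (real CARD('n) / 2 + 1) ^ 2)
    \<le> mahler_volume K"
proof -
  let ?n = "CARD('n)"
  define S where "S = {x - y | x y. x \<in> K \<and> y \<in> K}"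
  define D where "D = (\<lambda>x. (1 / 2) *\<^sub>R x) ` S"
  have S: "compact S" "convex S"
    unfolding S_def by (rule compact_convex_difference_body[OF K])+
  have D: "compact D" "convex D" unfolding D_def using S by (auto intro: compact_scaling convex_scaling)
  have rD: "cball 0 r \<subseteq> D"
  proof
    fix x :: "(real,'n) vec" assume x: "x \<in> cball 0 r"
    then have "x \<in> K" "- x \<in> K" using r(2) by auto
    then have "x - (- x) \<in> S" unfolding S_def by blast
    moreover have "x = (1 / 2) *\<^sub>R (x - (- x))" by (simp add: scaleR_2[symmetric])
    ultimately show "x \<in> D" unfolding D_def by blast
  qed
  have sym: "- x \<in> D" if "x \<in> D" for x
  proof -
    obtain a b where ab: "a \<in> K" "b \<in> K" "x = (1 / 2) *\<^sub>R (a - b)" using \<open>x \<in> D\<close> by (auto simp: D_def S_def)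
    then have "- x = (1 / 2) *\<^sub>R (b - a)" by (simp add: scaleR_right_diff_distrib)
    then show ?thesis using ab by (auto simp: D_def S_def)
  qed
  have "symmetric_bound ?n \<le> mahler_volume D" by (rule mahler_volume_symmetric[OF D r(1) rD sym])
  also have "\<dots> = (1 / 2) ^ ?n * measure lebesgue S * measure lebesgue (polar_body D)"
    by (simp add: mahler_volume_def D_def measure_scaleR)
  also have "\<dots> \<le> (1 / 2) ^ ?n * measure lebesgue S * measure lebesgue (polar_body K)"
    using measure_polar_half_difference[OF K(1) r] rD unfolding D_def S_def by (intro mult_left_mono) auto
  finally have 1: "symmetric_bound ?n \<le> (1 / 2) ^ ?n * measure lebesgue S * measure lebesgue (polar_body K)" .
  let ?c = "(fact ?n)\<^sup>2 / fact (2 * ?n) :: real"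
  have "2 ^ ?n * ?c * symmetric_bound ?n \<le> 2 ^ ?n * ?c * ((1 / 2) ^ ?n * measure lebesgue S * measure lebesgue (polar_body K))"
    using 1 by (intro mult_left_mono) auto
  also have "\<dots> = (?c * measure lebesgue S) * measure lebesgue (polar_body K)"
    by (simp add: power_one_over)
  also have "\<dots> \<le> measure lebesgue K * measure lebesgue (polar_body K)"
    using rogers_shephard[OF K r] by (intro mult_right_mono) (auto simp: S_def)
  also have "\<dots> = mahler_volume K" by (simp add: mahler_volume_def)
  also have "2 ^ ?n * ?c * symmetric_bound ?n = 4 ^ ?n * fact ?n ^ 4 * pi ^ ?n / (fact (2 * ?n) ^ 2 * Gamma (real ?n / 2 + 1) ^ 2)"
  proof -
    have "(4::real) ^ ?n = 2 ^ ?n * 2 ^ ?n" by (simp add: power_mult_distrib[symmetric])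
    then show ?thesis unfolding symmetric_bound_def
      by (simp add: power_mult_distrib power2_eq_square power4_eq_xxxx mult_ac)
  qed
  finally show ?thesis .
qed

section \<open>Simplices\<close>

text \<open>The all-ones vector is added to the rows of the identity one at a time. By linearity in
  row k each addition contributes the determinant of \<open>E' k S\<close>, whose row k is all ones;
  row operations show that this is 1.\<close>

lemma det_one_plus_ones: "det ((\<chi> i j. (if i = j then 1 else 0) + 1) :: real^'n^'n) = real CARD('n) + 1"
proof -
  let ?u = "(\<chi> j. 1) :: real^'n"
  define E where "E S = ((\<chi> i. if i \<in> S then axis i 1 + ?u else axis i 1) :: real^'n^'n)" for S :: "'n set"
  define E' where "E' k S = ((\<chi> i. if i = k then ?u else if i \<in> S then axis i 1 + ?u else axis i 1) :: real^'n^'n)" for k and S :: "'n set"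
  have I: "((\<chi> i. axis i 1) :: real^'n^'n) = mat 1" by (simp add: vec_eq_iff axis_def mat_def) 
  have 1: "det (E' k S) = 1" if "finite S" "k \<notin> S" for k S
    using that
  proof (induction S rule: finite_induct)
    case empty
    let ?A = "mat 1 :: real^'n^'n"
    have row: "row i ?A = axis i 1" for i by (simp add: row_def vec_eq_iff axis_def mat_def)
    have "(\<Sum>j\<in>UNIV - {k}. row j ?A) \<in> vec.span {row j ?A | j. j \<noteq> k}"
      by (intro vec.span_sum vec.span_base) auto
    then have "det (\<chi> i. if i = k then row k ?A + (\<Sum>j\<in>UNIV - {k}. row j ?A) else row i ?A) = 1"
      using det_row_span[where x="\<Sum>j\<in>UNIV - {k}. row j ?A" and i=k and A="?A"] by simp
    moreover have "row k ?A + (\<Sum>j\<in>UNIV - {k}. row j ?A) = ?u"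
    proof -
      have "row k ?A + (\<Sum>j\<in>UNIV - {k}. row j ?A) = (\<Sum>j\<in>UNIV. row j ?A)"
        by (simp add: sum.remove[of UNIV k])
      also have "\<dots> = ?u" by (simp add: row vec_eq_iff axis_def)
      finally show ?thesis .
    qed
    ultimately show ?case by (simp add: E'_def row cong: if_cong)
  next
    case (insert j S)
    have "j \<noteq> k" using insert by auto
    have "E' k (insert j S) = (\<chi> r. if r = j then row j (E' k S) + 1 *s row k (E' k S) else row r (E' k S))"
      using insert \<open>j \<noteq> k\<close> by (auto simp: E'_def vec_eq_iff row_def)
    then show ?case using det_row_operation[OF \<open>j \<noteq> k\<close>, of "E' k S" 1] insert by simp
  qed
  have 2: "det (E S) = 1 + real (card S)" if "finite S" for S
    using that
  proof (induction S rule: finite_induct)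
    case empty
    then show ?case by (simp add: E_def I)
  next
    case (insert k S)
    have "E (insert k S) = (\<chi> i. if i = k then axis k 1 + ?u else (if i \<in> S then axis i 1 + ?u else axis i 1))"
      by (auto simp: E_def vec_eq_iff)
    then have "det (E (insert k S)) = det (\<chi> i. if i = k then axis k 1 else (if i \<in> S then axis i 1 + ?u else axis i 1))
      + det (\<chi> i. if i = k then ?u else (if i \<in> S then axis i 1 + ?u else axis i 1))"
      using det_row_add[of k "\<lambda>_. axis k 1" "\<lambda>_. ?u" "\<lambda>i. if i \<in> S then axis i 1 + ?u else axis i 1"] by simp
    also have "(\<chi> i. if i = k then axis k 1 else (if i \<in> S then axis i 1 + ?u else axis i 1)) = E S"
      using insert by (auto simp: E_def vec_eq_iff)
    also have "(\<chi> i. if i = k then ?u else (if i \<in> S then axis i 1 + ?u else axis i 1)) = E' k S"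
      by (simp add: E'_def)
    finally show ?case using insert 1[of S k] by simp
  qed
  have "((\<chi> i j. (if i = j then 1 else 0) + 1) :: real^'n^'n) = E UNIV"
    by (auto simp: E_def vec_eq_iff axis_def)
  then show ?thesis using 2[of UNIV] by simp
qed

lemma std_simplex_cart:
  "convex hull (insert 0 Basis) = {y::real^'n. (\<forall>i. 0 \<le> y $ i) \<and> (\<Sum>i\<in>UNIV. y $ i) \<le> 1}"
proof -
  have B: "(Basis :: (real^'n) set) = range (\<lambda>i. axis i 1)" by (auto simp: Basis_vec_def)
  have inj: "inj (\<lambda>i. axis i 1 :: real^'n)" by (auto simp: inj_def axis_eq_axis)
  show ?thesis unfolding std_simplex unfolding B
    by (simp add: sum.reindex[OF inj] comp_def inner_axis)
qed

lemma distr_affine_lborel: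
  fixes M :: "real^'n::{finite,wellorder}^'n::_"
  assumes "det M \<noteq> 0"
  shows "distr (density lborel (\<lambda>_. ennreal \<bar>det M\<bar>)) lborel (\<lambda>y. c + M *v y) = lborel"
proof -
  have "distr (density lborel (\<lambda>u. ennreal \<bar>det (matrix (\<lambda>h. M *v h))\<bar>)) lborel (\<lambda>y. c + M *v y) = lborel"
  proof (rule distr_density_det_eq_lborel[where F="{}"])
    have inv: "invertible M" using assms by (simp add: invertible_det_nz)
    then have "bij ((*v) M)" by (simp add: invertible_eq_bij)
    then show "bij (\<lambda>y. c + M *v y)"
      using bij_comp[OF _ bij_plus, of "(*v) M" c] by (simp add: comp_def)
    show "((\<lambda>y. c + M *v y) has_derivative (\<lambda>h. M *v h)) (at u)" for u
      by (auto intro!: derivative_eq_intros bounded_linear_imp_has_derivative)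
    show "(\<lambda>y. c + M *v y) \<in> borel_measurable borel"
      by (intro borel_measurable_continuous_onI continuous_intros matrix_vector_mult_linear_continuous_on)
  qed auto
  then show ?thesis by simp
qed

text \<open>The volume preserving involution that exchanges the vertices \<open>0\<close> and \<open>axis i 1\<close> turns the \<open>i\<close>-th coordinate into
  the barycentric coordinate of the vertex \<open>0\<close>.\<close>
lemma integral_std_simplex_coord:
  fixes i :: "'n::{finite,wellorder}"
  defines "std \<equiv> convex hull (insert 0 Basis) :: (real,'n) vec set"
  shows "(LINT y|lborel. indicator std y *\<^sub>R (y $ i)) = measure lborel std / (real CARD('n) + 1)"
proof -
  have std: "y \<in> std \<longleftrightarrow> (\<forall>i. 0 \<le> y $ i) \<and> (\<Sum>i\<in>UNIV. y $ i) \<le> 1" for y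
    unfolding std_def std_simplex_cart by simp
  have comp: "compact std" unfolding std_def by (intro finite_imp_compact_convex_hull) auto
  then have stdb[measurable]: "std \<in> sets borel" by (simp add: borel_compact)
  define k where "k i = (LINT y|lborel. indicator std y *\<^sub>R (y $ i))" for i
  have int: "integrable lborel (\<lambda>y. indicator std y *\<^sub>R (y $ i))" for i
    by (intro borel_integrable_compact comp continuous_intros)
  have int1: "integrable lborel (indicator std :: _ \<Rightarrow> real)"
    using borel_integrable_compact[OF comp, of "\<lambda>_. 1::real"] by simp
  have eq: "k i = measure lborel std - (\<Sum>j\<in>UNIV. k j)" for i
  proof -
    define L where "L = ((\<chi> r c. if r = i then -1 else if r = c then 1 else 0) :: (real, 'n) vec^'n::_)"
    define t where "t y = axis i 1 + L *v y" for y
    have Ly: "(L *v y) $ r = (if r = i then - (\<Sum>j\<in>UNIV. y $ j) else y $ r)" for y r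
      by (simp add: L_def matrix_vector_mult_def sum_negf if_distrib[of "\<lambda>x. x * _"] cong: if_cong)
    have ty: "t y $ r = (if r = i then 1 - (\<Sum>j\<in>UNIV. y $ j) else y $ r)" for y r
      by (simp add: t_def Ly axis_def)
    have "L *v (L *v y) = y" for y
    proof -
      have "(\<Sum>j\<in>UNIV. (L *v y) $ j) = (L *v y) $ i + (\<Sum>j\<in>UNIV - {i}. (L *v y) $ j)"
        by (rule sum.remove) auto
      also have "(\<Sum>j\<in>UNIV - {i}. (L *v y) $ j) = (\<Sum>j\<in>UNIV - {i}. y $ j)"
        by (intro sum.cong) (auto simp: Ly)
      also have "\<dots> = (\<Sum>j\<in>UNIV. y $ j) - y $ i" by (simp add: sum.remove[of UNIV i])
      finally have "(\<Sum>j\<in>UNIV. (L *v y) $ j) = - (y $ i)" by (simp add: Ly)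
      then show ?thesis by (simp add: vec_eq_iff Ly[of "L *v y"]) (simp add: Ly)
    qed
    \<comment> \<open>As \<open>L\<close> is an involution, |det L| = 1 without expanding the
      determinant.\<close>
    then have "L ** L = mat 1" by (simp add: matrix_eq matrix_vector_mul_assoc[symmetric])
    then have "det L * det L = 1" by (simp add: det_mul[symmetric])
    then have "det L = 1 \<or> det L = - 1" by (simp add: square_eq_1_iff)
    then have d: "\<bar>det L\<bar> = 1" by auto
    then have "det L \<noteq> 0" by auto
    then have "distr (density lborel (\<lambda>_. ennreal \<bar>det L\<bar>)) lborel (\<lambda>y. axis i 1 + L *v y) = lborel"
      by (rule distr_affine_lborel)
    then have dt: "distr lborel lborel t = lborel" using d by (simp add: density_1 t_def[abs_def])
    have tm[measurable]: "t \<in> borel_measurable borel" unfolding t_def[abs_def]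
      by (intro borel_measurable_continuous_onI continuous_intros matrix_vector_mult_linear_continuous_on)
    have std_t: "t y \<in> std \<longleftrightarrow> y \<in> std" for y
    proof -
      have "(\<Sum>j\<in>UNIV. t y $ j) = t y $ i + (\<Sum>j\<in>UNIV - {i}. t y $ j)" by (rule sum.remove) auto
      also have "(\<Sum>j\<in>UNIV - {i}. t y $ j) = (\<Sum>j\<in>UNIV - {i}. y $ j)"
        by (intro sum.cong) (auto simp: ty)
      also have "\<dots> = (\<Sum>j\<in>UNIV. y $ j) - y $ i" by (simp add: sum.remove[of UNIV i])
      finally have "(\<Sum>j\<in>UNIV. t y $ j) = 1 - y $ i" by (simp add: ty)
      then show ?thesis unfolding std using ty[of y] by (auto split: if_splits)
    qed
    have "k i = (LINT y|distr lborel lborel t. indicator std y *\<^sub>R (y $ i))" unfolding dt k_def ..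
    also have "\<dots> = (LINT y|lborel. indicator std (t y) *\<^sub>R (t y $ i))"
      by (rule integral_distr) (auto intro!: borel_measurable_scaleR measurable_vec_nth)
    also have "\<dots> = (LINT y|lborel. indicator std y - (\<Sum>j\<in>UNIV. indicator std y *\<^sub>R (y $ j)))"
      by (intro Bochner_Integration.integral_cong) (auto simp: std_t ty indicator_def)
    also have "\<dots> = measure lborel std - (\<Sum>j\<in>UNIV. k j)"
    proof -
      have "integrable lborel (\<lambda>y. \<Sum>j\<in>UNIV. indicator std y *\<^sub>R (y $ j))" by (intro Bochner_Integration.integrable_sum int)
      then have "(LINT y|lborel. indicator std y - (\<Sum>j\<in>UNIV. indicator std y *\<^sub>R (y $ j)))
        = (LINT y|lborel. indicator std y) - (LINT y|lborel. (\<Sum>j\<in>UNIV. indicator std y *\<^sub>R (y $ j)))"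
        by (rule Bochner_Integration.integral_diff[OF int1])
      also have "(LINT y|lborel. (\<Sum>j\<in>UNIV. indicator std y *\<^sub>R (y $ j))) = (\<Sum>j\<in>UNIV. k j)"
        unfolding k_def by (rule Bochner_Integration.integral_sum[OF int])
      finally show ?thesis by simp
    qed
    finally show ?thesis .
  qed
  \<comment> \<open>The right-hand side of \<open>eq\<close> does not depend on i, so all
    \<open>k i\<close> agree.\<close>
  have "(\<Sum>j\<in>UNIV. k j) = real CARD('n) * k i"
  proof -
    have "k j = k i" for j using eq[of i] eq[of j] by simp
    then have "(\<Sum>j\<in>UNIV. k j) = (\<Sum>j\<in>(UNIV :: 'n set). k i)" by (rule sum.cong[OF refl])
    then show ?thesis by simp
  qed
  with eq[of i] have "(real CARD('n) + 1) * k i = measure lborel std" by (simp add: algebra_simps)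
  then show ?thesis unfolding k_def by (simp add: field_simps)
qed

lemma simplex_vertices:
  fixes \<Delta> :: "(real^'n) set"
  assumes "int CARD('n) simplex \<Delta>"
  obtains x0 f where "inj f" "x0 \<notin> range f" "\<Delta> = convex hull (insert x0 (range f))"
    "\<not> affine_dependent (insert x0 (range (f :: 'n \<Rightarrow> real^'n)))"
proof -
  obtain C where C: "\<not> affine_dependent C" "int (card C) = int CARD('n) + 1" "\<Delta> = convex hull C"
    using assms unfolding simplex_def by blast
  have fin: "finite C" using C(1) by (rule aff_independent_finite)
  obtain x0 where x0: "x0 \<in> C" using C(2) by fastforce
  have "card (C - {x0}) = card (UNIV :: 'n set)" using C(2) x0 fin by simp
  then obtain f where f: "bij_betw f (UNIV :: 'n set) (C - {x0})"
    using finite_same_card_bij[of "UNIV :: 'n set" "C - {x0}"] fin by auto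
  have "insert x0 (range f) = C" using f x0 by (auto simp: bij_betw_def)
  moreover have "inj f" "x0 \<notin> range f" using f by (auto simp: bij_betw_def)
  ultimately show ?thesis using C that by metis
qed

text \<open>Centring makes the vertices sum to 0. The edge matrix \<open>M\<close> gives the volume
  and the matrix \<open>B\<close> of the vertices other than \<open>x0\<close> describes the polar
  body; the vanishing sum gives det M = (n + 1) det B, so det B cancels in the product of
  volumes.\<close>

theorem mahler_volume_simplex:
  fixes \<Delta> :: "(real^'n::{finite,wellorder}) set"
  assumes "int CARD('n) simplex \<Delta>" and cent: "centroid \<Delta> = 0"
  shows "mahler_volume \<Delta> = (real CARD('n) + 1) ^ (CARD('n) + 1) / fact CARD('n) ^ 2"
proof -
  let ?n = "CARD('n)"
  obtain x0 and f :: "'n \<Rightarrow> (real,'n) vec" where f: "inj f" "x0 \<notin> range f" and D: "\<Delta> = convex hull (insert x0 (range f))"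
    and ind: "\<not> affine_dependent (insert x0 (range f))" using simplex_vertices[OF assms(1)] by metis
  define M where "M = (\<chi> i. \<chi> j. f j $ i - x0 $ i)"
  define g where "g y = x0 + M *v y" for y
  define std where "std = (convex hull (insert 0 Basis) :: (real,'n) vec set)"
  have cD: "compact \<Delta>" unfolding D by (intro finite_imp_compact_convex_hull) auto
  have cS: "compact std" unfolding std_def by (intro finite_imp_compact_convex_hull) auto
  have [measurable]: "std \<in> sets borel" "\<Delta> \<in> sets borel" using cS cD by (auto simp: borel_compact)
  have card: "card (insert x0 (range f)) = Suc ?n" using f by (simp add: card_image)
  have vol: "measure lebesgue \<Delta> = \<bar>det M\<bar> / fact ?n"
  proof -
    have "measure lborel (convex hull (insert x0 (range f))) = \<bar>det (\<chi> i. \<chi> j. f j $ i - x0 $ i)\<bar> / fact ?n"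
    proof (rule content_simplex)
      show "bij_betw f UNIV (insert x0 (range f) - {x0})" using f by (auto simp: bij_betw_def)
    qed (use card in auto)
    then show ?thesis using cD by (simp add: D[symmetric] M_def measure_completion borel_compact)
  qed
  have pos: "measure lebesgue \<Delta> > 0"
  proof -
    have "interior \<Delta> \<noteq> {}" unfolding D
      using interior_convex_hull_eq_empty[of "insert x0 (range f)"] card ind by simp
    then obtain z e where e: "e > 0" "ball z e \<subseteq> \<Delta>" by (meson mem_interior equals0I)
    have "measure lebesgue (ball z e) \<le> measure lebesgue \<Delta>"
      using e cD by (intro measure_mono_fmeasurable) (auto intro: lmeasurable_compact fmeasurableD)
    moreover have "measure lebesgue (ball z e) > 0"
      using e content_ball_pos[of e z] by (simp add: measure_completion)
    ultimately show ?thesis by linarith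
  qed
  have dM: "det M \<noteq> 0" using pos unfolding vol by auto
  have axM: "M *v axis j 1 = f j - x0" for j
    by (simp add: M_def matrix_vector_mult_basis column_def vec_eq_iff)
  have gD: "g ` std = \<Delta>"
  proof -
    have "g ` std = (\<lambda>y. x0 + y) ` ((*v) M ` std)" by (auto simp: g_def)
    also have "(*v) M ` std = convex hull ((*v) M ` insert 0 Basis)"
      unfolding std_def by (rule convex_hull_linear_image) simp
    also have "(\<lambda>y. x0 + y) ` (convex hull ((*v) M ` insert 0 Basis)) = convex hull ((\<lambda>y. x0 + y) ` ((*v) M ` insert 0 Basis))"
      by (rule convex_hull_translation[symmetric])
    also have "(\<lambda>y. x0 + y) ` ((*v) M ` insert 0 Basis) = insert x0 (range f)"
      by (auto simp: Basis_vec_def axM image_iff)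
    finally show ?thesis by (simp add: D)
  qed
  have injg: "inj g"
  proof -
    have "inj ((*v) M)" using dM by (simp add: invertible_det_nz[symmetric] invertible_eq_bij bij_is_inj)
    then show ?thesis by (simp add: inj_def g_def)
  qed
  have gm[measurable]: "g \<in> borel_measurable borel" unfolding g_def[abs_def]
    by (intro borel_measurable_continuous_onI continuous_intros matrix_vector_mult_linear_continuous_on)
  \<comment> \<open>The affine parametrisation integrates over the standard simplex to its volume
    times x0 plus the sum of (f i - x0) / (n + 1), which is the mean of the n + 1 vertices.\<close>
  have sum0: "x0 + (\<Sum>i\<in>UNIV. f i) = 0"
  proof -
    have "(LINT x:\<Delta>|lebesgue. x) = 0" using cent pos by (simp add: centroid_def)
    then have "0 = (LINT x|lborel. indicator \<Delta> x *\<^sub>R x)"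
      unfolding set_lebesgue_integral_def by (subst (asm) integral_completion) auto
    also have "\<dots> = (LINT x|distr (density lborel (\<lambda>_. ennreal \<bar>det M\<bar>)) lborel g. indicator \<Delta> x *\<^sub>R x)"
      unfolding g_def[abs_def] distr_affine_lborel[OF dM] ..
    also have "\<dots> = (LINT y|density lborel (\<lambda>_. ennreal \<bar>det M\<bar>). indicator \<Delta> (g y) *\<^sub>R g y)"
      by (rule integral_distr) auto
    also have "\<dots> = (LINT y|lborel. \<bar>det M\<bar> *\<^sub>R (indicator \<Delta> (g y) *\<^sub>R g y))"
      by (rule integral_density) auto
    also have "\<dots> = \<bar>det M\<bar> *\<^sub>R (LINT y|lborel. indicator \<Delta> (g y) *\<^sub>R g y)"
      by (rule Bochner_Integration.integral_scaleR_right) 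
    finally have "0 = (LINT y|lborel. indicator \<Delta> (g y) *\<^sub>R g y)" using dM by simp
    also have "\<dots> = (LINT y|lborel. indicator std y *\<^sub>R x0 + (\<Sum>i\<in>UNIV. (indicator std y *\<^sub>R (y $ i)) *\<^sub>R (f i - x0)))"
    proof (rule Bochner_Integration.integral_cong[OF refl])
      fix y
      have "indicator \<Delta> (g y) = (indicator std y :: real)"
        using injg unfolding gD[symmetric] by (simp add: indicator_def inj_image_mem_iff)
      moreover have "M *v y = (\<Sum>i\<in>UNIV. y $ i *\<^sub>R (f i - x0))"
        by (simp add: vec_eq_iff M_def matrix_vector_mult_def mult.commute)
      ultimately show "indicator \<Delta> (g y) *\<^sub>R g y = indicator std y *\<^sub>R x0 + (\<Sum>i\<in>UNIV. (indicator std y *\<^sub>R (y $ i)) *\<^sub>R (f i - x0))"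
        by (simp add: g_def scaleR_add_right scaleR_sum_right)
    qed
    also have "\<dots> = measure lborel std *\<^sub>R x0 + (\<Sum>i\<in>UNIV. (measure lborel std / (real ?n + 1)) *\<^sub>R (f i - x0))"
    proof -
      have i1: "integrable lborel (\<lambda>y. indicator std y *\<^sub>R x0)" by (intro borel_integrable_compact cS continuous_intros)
      have i2: "integrable lborel (\<lambda>y. indicator std y *\<^sub>R (y $ i))" for i by (intro borel_integrable_compact cS continuous_intros)
      have i3: "integrable lborel (indicator std :: (real,'n) vec \<Rightarrow> real)"
        using borel_integrable_compact[OF cS, of "\<lambda>_. 1::real"] by simp
      have v1: "(LINT y|lborel. indicator std y *\<^sub>R x0) = measure lborel std *\<^sub>R x0"
        using i3 by simp
      have v2: "(LINT y|lborel. (indicator std y *\<^sub>R (y $ i)) *\<^sub>R (f i - x0)) = (measure lborel std / (real ?n + 1)) *\<^sub>R (f i - x0)" for i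
        using integral_std_simplex_coord[of i] unfolding std_def[symmetric]
        by (subst integral_scaleR_left[OF i2]) simp
      show ?thesis using i1 i2
        by (subst Bochner_Integration.integral_add) (auto simp: v1 v2 Bochner_Integration.integral_sum simp del: real_scaleR_def)
    qed
    finally have e: "measure lborel std *\<^sub>R x0 + (\<Sum>i\<in>UNIV. (measure lborel std / (real ?n + 1)) *\<^sub>R (f i - x0)) = 0" ..
    have "measure lborel std > 0" unfolding std_def by (simp add: content_std_simplex)
    then have v: "measure lborel std / (real ?n + 1) \<noteq> 0" by simp
    have "measure lborel std *\<^sub>R x0 = (measure lborel std / (real ?n + 1)) *\<^sub>R ((real ?n + 1) *\<^sub>R x0)"
    proof -
      have "real ?n + 1 \<noteq> 0" by (simp add: add_nonneg_eq_0_iff)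
      then show ?thesis unfolding scaleR_scaleR by simp
    qed
    then have "(measure lborel std / (real ?n + 1)) *\<^sub>R ((real ?n + 1) *\<^sub>R x0 + (\<Sum>i\<in>UNIV. f i - x0)) = 0"
      using e by (simp only: scaleR_add_right scaleR_sum_right)
    then have "(real ?n + 1) *\<^sub>R x0 + (\<Sum>i\<in>UNIV. f i - x0) = 0" using v by (simp only: scaleR_eq_0_iff) simp
    moreover have "(\<Sum>i\<in>UNIV. f i - x0) = (\<Sum>i\<in>UNIV. f i) - real ?n *\<^sub>R x0"
      by (simp only: sum_subtractf sum_constant_scaleR)
    ultimately show ?thesis by (simp add: scaleR_add_left algebra_simps)
  qed
  define B where "B = (\<chi> i. f i)"
  have MB: "M = transpose B ** (\<chi> i j. (if i = j then 1 else 0) + 1)"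
  proof -
    have "x0 = - (\<Sum>i\<in>UNIV. f i)" using sum0 by (simp add: eq_neg_iff_add_eq_0)
    then show ?thesis
      by (simp add: M_def B_def transpose_def matrix_matrix_mult_def vec_eq_iff distrib_left sum.distrib
        if_distrib[of "\<lambda>x. _ * x"] cong: if_cong)
  qed
  have detM: "det M = det B * (real ?n + 1)"
    unfolding MB det_mul det_transpose det_one_plus_ones ..
  have dB: "det B \<noteq> 0" using dM detM by auto
  have Bv: "(B *v y) $ i = f i \<bullet> y" for y i
    by (simp add: B_def matrix_vector_mult_def inner_vec_def)
  have pol: "y \<in> polar_body \<Delta> \<longleftrightarrow> (\<forall>i. (B *v y) $ i \<le> 1) \<and> - (\<Sum>i\<in>UNIV. (B *v y) $ i) \<le> 1" for y
  proof -
    have "y \<in> polar_body \<Delta> \<longleftrightarrow> (\<forall>v\<in>insert x0 (range f). v \<bullet> y \<le> 1)"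
    proof
      assume "\<forall>v\<in>insert x0 (range f). v \<bullet> y \<le> 1"
      then have "insert x0 (range f) \<subseteq> {v. v \<bullet> y \<le> 1}" by auto
      moreover have "convex {v. v \<bullet> y \<le> 1}" using convex_halfspace_le[of y 1] by (simp add: inner_commute)
      ultimately have "\<Delta> \<subseteq> {v. v \<bullet> y \<le> 1}" unfolding D by (rule hull_minimal)
      then show "y \<in> polar_body \<Delta>" by (auto simp: polar_body_def)
    next
      assume "y \<in> polar_body \<Delta>"
      then show "\<forall>v\<in>insert x0 (range f). v \<bullet> y \<le> 1"
        unfolding polar_body_def D using hull_subset[of "insert x0 (range f)" convex] by blast
    qed
    moreover have "x0 \<bullet> y = - (\<Sum>i\<in>UNIV. (B *v y) $ i)"
    proof -
      have "x0 = - (\<Sum>i\<in>UNIV. f i)" using sum0 by (simp add: eq_neg_iff_add_eq_0)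
      then show ?thesis by (simp add: Bv inner_sum_left)
    qed
    ultimately show ?thesis by (auto simp: Bv)
  qed
  \<comment> \<open>with \<open>z = (1 - B y) / (n + 1)\<close> the inequalities defining the polar body become those of the standard simplex\<close>
  have Bim: "(*v) B ` polar_body \<Delta> = (\<lambda>z. (- (real ?n + 1)) *\<^sub>R z + (\<chi> i. 1)) ` std"
  proof (intro set_eqI iffI)
    fix w assume "w \<in> (*v) B ` polar_body \<Delta>"
    then have w: "\<forall>i. w $ i \<le> 1" "- (\<Sum>i\<in>UNIV. w $ i) \<le> 1" using pol by auto
    define z where "z = (1 / (real ?n + 1)) *\<^sub>R ((\<chi> i. 1) - w)"
    have "(\<Sum>i\<in>UNIV. z $ i) = (real ?n - (\<Sum>i\<in>UNIV. w $ i)) / (real ?n + 1)"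
      by (simp add: z_def sum_subtractf sum_divide_distrib[symmetric])
    then have "z \<in> std" using w unfolding std_def std_simplex_cart by (simp add: z_def divide_le_eq)
    moreover have "w = (- (real ?n + 1)) *\<^sub>R z + (\<chi> i. 1)" 
    proof -
      have "(real ?n + 1) *\<^sub>R z = (\<chi> i. 1) - w" by (simp add: z_def)
      then show ?thesis by (simp only: scaleR_minus_left) simp
    qed
    ultimately show "w \<in> (\<lambda>z. (- (real ?n + 1)) *\<^sub>R z + (\<chi> i. 1)) ` std" by blast
  next
    fix w assume "w \<in> (\<lambda>z. (- (real ?n + 1)) *\<^sub>R z + (\<chi> i. 1)) ` std"
    then obtain z where z: "z \<in> std" "w = (- (real ?n + 1)) *\<^sub>R z + (\<chi> i. 1)" by blast
    have z': "0 \<le> z $ i" "(\<Sum>i\<in>UNIV. z $ i) \<le> 1" for i using z(1) unfolding std_def std_simplex_cart by auto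
    have wi: "w $ i = 1 - (real ?n + 1) * z $ i" for i unfolding z(2) by (simp add: algebra_simps)
    have w1: "w $ i \<le> 1" for i using z'(1)[of i] unfolding wi by simp
    have "(\<Sum>i\<in>UNIV. w $ i) = real ?n - (real ?n + 1) * (\<Sum>i\<in>UNIV. z $ i)"
      unfolding wi by (simp add: sum_subtractf sum_distrib_left)
    then have "- (\<Sum>i\<in>UNIV. w $ i) = (real ?n + 1) * (\<Sum>i\<in>UNIV. z $ i) - real ?n" by simp
    also have "\<dots> \<le> (real ?n + 1) * 1 - real ?n"
      using z'(2) by (intro diff_right_mono mult_left_mono) auto
    finally have w2: "- (\<Sum>i\<in>UNIV. w $ i) \<le> 1" by simp
    have "bij ((*v) B)" using dB by (simp add: invertible_det_nz[symmetric] invertible_eq_bij)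
    then obtain y where "B *v y = w" by (metis bij_pointE)
    then show "w \<in> (*v) B ` polar_body \<Delta>" using w1 w2 pol[of y] by force
  qed
  have volP: "\<bar>det B\<bar> * measure lebesgue (polar_body \<Delta>) = (real ?n + 1) ^ ?n / fact ?n"
  proof -
    have "measure lebesgue ((*v) B ` polar_body \<Delta>) = (real ?n + 1) ^ ?n * measure lebesgue std"
      unfolding Bim using measure_lebesgue_affine[of "- (real ?n + 1)" "(\<chi> i. 1) :: (real,'n) vec" std]
      by (simp add: add.commute)
    moreover have "measure lebesgue std = 1 / fact ?n"
      using content_std_simplex[where 'a="(real,'n) vec"] cS by (simp add: std_def[symmetric] measure_completion borel_compact)
    moreover have "measure lebesgue ((*v) B ` polar_body \<Delta>) = \<bar>det (matrix ((*v) B))\<bar> * measure lebesgue (polar_body \<Delta>)"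
    proof (rule measure_lebesgue_linear_transformation)
      have "compact ((\<lambda>z. (- (real ?n + 1)) *\<^sub>R z + (\<chi> i. 1)) ` std)"
        by (intro compact_continuous_image cS continuous_intros)
      then have bd: "bounded ((*v) B ` polar_body \<Delta>)" unfolding Bim by (rule compact_imp_bounded)
      obtain B' where B': "B' ** B = mat 1" using dB by (auto simp: invertible_det_nz[symmetric] invertible_def)
      have "(\<lambda>w. B' *v w) ` ((*v) B ` polar_body \<Delta>) = polar_body \<Delta>"
        by (simp add: image_comp comp_def matrix_vector_mul_assoc B')
      moreover have "bounded ((\<lambda>w. B' *v w) ` ((*v) B ` polar_body \<Delta>))"
        by (intro bounded_linear_image[OF bd]) simp
      ultimately show "bounded (polar_body \<Delta>)" by simp
      show "polar_body \<Delta> \<in> sets lebesgue" using borel_closed[OF closed_polar_body] by (intro sets_completionI_sets) simp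
    qed simp
    ultimately show ?thesis by simp
  qed
  have "mahler_volume \<Delta> = (\<bar>det B\<bar> * measure lebesgue (polar_body \<Delta>)) * (real ?n + 1) / fact ?n"
    by (simp add: mahler_volume_def vol detM abs_mult)
  also have "\<dots> = (real ?n + 1) ^ (?n + 1) / fact ?n ^ 2"
    unfolding volP by (simp add: power2_eq_square mult_ac)
  finally show ?thesis .
qed

section \<open>The factor delta\<close>

lemma nonneg_if_decreasing_to_zero:
  fixes f :: "real \<Rightarrow> real"
  assumes der: "\<And>x. x \<ge> a \<Longrightarrow> (f has_real_derivative f' x) (at x)" and neg: "\<And>x. x \<ge> a \<Longrightarrow> f' x \<le> 0"
    and lim: "(f \<longlongrightarrow> 0) at_top" and x: "x \<ge> a"
  shows "f x \<ge> 0"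
proof (rule tendsto_upperbound[OF lim])
  show "\<forall>\<^sub>F y in at_top. f y \<le> f x"
    using eventually_ge_at_top[of x]
  proof eventually_elim
    case (elim y)
    show ?case
      by (rule DERIV_nonpos_imp_nonincreasing[OF elim]) (use der neg x in \<open>meson order_trans\<close>)
  qed
qed simp

text \<open>The difference of the two sides tends to 0 at infinity, and its derivative 2/x^2 -
  2/(x^2 - 1) is nonpositive.\<close>

lemma ln_ratio_ge:
  fixes k :: real assumes "k > 1"
  shows "2 / k \<le> ln (k + 1) - ln (k - 1)"
proof -
  have "0 \<le> ln (k + 1) - ln (k - 1) - 2 / k"
  proof (rule nonneg_if_decreasing_to_zero[where f="\<lambda>k. ln (k + 1) - ln (k - 1) - 2 / k" and a=k and f'="\<lambda>k. 1 / (k + 1) - 1 / (k - 1) + 2 / k\<^sup>2"])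
    fix x assume "x \<ge> k"
    then have x: "x > 1" using assms by simp
    show "((\<lambda>k. ln (k + 1) - ln (k - 1) - 2 / k) has_real_derivative 1 / (x + 1) - 1 / (x - 1) + 2 / x\<^sup>2) (at x)"
      using x by (auto intro!: derivative_eq_intros simp: power2_eq_square)
    have "1 / (x + 1) - 1 / (x - 1) = - (2 / (x\<^sup>2 - 1))"
      using x by (simp add: field_simps power2_eq_square)
    moreover have "2 / x\<^sup>2 \<le> 2 / (x\<^sup>2 - 1)"
      using x by (intro divide_left_mono) (auto simp: one_less_power)
    ultimately show "1 / (x + 1) - 1 / (x - 1) + 2 / x\<^sup>2 \<le> 0" by simp
  next
    show "((\<lambda>k::real. ln (k + 1) - ln (k - 1) - 2 / k) \<longlongrightarrow> 0) at_top" by real_asymp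
  qed simp
  then show ?thesis by simp
qed

text \<open>With k = n + 2 this is the logarithm of the quotient of \<open>delta (n + 2)\<close> by
  \<open>delta n\<close>. It decreases to 0, by \<open>ln_ratio_ge\<close> and convexity of 1/x at k
  - 3/2 and k - 1/2 with midpoint k - 1.\<close>

lemma two_step_log_nonneg:
  fixes k :: real assumes "k \<ge> 3"
  shows "0 \<le> 2 + (k + 3) * ln (k - 1) + 2 * ln k - 2 * ln (k - 3 / 2) - 2 * ln (k - 1 / 2) - (k + 1) * ln (k + 1)"
proof (rule nonneg_if_decreasing_to_zero[where a=3 and
      f="\<lambda>k. 2 + (k + 3) * ln (k - 1) + 2 * ln k - 2 * ln (k - 3 / 2) - 2 * ln (k - 1 / 2) - (k + 1) * ln (k + 1)" and
      f'="\<lambda>k. ln (k - 1) - ln (k + 1) + 4 / (k - 1) + 2 / k - 2 / (k - 3 / 2) - 2 / (k - 1 / 2)", OF _ _ _ assms])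
  fix x :: real assume x: "x \<ge> 3"
  have "(x + 3) / (x - 1) = 1 + 4 / (x - 1)" using x by (simp add: field_simps)
  then show "((\<lambda>k. 2 + (k + 3) * ln (k - 1) + 2 * ln k - 2 * ln (k - 3 / 2) - 2 * ln (k - 1 / 2) - (k + 1) * ln (k + 1)) has_real_derivative
      ln (x - 1) - ln (x + 1) + 4 / (x - 1) + 2 / x - 2 / (x - 3 / 2) - 2 / (x - 1 / 2)) (at x)"
    using x by (auto intro!: derivative_eq_intros)
  have "2 / (x - 3 / 2) + 2 / (x - 1 / 2) - 4 / (x - 1) = 1 / ((x - 3 / 2) * (x - 1 / 2) * (x - 1))"
    using x by (simp add: divide_simps) (simp add: algebra_simps)
  also have "\<dots> \<ge> 0" using x by simp
  finally have "4 / (x - 1) \<le> 2 / (x - 3 / 2) + 2 / (x - 1 / 2)" by simp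
  then show "ln (x - 1) - ln (x + 1) + 4 / (x - 1) + 2 / x - 2 / (x - 3 / 2) - 2 / (x - 1 / 2) \<le> 0"
    using ln_ratio_ge[of x] x by simp
next
  show "((\<lambda>k::real. 2 + (k + 3) * ln (k - 1) + 2 * ln k - 2 * ln (k - 3 / 2) - 2 * ln (k - 1 / 2) - (k + 1) * ln (k + 1)) \<longlongrightarrow> 0) at_top"
    by real_asymp
qed

lemma Gamma_half_pos: "Gamma (real n / 2 + 1) > 0" "Gamma (real n / 2 + 1 / 2) > 0"
  by (auto intro!: Gamma_real_pos add_nonneg_pos)

lemma delta_pos: "delta n > 0"
  unfolding delta_def using Gamma_half_pos[of n] by (intro divide_pos_pos mult_pos_pos zero_less_power) auto

lemma Gamma_plus1_pos: "x > 0 \<Longrightarrow> Gamma (x + 1) = x * Gamma (x :: real)"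
  by (rule Gamma_plus1) (auto elim!: nonpos_Ints_cases)

text \<open>Two steps at a time the Gamma factors have a rational quotient.\<close>
lemma delta_two_step: assumes "n \<ge> 1" shows "delta n \<le> delta (n + 2)"
proof -
  define k where "k = real n + 2"
  have k: "k \<ge> 3" using assms by (simp add: k_def)
  \<comment> \<open>Collects the quotients k (k - 1) of n!, 16 k (k - 1/2) (k - 1) (k - 3/2) of
    (2n)! and k/2 of the Gamma factor; the powers of 2 cancel against 8^2.\<close>
  define q where "q = exp 1 ^ 2 * (k - 1) ^ 4 * k ^ 2 * (k - 1) ^ (n + 1) / ((k - 3 / 2) ^ 2 * (k - 1 / 2) ^ 2 * (k + 1) ^ (n + 3))"
  have "delta (n + 2) = delta n * q"
  proof -
    let ?G = "Gamma (real n / 2 + 1)"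
    have G: "Gamma (real (n + 2) / 2 + 1) = (k / 2) * ?G"
      using Gamma_plus1_pos[of "real n / 2 + 1"] by (simp add: k_def add_divide_distrib add.commute)
    have F: "fact (n + 2) = k * (k - 1) * (fact n :: real)" by (simp add: k_def algebra_simps)
    have "2 * (n + 2) = Suc (Suc (Suc (Suc (2 * n))))" by simp
    then have F2: "fact (2 * (n + 2)) = (2 * k) * (2 * (k - 1 / 2)) * (2 * (k - 1)) * (2 * (k - 3 / 2)) * (fact (2 * n) :: real)"
      by (simp only: fact_Suc) (simp add: k_def algebra_simps)
    have S: "real (n + 2) + 1 = k + 1" "real n + 1 = k - 1" by (simp_all add: k_def)
    have nz: "fact (2 * n) \<noteq> (0::real)" "k - 1 \<noteq> 0" "k \<noteq> 0" "k - 1 / 2 \<noteq> 0" "k - 3 / 2 \<noteq> 0" "k + 1 \<noteq> 0"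
      using k by auto
    have nzG: "?G \<noteq> 0" using Gamma_half_pos(1)[of n] by (metis less_irrefl)
    have e: "(8::real) ^ (n + 2) = 64 * 8 ^ n" "exp 1 ^ (n + 2) = exp 1 ^ 2 * exp (1::real) ^ n" "n + 2 + 1 = n + 3"
      by (simp_all add: power_add power2_eq_square)
    obtain G' a b c d e' g where gen: "G' = ?G" "a = (fact n :: real)" "b = (fact (2 * n) :: real)" "c = k - 1 / 2" "d = k - 3 / 2" 
      "e' = (k - 1) ^ (n + 1)" "g = (k + 1) ^ (n + 3)" by blast
    define h where "h = k - 1"
    have nz': "G' \<noteq> 0" "b \<noteq> 0" "h \<noteq> 0" "k \<noteq> 0" "c \<noteq> 0" "d \<noteq> 0" "e' \<noteq> 0" "g \<noteq> 0"
      unfolding gen h_def using nz by (simp_all only: nzG power_not_zero not_False_eq_True simp_thms)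
    show ?thesis
      unfolding delta_def q_def G F F2 S e gen(1-7)[symmetric] h_def[symmetric]
      using nz' by (simp add: divide_simps power_mult_distrib power2_eq_square power4_eq_xxxx) (simp add: algebra_simps eval_nat_numeral)
  qed
  moreover have "q \<ge> 1"
  proof -
    have "ln q = 2 + (k + 3) * ln (k - 1) + 2 * ln k - 2 * ln (k - 3 / 2) - 2 * ln (k - 1 / 2) - (k + 1) * ln (k + 1)"
      using k unfolding q_def by (simp add: ln_div ln_mult ln_realpow k_def[symmetric]) (simp add: k_def algebra_simps)
    then have "ln q \<ge> 0" using two_step_log_nonneg[OF k] by simp
    moreover have "q > 0" using k unfolding q_def by (intro divide_pos_pos mult_pos_pos zero_less_power) auto
    ultimately show ?thesis by (simp add: ln_ge_zero_iff)
  qed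
  ultimately show ?thesis using delta_pos[of n] by simp
qed

text \<open>The case of equality in the lower bound, and the start of the chain of odd n.\<close>

lemma delta_1: "delta 1 = 2 * exp 1 / pi"
proof -
  have "Gamma (3 / 2 :: real) = sqrt pi / 2"
    using Gamma_plus1_pos[of "1/2"] by (simp add: Gamma_one_half_real)
  moreover have "delta 1 = exp 1 / (2 * (Gamma (3 / 2))\<^sup>2)"
    by (simp add: delta_def power_divide fact_numeral)
  ultimately show ?thesis by (simp only: power_divide) simp
qed

text \<open>The start of the chain of even n. As pi > 3, it suffices that e \<ge> 81/32; the
  estimate e \<ge> 13/5 comes from squaring a Taylor bound for exp (1/2).\<close>

lemma delta_2: "delta 2 \<ge> 2 * exp 1 / pi"
proof -
  have "Gamma (2 :: real) = 1" using Gamma_fact[of 1, where 'a=real] by simp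
  then have "delta 2 = 64 * 64 * exp 1 ^ 2 / (576 * 27)"
    by (simp add: delta_def fact_numeral)
  moreover have "2 * exp 1 / pi \<le> 2 * exp 1 / 3"
    using pi_gt3 by (intro divide_left_mono) auto
  moreover have "exp (1::real) * (13 / 5) \<le> exp 1 * exp 1"
  proof (rule mult_left_mono)
    have "1 + 1 / 2 + (1 / 2)\<^sup>2 / 2 \<le> exp (1 / 2 :: real)" by (rule exp_lower_Taylor_quadratic) simp
    then have "(1 + 1 / 2 + (1 / 2)\<^sup>2 / 2)\<^sup>2 \<le> (exp (1 / 2 :: real))\<^sup>2" by (rule power_mono) simp
    also have "(exp (1 / 2 :: real))\<^sup>2 = exp 1" by (simp add: exp_double[symmetric])
    finally show "13 / 5 \<le> exp (1::real)" by (simp add: power2_eq_square)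
  qed simp
  moreover have "0 < exp (1::real)" by simp
  ultimately show ?thesis unfolding power2_eq_square by linarith
qed

theorem delta_ge: "n \<ge> 1 \<Longrightarrow> delta n \<ge> 2 * exp 1 / pi"
proof (induction n rule: less_induct)
  case (less n)
  consider "n = 1" | "n = 2" | "n \<ge> 3" using less.prems by linarith
  then show ?case
  proof cases
    case 3
    then obtain m where m: "n = m + 2" "m \<ge> 1" using that[of "n - 2"] by simp
    have "delta m \<le> delta (m + 2)" using m by (intro delta_two_step)
    moreover have "delta m \<ge> 2 * exp 1 / pi" using m by (intro less.IH) auto
    ultimately show ?thesis unfolding m(1) by linarith
  qed (auto simp: delta_1[simplified] delta_2)
qed

section \<open>Stirling's formula from Wallis' product\<close>

definition stirling_seq :: "nat \<Rightarrow> real" where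
  "stirling_seq n = fact n * exp 1 ^ n / (real n ^ n * sqrt (real n))"

lemma stirling_seq_pos: "n > 0 \<Longrightarrow> stirling_seq n > 0"
  by (simp add: stirling_seq_def)

text \<open>Successive logarithms differ by -\<open>d n\<close>, which is of order 1/n^2, so they
  converge; exponentiating makes the limit positive.\<close>

lemma stirling_seq_convergent: obtains L where "L > 0" "stirling_seq \<longlonglongrightarrow> L"
proof -
  define d where "d n = (real (Suc n) + 1 / 2) * ln (real (Suc (Suc n)) / real (Suc n)) - 1" for n
  have "d \<in> O(\<lambda>n. 1 / real (Suc n) ^ 2)" unfolding d_def by real_asymp
  moreover have "summable (\<lambda>n. 1 / real (Suc n) ^ 2)"
    using inverse_power_summable[of 2, where 'a=real] by (subst summable_Suc_iff) (simp add: inverse_eq_divide)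
  ultimately have "summable d"
    by (intro summable_comparison_test_bigo[of "\<lambda>n. 1 / real (Suc n) ^ 2" d]) auto
  then have "convergent (\<lambda>n. \<Sum>k<n. d k)" by (simp add: summable_iff_convergent)
  then obtain S where S: "(\<lambda>n. \<Sum>k<n. d k) \<longlonglongrightarrow> S" by (auto simp: convergent_def)
  have step: "ln (stirling_seq (Suc (Suc n))) = ln (stirling_seq (Suc n)) - d n" for n
  proof -
    have l: "ln (stirling_seq (Suc m)) = ln (fact (Suc m)) + real (Suc m) - (real (Suc m) + 1 / 2) * ln (real (Suc m))" for m
      unfolding stirling_seq_def by (simp add: ln_div ln_mult ln_realpow ln_sqrt algebra_simps del: fact_Suc of_nat_Suc power_Suc)
    have f: "ln (fact (Suc (Suc n)) :: real) = ln (real (Suc (Suc n))) + ln (fact (Suc n))"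
      by (subst fact_Suc) (simp add: ln_mult del: fact_Suc of_nat_Suc)
    have r: "ln (real (Suc (Suc n)) / real (Suc n)) = ln (real (Suc (Suc n))) - ln (real (Suc n))"
      by (simp add: ln_div del: of_nat_Suc)
    show ?thesis unfolding l f d_def r by (simp add: algebra_simps)
  qed
  have "ln (stirling_seq (Suc n)) = 1 - (\<Sum>k<n. d k)" for n
  proof (induction n)
    case 0
    then show ?case by (simp add: stirling_seq_def)
  next
    case (Suc n)
    then show ?case by (simp add: step)
  qed
  then have "(\<lambda>n. ln (stirling_seq (Suc n))) \<longlonglongrightarrow> 1 - S" using S by (auto intro!: tendsto_intros)
  then have "(\<lambda>n. exp (ln (stirling_seq (Suc n)))) \<longlonglongrightarrow> exp (1 - S)" by (rule tendsto_exp)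
  then have "(\<lambda>n. stirling_seq (Suc n)) \<longlonglongrightarrow> exp (1 - S)" by (simp add: stirling_seq_pos)
  then have "stirling_seq \<longlonglongrightarrow> exp (1 - S)" by (rule LIMSEQ_imp_Suc)
  then show ?thesis using that[of "exp (1 - S)"] by simp
qed

text \<open>The partial product of Wallis' formula has this closed form, by induction.\<close>

lemma wallis_fact: "(\<lambda>n. (4 ^ n * (fact n)\<^sup>2 / fact (2 * n))\<^sup>2 / (2 * real n + 1)) \<longlonglongrightarrow> pi / 2"
proof -
  have "(\<Prod>k=1..n. (4*real k^2) / (4*real k^2 - 1)) = (4 ^ n * (fact n)\<^sup>2 / fact (2 * n))\<^sup>2 / (2 * real n + 1)" for n
  proof (induction n)
    case (Suc n)
    define a where "a = (fact n :: real)"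
    define b where "b = (fact (2 * n) :: real)"
    define c where "c = (4 :: real) ^ n"
    define x where "x = real n"
    have b: "b > 0" by (simp add: b_def)
    have x: "x \<ge> 0" by (simp add: x_def)
    have "2 * Suc n = Suc (Suc (2 * n))" by simp
    then have F: "fact (2 * Suc n) = (2 * x + 2) * (2 * x + 1) * b" by (simp only: fact_Suc) (simp add: b_def x_def algebra_simps)
    have F1: "fact (Suc n) = (x + 1) * a" by (simp add: a_def x_def)
    have d: "4 * (x + 1)\<^sup>2 - 1 = (2 * x + 1) * (2 * x + 3)" by (simp add: power2_eq_square algebra_simps)
    have "(\<Prod>k=1..Suc n. (4*real k^2) / (4*real k^2 - 1)) = (c * a\<^sup>2 / b)\<^sup>2 / (2 * x + 1) * (4 * (x + 1)\<^sup>2 / (4 * (x + 1)\<^sup>2 - 1))"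
      using Suc.IH by (simp add: a_def b_def c_def x_def add.commute)
    also have "\<dots> = (4 * c * ((x + 1) * a)\<^sup>2 / ((2 * x + 2) * (2 * x + 1) * b))\<^sup>2 / (2 * x + 3)"
    proof -
      have "2 * x + 2 = 2 * (x + 1)" by simp
      then have "4 * c * ((x + 1) * a)\<^sup>2 / ((2 * x + 2) * (2 * x + 1) * b) = (c * a\<^sup>2 / b) * (2 * (x + 1) / (2 * x + 1))"
        using x b by (simp add: power2_eq_square divide_simps) (simp add: algebra_simps)
      then have e: "(4 * c * ((x + 1) * a)\<^sup>2 / ((2 * x + 2) * (2 * x + 1) * b))\<^sup>2 = (c * a\<^sup>2 / b)\<^sup>2 * (2 * (x + 1) / (2 * x + 1))\<^sup>2"
        by (simp only: power_mult_distrib)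
      have gen: "K / u * (4 * s\<^sup>2 / (u * v)) = K * (2 * s / u)\<^sup>2 / v" for K u s v :: real
        by (simp add: power2_eq_square)
      show ?thesis unfolding e d by (rule gen)
    qed
    finally show ?case unfolding F F1 by (simp add: c_def x_def add.commute)
  qed simp
  then show ?thesis using wallis by simp
qed

text \<open>For a = \<open>stirling_seq\<close>, the powers of n^n and e in a(n)^2 / a(2n) cancel,
  leaving 4^n (n!)^2 / (2n)! times sqrt (2/n). Since a(n) and a(2n) have the same limit L, Wallis'
  product gives L^2 / 4 = pi / 2.\<close>

theorem stirling_limit: "stirling_seq \<longlonglongrightarrow> sqrt (2 * pi)"
proof -
  obtain L where L: "L > 0" "stirling_seq \<longlonglongrightarrow> L" using stirling_seq_convergent by blast
  have L2: "(\<lambda>n. stirling_seq (2 * n)) \<longlonglongrightarrow> L"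
    using LIMSEQ_subseq_LIMSEQ[OF L(2), of "\<lambda>n. 2 * n"] by (simp add: strict_mono_def comp_def)
  have "\<forall>\<^sub>F n in sequentially. ((stirling_seq n)\<^sup>2 / stirling_seq (2 * n))\<^sup>2 * (real n / (2 * (2 * real n + 1)))
     = (4 ^ n * (fact n)\<^sup>2 / fact (2 * n))\<^sup>2 / (2 * real n + 1)"
    using eventually_gt_at_top[of 0]
  proof eventually_elim
    case (elim n)
    define x where "x = real n"
    define p where "p = x ^ n"
    define E where "E = exp (1::real) ^ n"
    define c where "c = (4::real) ^ n"
    define y where "y = sqrt x"
    define w where "w = sqrt (2::real)"
    define F where "F = (fact n :: real)"
    define H where "H = (fact (2 * n) :: real)"
    have pos: "x > 0" "p > 0" "E > 0" "c > 0" "y > 0" "w > 0" "F > 0" "H > 0"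
      using elim by (auto simp: x_def p_def E_def c_def y_def w_def F_def H_def)
    have sq: "y\<^sup>2 = x" "w\<^sup>2 = 2" using pos by (auto simp: y_def w_def)
    have s1: "stirling_seq n = F * E / (p * y)" by (simp add: stirling_seq_def x_def p_def E_def F_def y_def)
    have "(real (2 * n)) ^ (2 * n) = c * p\<^sup>2"
      by (simp add: c_def p_def x_def power_mult power_mult_distrib power2_eq_square)
    moreover have "exp (1::real) ^ (2 * n) = E\<^sup>2" by (simp add: E_def power_mult[symmetric] mult.commute)
    moreover have "sqrt (real (2 * n)) = w * y" by (simp add: w_def y_def x_def real_sqrt_mult)
    ultimately have s2: "stirling_seq (2 * n) = H * E\<^sup>2 / (c * p\<^sup>2 * (w * y))"
      unfolding stirling_seq_def H_def by (simp only:)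
    have "(stirling_seq n)\<^sup>2 / stirling_seq (2 * n) = (c * F\<^sup>2 / H) * (w / y)"
      unfolding s1 s2 using pos by (simp add: field_simps power2_eq_square)
    then have R: "((stirling_seq n)\<^sup>2 / stirling_seq (2 * n))\<^sup>2 = (c * F\<^sup>2 / H)\<^sup>2 * (2 / x)"
      by (simp only: power_mult_distrib power_divide sq)
    have "K * (2 / x) * (x / (2 * (2 * x + 1))) = K / (2 * x + 1)" for K
      using pos(1) by (simp add: field_simps)
    then show ?case unfolding R x_def[symmetric] c_def[symmetric] F_def[symmetric] H_def[symmetric] .
  qed
  moreover have "(\<lambda>n. ((stirling_seq n)\<^sup>2 / stirling_seq (2 * n))\<^sup>2 * (real n / (2 * (2 * real n + 1)))) \<longlonglongrightarrow> (L\<^sup>2 / L)\<^sup>2 * (1 / 4)"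
  proof (rule tendsto_mult)
    show "(\<lambda>n. real n / (2 * (2 * real n + 1))) \<longlonglongrightarrow> 1 / 4" by real_asymp
    show "(\<lambda>n. ((stirling_seq n)\<^sup>2 / stirling_seq (2 * n))\<^sup>2) \<longlonglongrightarrow> (L\<^sup>2 / L)\<^sup>2"
      using L by (intro tendsto_power tendsto_divide L2) auto
  qed
  ultimately have "(\<lambda>n. (4 ^ n * (fact n)\<^sup>2 / fact (2 * n))\<^sup>2 / (2 * real n + 1)) \<longlonglongrightarrow> (L\<^sup>2 / L)\<^sup>2 * (1 / 4)"
    by (rule Lim_transform_eventually[rotated])
  then have "(L\<^sup>2 / L)\<^sup>2 * (1 / 4) = pi / 2" using wallis_fact LIMSEQ_unique by blast
  then have "L\<^sup>2 = 2 * pi" using L(1) by (simp add: power2_eq_square)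
  then have "L = sqrt (2 * pi)" using L(1) by (metis real_sqrt_unique less_imp_le)
  with L(2) show ?thesis by simp
qed

section \<open>Gamma at half-integers\<close>

definition half_ratio :: "nat \<Rightarrow> real" where
  "half_ratio n = Gamma (real n / 2 + 1) / Gamma (real n / 2 + 1 / 2)"

text \<open>Legendre's duplication formula at these arguments. Raising n by one exchanges the two
  Gamma values up to the factor (n + 1) / 2, so induction suffices.\<close>

lemma Gamma_half_prod: "Gamma (real n / 2 + 1) * Gamma (real n / 2 + 1 / 2) = fact n * sqrt pi / 2 ^ n"
proof (induction n)
  case 0
  then show ?case by (simp add: Gamma_one_half_real)
next
  case (Suc n)
  have "Gamma (real (Suc n) / 2 + 1) = (real n / 2 + 1 / 2) * Gamma (real n / 2 + 1 / 2)"
    using Gamma_plus1_pos[of "real n / 2 + 1 / 2"] by (simp add: add_divide_distrib add.commute)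
  moreover have "real (Suc n) / 2 + 1 / 2 = real n / 2 + 1" by (simp add: field_simps)
  ultimately have "Gamma (real (Suc n) / 2 + 1) * Gamma (real (Suc n) / 2 + 1 / 2)
     = (real n / 2 + 1 / 2) * (Gamma (real n / 2 + 1) * Gamma (real n / 2 + 1 / 2))"
    by (simp only: mult_ac)
  then show ?case unfolding Suc.IH by (simp add: field_simps)
qed

lemma half_ratio_pos: "half_ratio n > 0"
  unfolding half_ratio_def by (intro divide_pos_pos Gamma_half_pos)

lemma half_ratio_prod: "half_ratio (Suc n) * half_ratio n = (real n + 1) / 2"
proof -
  have "Gamma (real (Suc n) / 2 + 1) = (real n / 2 + 1 / 2) * Gamma (real n / 2 + 1 / 2)"
    using Gamma_plus1_pos[of "real n / 2 + 1 / 2"] by (simp add: add_divide_distrib add.commute)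
  moreover have "real (Suc n) / 2 + 1 / 2 = real n / 2 + 1" by (simp add: field_simps)
  ultimately have "half_ratio (Suc n) = (real n / 2 + 1 / 2) * Gamma (real n / 2 + 1 / 2) / Gamma (real n / 2 + 1)"
    unfolding half_ratio_def by (simp only:)
  moreover have "c * b / a * (a / b) = c" if "a > 0" "b > 0" for a b c :: real using that by simp
  ultimately show ?thesis using Gamma_half_pos[of n] unfolding half_ratio_def[of n]
    by (simp only: add_divide_distrib)
qed

text \<open>n/2 + 1 is the midpoint of n/2 + 1/2 and n/2 + 3/2, and log Gamma is convex.\<close>

lemma half_ratio_mono: "half_ratio n \<le> half_ratio (Suc n)"
proof -
  let ?x = "real n / 2 + 1 / 2" and ?y = "real n / 2 + 3 / 2"
  have pos: "?x > 0" "?y > 0" by (simp_all add: add_nonneg_pos)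
  have "(ln \<circ> Gamma) ((1 - 1 / 2) *\<^sub>R ?x + (1 / 2) *\<^sub>R ?y) \<le> (1 - 1 / 2) * (ln \<circ> Gamma) ?x + 1 / 2 * (ln \<circ> Gamma) ?y"
    by (rule convex_onD[OF log_convex_Gamma_real]) (use pos in auto)
  moreover have "(1 - 1 / 2) *\<^sub>R ?x + (1 / 2) *\<^sub>R ?y = real n / 2 + 1" by (simp add: field_simps)
  ultimately have c: "2 * ln (Gamma (real n / 2 + 1)) \<le> ln (Gamma ?x) + ln (Gamma ?y)" by simp
  have y: "real (Suc n) / 2 + 1 = ?y" "real (Suc n) / 2 + 1 / 2 = real n / 2 + 1" by (simp_all add: field_simps)
  have gp: "Gamma ?x > 0" "Gamma ?y > 0" "Gamma (real n / 2 + 1) > 0"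
    using pos Gamma_half_pos(1)[of n] by (auto intro: Gamma_real_pos)
  have "ln (half_ratio n) \<le> ln (half_ratio (Suc n))"
  proof -
    have l: "ln (a / b) = ln a - ln b" if "a > 0" "b > 0" for a b :: real using that by (simp add: ln_div)
    show ?thesis unfolding half_ratio_def y l[OF gp(3,1)] l[OF gp(2,3)] using c by linarith
  qed
  then show ?thesis using half_ratio_pos by simp
qed

text \<open>Consecutive values multiply to (n + 1) / 2, so monotonicity squeezes the square of
  \<open>half_ratio n\<close> between n/2 and (n + 1) / 2. The ratio times
  \<open>Gamma_half_prod\<close> is Gamma(n/2 + 1)^2, as it occurs in \<open>delta\<close>.\<close>

lemma half_ratio_limit: "(\<lambda>n. half_ratio n / sqrt (real n / 2)) \<longlonglongrightarrow> 1"
proof -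
  have ub: "half_ratio n \<le> sqrt ((real n + 1) / 2)" for n
  proof (rule real_le_rsqrt)
    have "(half_ratio n)\<^sup>2 \<le> half_ratio (Suc n) * half_ratio n"
      unfolding power2_eq_square using half_ratio_mono[of n] half_ratio_pos[of n] by (intro mult_right_mono) auto
    then show "(half_ratio n)\<^sup>2 \<le> (real n + 1) / 2" unfolding half_ratio_prod .
  qed
  have lb: "sqrt (real n / 2) \<le> half_ratio n" if n: "n > 0" for n
  proof -
    obtain m where m: "n = Suc m" using gr0_implies_Suc[OF n] by blast
    have "half_ratio n * half_ratio m \<le> half_ratio n * half_ratio n"
      unfolding m using half_ratio_mono[of m] half_ratio_pos[of "Suc m"] by (intro mult_left_mono) auto
    then have "real n / 2 \<le> (half_ratio n)\<^sup>2" unfolding m half_ratio_prod by (simp add: power2_eq_square)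
    then show ?thesis using half_ratio_pos[of n] by (intro real_le_lsqrt) auto
  qed
  show ?thesis
  proof (rule tendsto_sandwich[of "\<lambda>_. 1" _ _ "\<lambda>n. sqrt ((real n + 1) / 2) / sqrt (real n / 2)"])
    show "\<forall>\<^sub>F n in sequentially. 1 \<le> half_ratio n / sqrt (real n / 2)"
      using eventually_gt_at_top[of 0] by eventually_elim (use lb in \<open>simp add: le_divide_eq\<close>)
    show "\<forall>\<^sub>F n in sequentially. half_ratio n / sqrt (real n / 2) \<le> sqrt ((real n + 1) / 2) / sqrt (real n / 2)"
      by (intro always_eventually allI divide_right_mono ub) simp
    show "(\<lambda>n. sqrt ((real n + 1) / 2) / sqrt (real n / 2)) \<longlonglongrightarrow> 1" by real_asymp
  qed simp
qed

text \<open>Of the six factors n!, four join ((2n)!)^2 in Wallis' product, one cancels against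
  Gamma(n/2 + 1)^2, which is \<open>half_ratio n\<close> times n! sqrt pi / 2^n, and one is left to
  Stirling. The remaining factor tends to 2 sqrt 2 / (e sqrt pi), where (n / (n + 1))^n contributes
  1/e.\<close>

theorem delta_limit: "delta \<longlonglongrightarrow> 2 * pi / exp 1"
proof -
  let ?W = "\<lambda>n. (4 ^ n * (fact n)\<^sup>2 / fact (2 * n))\<^sup>2 / (2 * real n + 1)"
  let ?Z = "\<lambda>n. sqrt 2 * (2 * real n + 1) / (sqrt pi * (real n + 1)) * (real n / (real n + 1)) ^ n"
  have ev: "\<forall>\<^sub>F n in sequentially. stirling_seq n * ?W n / (half_ratio n / sqrt (real n / 2)) * ?Z n = delta n"
    using eventually_gt_at_top[of 0]
  proof eventually_elim
    case (elim n)
    define x where "x = real n"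
    define F where "F = (fact n :: real)"
    define H where "H = (fact (2 * n) :: real)"
    define E where "E = exp (1::real) ^ n"
    define p where "p = x ^ n"
    define q where "q = (x + 1) ^ n"
    define t where "t = (2::real) ^ n"
    define r where "r = half_ratio n"
    define y where "y = sqrt x"
    define z where "z = sqrt pi"
    define w where "w = sqrt (2::real)"
    have pos: "x > 0" "F > 0" "H > 0" "E > 0" "p > 0" "q > 0" "t > 0" "r > 0" "y > 0" "z > 0" "w > 0"
      using elim half_ratio_pos[of n] by (auto simp: x_def F_def H_def E_def p_def q_def t_def r_def y_def z_def w_def)
    have x1: "x + 1 > 0" "2 * x + 1 > 0" using pos by auto
    have ww: "w * w = 2" by (simp add: w_def)
    have "Gamma (real n / 2 + 1) ^ 2 = r * (Gamma (real n / 2 + 1) * Gamma (real n / 2 + 1 / 2))"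
    proof -
      have sq: "a\<^sup>2 = a / b * (a * b)" if "a > 0" "b > 0" for a b :: real using that by (simp add: power2_eq_square)
      show ?thesis unfolding r_def half_ratio_def by (rule sq[OF Gamma_half_pos])
    qed
    then have G: "Gamma (real n / 2 + 1) ^ 2 = r * (F * z / t)" unfolding Gamma_half_prod by (simp add: F_def z_def t_def)
    have p8: "(8::real) ^ n = t * t * t" "(4::real) ^ n = t * t" by (simp_all add: t_def power_mult_distrib[symmetric])
    have sq: "sqrt (real n / 2) = y / w" by (simp add: y_def w_def x_def real_sqrt_divide)
    have del: "delta n = t * t * t * F ^ 6 * E / (H ^ 2 * (r * (F * z / t)) * (q * (x + 1)))"
      unfolding delta_def G p8 by (simp add: F_def E_def H_def q_def x_def mult.commute)
    have st: "stirling_seq n = F * E / (p * y)" by (simp add: stirling_seq_def F_def E_def p_def y_def x_def)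
    have "stirling_seq n * ?W n / (half_ratio n / sqrt (real n / 2)) * ?Z n
      = (F * E / (p * y)) * ((t * t * F\<^sup>2 / H)\<^sup>2 / (2 * x + 1)) / (r / (y / w)) * (w * (2 * x + 1) / (z * (x + 1)) * (p / q))"
      unfolding st sq p8 by (simp only: F_def H_def x_def r_def w_def z_def p_def q_def power_divide)
    also have "\<dots> = delta n"
    proof -
      define u v where "u = 2 * x + 1" and "v = x + 1"
      have "u > 0" "v > 0" using x1 by (auto simp: u_def v_def)
      then show ?thesis unfolding del u_def[symmetric] v_def[symmetric] using pos
        by (simp add: divide_simps power2_eq_square) (simp add: algebra_simps eval_nat_numeral)
    qed
    finally show ?case .
  qed
  have lim: "(\<lambda>n. stirling_seq n * ?W n / (half_ratio n / sqrt (real n / 2)) * ?Z n) \<longlonglongrightarrow> sqrt (2 * pi) * (pi / 2) / 1 * (sqrt 2 * 2 / (sqrt pi * exp 1))"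
  proof (rule tendsto_mult[OF tendsto_divide[OF tendsto_mult[OF stirling_limit wallis_fact] half_ratio_limit]])
    have "(\<lambda>n. (2 * real n + 1) / (real n + 1)) \<longlonglongrightarrow> 2" by real_asymp
    moreover have "(\<lambda>n. (real n / (real n + 1)) ^ n) \<longlonglongrightarrow> exp (- 1)" by real_asymp
    ultimately have "(\<lambda>n. sqrt 2 / sqrt pi * ((2 * real n + 1) / (real n + 1)) * (real n / (real n + 1)) ^ n) \<longlonglongrightarrow> sqrt 2 / sqrt pi * 2 * exp (- 1)"
      by (intro tendsto_mult tendsto_const)
    then show "?Z \<longlonglongrightarrow> sqrt 2 * 2 / (sqrt pi * exp 1)" by (simp add: exp_minus divide_inverse mult_ac)
  qed simp
  have "sqrt (2 * pi) * (pi / 2) / 1 * (sqrt 2 * 2 / (sqrt pi * exp 1)) = 2 * pi / exp 1"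
    by (simp add: real_sqrt_mult)
  then show ?thesis using Lim_transform_eventually[OF lim ev] by (simp only:)
qed

section \<open>Arbitrary index types\<close>

text \<open>The change of variables theorems need a well-ordered index type; this is one of the same size as \<open>'a\<close>.\<close>
typedef (overloaded) 'a idx = "{..<CARD('a::finite)}"
  by (intro exI[of _ 0]) simp

instantiation idx :: (finite) wellorder
begin

definition less_eq_idx :: "'a idx \<Rightarrow> 'a idx \<Rightarrow> bool" where "less_eq_idx x y \<longleftrightarrow> Rep_idx x \<le> Rep_idx y"
definition less_idx :: "'a idx \<Rightarrow> 'a idx \<Rightarrow> bool" where "less_idx x y \<longleftrightarrow> Rep_idx x < Rep_idx y"

instance
proof
  fix P :: "'a idx \<Rightarrow> bool" and a
  assume step: "\<And>x. (\<And>y. y < x \<Longrightarrow> P y) \<Longrightarrow> P x"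
  show "P a"
    by (induction a rule: measure_induct_rule[where f=Rep_idx]) (rule step, simp add: less_idx_def)
qed (auto simp: less_eq_idx_def less_idx_def Rep_idx_inject)

end

instance idx :: (finite) finite
proof
  show "finite (UNIV :: 'a idx set)"
    unfolding type_definition.univ[OF type_definition_idx] by simp
qed

lemma card_idx: "CARD('a::finite idx) = CARD('a)"
  by (simp add: type_definition.card[OF type_definition_idx])

lemma prod_Basis_cart: "(\<Prod>b\<in>Basis. x \<bullet> b) = (\<Prod>i\<in>UNIV. x $ i)" for x :: "real^'k"
proof -
  have B: "(Basis :: (real^'k) set) = range (\<lambda>i. axis i 1)" by (auto simp: Basis_vec_def)
  have inj: "inj (\<lambda>i. axis i 1 :: real^'k)" by (auto simp: inj_def axis_eq_axis)
  show ?thesis unfolding B by (simp add: prod.reindex[OF inj] inner_axis)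
qed

text \<open>Relabelling coordinates is a linear isometry and so preserves volumes, polarity,
  centroids and simplices. This carries the results over to arbitrary finite index types.\<close>

locale reindexing =
  fixes \<rho> :: "'m::finite \<Rightarrow> 'n::finite"
  assumes bij: "bij \<rho>"
begin

definition R :: "real^'n \<Rightarrow> real^'m" where "R x = (\<chi> i. x $ \<rho> i)"
definition R' :: "real^'m \<Rightarrow> real^'n" where "R' y = (\<chi> j. y $ inv \<rho> j)"

lemma R'_R [simp]: "R' (R x) = x"
  using bij by (simp add: R_def R'_def vec_eq_iff bij_is_surj surj_f_inv_f)

lemma R_R' [simp]: "R (R' y) = y"
  using bij by (simp add: R_def R'_def vec_eq_iff bij_is_inj inv_f_f)

lemma linear_R: "linear R" by (rule linearI) (simp_all add: R_def vec_eq_iff)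
lemma linear_R': "linear R'" by (rule linearI) (simp_all add: R'_def vec_eq_iff)

lemma R_zero [simp]: "R 0 = 0" using linear_0[OF linear_R] .

lemma inj_R: "inj R" by (rule inj_on_inverseI[of _ R']) simp

lemma R_image: "R ` S = R' -` S"
  by (force simp: image_iff)

lemma inner_R: "R x \<bullet> R y = x \<bullet> y"
  unfolding inner_vec_def R_def using sum.reindex_bij_betw[OF bij, of "\<lambda>i. x $ i \<bullet> y $ i"] by simp

lemma continuous_R: "continuous_on S R" using linear_R by (simp add: linear_continuous_on linear_conv_bounded_linear)
lemma continuous_R': "continuous_on S R'" using linear_R' by (simp add: linear_continuous_on linear_conv_bounded_linear)

lemma measurable_R [measurable]: "R \<in> borel \<rightarrow>\<^sub>M borel" by (rule borel_measurable_continuous_onI[OF continuous_R])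
lemma measurable_R' [measurable]: "R' \<in> borel \<rightarrow>\<^sub>M borel" by (rule borel_measurable_continuous_onI[OF continuous_R'])

lemma distr_lborel_R: "distr lborel lborel R = lborel"
proof (rule lborel_eqI[symmetric])
  fix l u :: "real^'m"
  assume le: "\<And>b. b \<in> Basis \<Longrightarrow> l \<bullet> b \<le> u \<bullet> b"
  then have le': "l $ i \<le> u $ i" for i using le[of "axis i 1"] by (auto simp: inner_axis Basis_vec_def)
  have box: "R -` box l u = box (R' l) (R' u)"
  proof (rule set_eqI)
    fix x
    have "(\<forall>i. l $ i < x $ \<rho> i \<and> x $ \<rho> i < u $ i) \<longleftrightarrow> (\<forall>j. l $ inv \<rho> j < x $ j \<and> x $ j < u $ inv \<rho> j)"
      using bij by (metis bij_inv_eq_iff)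
    then show "x \<in> R -` box l u \<longleftrightarrow> x \<in> box (R' l) (R' u)"
      by (simp add: R_def R'_def mem_box_cart)
  qed
  have "emeasure (distr lborel lborel R) (box l u) = emeasure lborel (box (R' l) (R' u))"
    by (subst emeasure_distr) (auto simp: box)
  also have "\<dots> = ennreal (\<Prod>b\<in>Basis. (R' u - R' l) \<bullet> b)"
  proof (rule emeasure_lborel_box)
    fix b :: "real^'n" assume "b \<in> Basis"
    then obtain i where "b = axis i 1" by (auto simp: Basis_vec_def)
    then show "R' l \<bullet> b \<le> R' u \<bullet> b" using le' by (simp add: R'_def inner_axis)
  qed
  also have "(\<Prod>b\<in>Basis. (R' u - R' l) \<bullet> b) = (\<Prod>j\<in>UNIV. (u - l) $ inv \<rho> j)"
    unfolding prod_Basis_cart by (simp add: R'_def)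
  also have "\<dots> = (\<Prod>i\<in>UNIV. (u - l) $ i)"
    using bij by (intro prod.reindex_bij_betw bij_imp_bij_inv)
  also have "\<dots> = (\<Prod>b\<in>Basis. (u - l) \<bullet> b)" unfolding prod_Basis_cart ..
  finally show "emeasure (distr lborel lborel R) (box l u) = ennreal (\<Prod>b\<in>Basis. (u - l) \<bullet> b)" .
qed simp

lemma measure_R_image: assumes S: "S \<in> sets borel" shows "measure lebesgue (R ` S) = measure lebesgue S"
proof -
  have RS: "R ` S \<in> sets borel" unfolding R_image using measurable_sets_borel[OF measurable_R' S] .
  have "measure lborel (R ` S) = measure (distr lborel lborel R) (R ` S)" unfolding distr_lborel_R ..
  also have "\<dots> = measure lborel (R -` (R ` S))" using RS by (subst measure_distr) auto
  also have "R -` (R ` S) = S" using inj_R by (rule inj_vimage_image_eq)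
  finally show ?thesis using S RS by (simp add: measure_completion)
qed

lemma polar_body_R_image: "polar_body (R ` K) = R ` polar_body K"
proof (rule set_eqI)
  fix y
  have "y \<in> polar_body (R ` K) \<longleftrightarrow> (\<forall>x\<in>K. R x \<bullet> R (R' y) \<le> 1)" by (auto simp: polar_body_def)
  also have "\<dots> \<longleftrightarrow> y \<in> R ` polar_body K" unfolding R_image by (simp only: inner_R) (simp add: polar_body_def)
  finally show "y \<in> polar_body (R ` K) \<longleftrightarrow> y \<in> R ` polar_body K" .
qed

lemma mahler_volume_R_image:
  assumes "compact K" shows "mahler_volume (R ` K) = mahler_volume K"
proof -
  have "polar_body K \<in> sets borel" by (rule borel_closed[OF closed_polar_body])
  then show ?thesis using assms
    by (simp add: mahler_volume_def polar_body_R_image measure_R_image borel_compact)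
qed

lemma centroid_R_image:
  assumes K: "compact K" shows "centroid (R ` K) = R (centroid K)"
proof -
  have bl: "bounded_linear R" using linear_R by (simp add: linear_linear)
  have [measurable]: "K \<in> sets borel" "R ` K \<in> sets borel"
    using K compact_continuous_image[OF continuous_R K] by (auto simp: borel_compact)
  have int: "integrable lborel (\<lambda>x. indicator K x *\<^sub>R x)" by (intro borel_integrable_compact K continuous_intros)
  have "(LINT y:R ` K|lebesgue. y) = (LINT y|lborel. indicator (R ` K) y *\<^sub>R y)"
    unfolding set_lebesgue_integral_def by (rule integral_completion) measurable
  also have "\<dots> = (LINT y|distr lborel lborel R. indicator (R ` K) y *\<^sub>R y)" unfolding distr_lborel_R ..
  also have "\<dots> = (LINT x|lborel. indicator (R ` K) (R x) *\<^sub>R R x)"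
    by (rule integral_distr) measurable
  also have "\<dots> = (LINT x|lborel. R (indicator K x *\<^sub>R x))"
    using inj_R by (intro Bochner_Integration.integral_cong) (auto simp: indicator_def inj_image_mem_iff)
  also have "\<dots> = R (LINT x|lborel. indicator K x *\<^sub>R x)"
    by (rule integral_bounded_linear[OF bl int])
  also have "(LINT x|lborel. indicator K x *\<^sub>R x) = (LINT x:K|lebesgue. x)"
    unfolding set_lebesgue_integral_def by (rule integral_completion[symmetric]) measurable
  finally show ?thesis
    unfolding centroid_def measure_R_image[OF borel_compact[OF K]] by (simp only: linear_cmul[OF linear_R])
qed

lemma simplex_R_image:
  assumes "k simplex S" shows "k simplex (R ` S)"
proof -
  obtain C where C: "\<not> affine_dependent C" "int (card C) = k + 1" "S = convex hull C"
    using assms unfolding simplex_def by blast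
  have fin: "finite C" using C(1) by (rule aff_independent_finite)
  have "\<not> affine_dependent (R ` C)"
  proof
    assume "affine_dependent (R ` C)"
    then obtain U where U: "sum U (R ` C) = 0" "\<exists>v\<in>R ` C. U v \<noteq> 0" "(\<Sum>v\<in>R ` C. U v *\<^sub>R v) = 0"
      unfolding affine_dependent_explicit_finite[OF finite_imageI[OF fin]] by blast
    have inj: "inj_on R C" using inj_R by (rule inj_on_subset) simp
    have "sum (U \<circ> R) C = 0" using U(1) by (simp add: sum.reindex[OF inj])
    moreover have "\<exists>v\<in>C. (U \<circ> R) v \<noteq> 0" using U(2) by auto
    moreover have "(\<Sum>v\<in>C. (U \<circ> R) v *\<^sub>R v) = 0"
    proof -
      have "R (\<Sum>v\<in>C. (U \<circ> R) v *\<^sub>R v) = (\<Sum>v\<in>C. U (R v) *\<^sub>R R v)"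
        using linear_R by (simp add: linear_sum linear_cmul)
      also have "\<dots> = 0" using U(3) by (simp add: sum.reindex[OF inj])
      finally have "R (\<Sum>v\<in>C. (U \<circ> R) v *\<^sub>R v) = R 0" by simp
      then show ?thesis using inj_R by (rule injD[rotated])
    qed
    ultimately have "affine_dependent C" unfolding affine_dependent_explicit_finite[OF fin] by blast
    then show False using C(1) by simp
  qed
  moreover have "card (R ` C) = card C" using inj_R by (intro card_image) (auto intro: inj_on_subset)
  moreover have "R ` S = convex hull (R ` C)" unfolding C(3) by (rule convex_hull_linear_image[OF linear_R])
  ultimately show ?thesis unfolding simplex_def using C(2) by metis
qed

end

lemma bij_idx_exists: obtains \<rho> :: "'n::finite idx \<Rightarrow> 'n" where "bij \<rho>"
proof -
  have "card (UNIV :: 'n idx set) = card (UNIV :: 'n set)" by (rule card_idx)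
  then obtain \<rho> :: "'n idx \<Rightarrow> 'n" where "bij_betw \<rho> UNIV UNIV"
    using finite_same_card_bij[of "UNIV :: 'n idx set" "UNIV :: 'n set"] by auto
  then show ?thesis by (rule that)
qed

theorem corollary1p8:
  fixes K :: "(real ^ 'n) set" and n :: nat
  defines "n \<equiv> CARD('n)"
  assumes "convex_body K" and "0 \<in> interior K"
  shows "mahler_volume K
           \<ge> 4 ^ n * fact n ^ 4 * pi ^ n / (fact (2 * n) ^ 2 * Gamma (real n / 2 + 1) ^ 2)
       \<and> (\<forall>\<Delta> :: (real ^ 'n) set. int n simplex \<Delta> \<and> centroid \<Delta> = 0 \<longrightarrow>
            4 ^ n * fact n ^ 4 * pi ^ n / (fact (2 * n) ^ 2 * Gamma (real n / 2 + 1) ^ 2)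
              = delta n * (pi / (2 * exp 1)) ^ n * mahler_volume \<Delta>)
       \<and> (\<forall>m\<ge>1. delta m \<ge> 2 * exp 1 / pi)
       \<and> delta \<longlonglongrightarrow> 2 * pi / exp 1"
proof (intro conjI allI impI)
  obtain \<rho> :: "'n idx \<Rightarrow> 'n" where \<rho>: "bij \<rho>" using bij_idx_exists by blast
  interpret reindexing \<rho> by unfold_locales (rule \<rho>)
  let ?G = "Gamma (real n / 2 + 1)"
  have K: "compact K" "convex K" using assms(2) by (auto simp: convex_body_def)
  obtain r where r: "r > 0" "cball 0 r \<subseteq> K" using assms(3) mem_interior_cball by blast
  show "4 ^ n * fact n ^ 4 * pi ^ n / (fact (2 * n) ^ 2 * ?G ^ 2) \<le> mahler_volume K"
  proof -
    have "cball 0 r \<subseteq> R ` K"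
    proof
      fix y :: "real ^ 'n idx" assume y: "y \<in> cball 0 r"
      have "norm (R' y) = norm y" using inner_R[of "R' y" "R' y"] by (simp add: norm_eq_sqrt_inner)
      then have "R' y \<in> K" using y r(2) by auto
      then show "y \<in> R ` K" by (simp add: R_image)
    qed
    moreover have "compact (R ` K)" "convex (R ` K)"
      using K by (auto intro: compact_continuous_image continuous_R convex_linear_image linear_R)
    ultimately have "4 ^ CARD('n idx) * fact CARD('n idx) ^ 4 * pi ^ CARD('n idx)
        / (fact (2 * CARD('n idx)) ^ 2 * Gamma (real CARD('n idx) / 2 + 1) ^ 2) \<le> mahler_volume (R ` K)"
      by (intro mahler_volume_ge[OF _ _ r(1)])
    then show ?thesis unfolding card_idx n_def mahler_volume_R_image[OF K(1)] .
  qed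
  show "4 ^ n * fact n ^ 4 * pi ^ n / (fact (2 * n) ^ 2 * ?G ^ 2)
      = delta n * (pi / (2 * exp 1)) ^ n * mahler_volume \<Delta>"
    if \<Delta>: "int n simplex \<Delta> \<and> centroid \<Delta> = 0" for \<Delta> :: "(real ^ 'n) set"
  proof -
    have c\<Delta>: "compact \<Delta>" using \<Delta> compact_simplex by blast
    have "int CARD('n idx) simplex (R ` \<Delta>)" using \<Delta> unfolding n_def card_idx by (blast intro: simplex_R_image)
    moreover have "centroid (R ` \<Delta>) = 0" using \<Delta> by (simp add: centroid_R_image[OF c\<Delta>])
    ultimately have "mahler_volume (R ` \<Delta>) = (real CARD('n idx) + 1) ^ (CARD('n idx) + 1) / fact CARD('n idx) ^ 2"
      by (rule mahler_volume_simplex)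
    then have v: "mahler_volume \<Delta> = (real n + 1) ^ (n + 1) / fact n ^ 2"
      unfolding card_idx n_def mahler_volume_R_image[OF c\<Delta>] .
    \<comment> \<open>In these quantities the identity is rational: \<open>X\<close> and
      \<open>E\<close> cancel, and 4^n and 8^n are powers of \<open>q\<close>.\<close>
    define p q f H E X where "p = pi ^ n" and "q = (2 :: real) ^ n" and "f = (fact n :: real)"
      and "H = (fact (2 * n) :: real)" and "E = exp (1 :: real) ^ n" and "X = (real n + 1) ^ (n + 1)"
    define g where "g = ?G"
    have "f > 0" "H > 0" "E > 0" "X > 0" "q > 0" "g > 0"
      using Gamma_half_pos(1)[of n] by (auto simp: f_def H_def E_def X_def q_def g_def)
    then have "q\<^sup>2 * f ^ 4 * p / (H\<^sup>2 * g\<^sup>2) = q ^ 3 * f ^ 6 * E / (H\<^sup>2 * g\<^sup>2 * X) * (p / (q * E)) * (X / f\<^sup>2)"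
      by (simp add: field_simps eval_nat_numeral)
    moreover have "(4 :: real) ^ n = q\<^sup>2" "(8 :: real) ^ n = q ^ 3"
      by (simp_all add: q_def power_mult[symmetric] mult.commute[of n]) (simp_all add: power_mult)
    ultimately show ?thesis
      unfolding v delta_def power_divide power_mult_distrib by (simp only: p_def q_def f_def H_def E_def X_def g_def)
  qed
  show "2 * exp 1 / pi \<le> delta m" if "1 \<le> m" for m using that by (rule delta_ge)
  show "delta \<longlonglongrightarrow> 2 * pi / exp 1" by (rule delta_limit)
qed

end
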